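(* There exist absolute constants $D_1,D_2>0$ such that the following holds. Let $\mathbf{A}\in\mathbb{R}^{d_1\times d_2\times d_3}$ be a deterministic tensor, and let $\mathbf{Y}=\mathbf{A}+\mathbf{Z}$, where $\mathbf{Z}\in\mathbb{R}^{d_1\times d_2\times d_3}$ has i.i.d. $\mathcal{N}(0,\sigma^2)$ entries, $\sigma>0$. Let $\mathbf{M}:=\mathcal{M}_1(\mathbf{A})\in\mathbb{R}^{d_1\times(d_2d_3)}$ be the mode-1 unfolding of $\mathbf{A}$, let $\delta(d_1,d_2,d_3):=\sigma d_1^{1/2}\|\mathbf{M}\|+\sigma^2(d_1d_2d_3)^{1/2}$, and suppose $d_2d_3e^{-d_1/2}\le 1$. Let $1\le k\le \mathrm{rank}(\mathbf{M})$, suppose the $k$-th largest singular value of $\mathbf{M}$ has multiplicity $1$, let $\mathbf{u}_k$ be the corresponding (unit) left singular vector of $\mathbf{M}$, and let $\hat{\mathbf{u}}_k$ be the $k$-th (unit) left singular vector of $\mathcal{M}_1(\mathbf{Y})$, with sign chosen so that $\langle\hat{\mathbf{u}}_k,\mathbf{u}_k\rangle>0$. If $\bar g_k(\mathbf{M}\mathbf{M}^\top)\ge D_1\delta(d_1,d_2,d_3)$, then there exists a constant $b_k\in[-1/2,0]$ with $|b_k|\le \frac{\sqrt2\,\delta(d_1,d_2,d_3)}{\bar g_k(\mathbf{M}\mathbf{M}^\top)}$ (deterministic, not depending on $\mathbf{x}$ or $t$ below) such that for any $\mathbf{x}\in\mathbb{R}^{d_1}$ and all $\log 8\le t\le d_1$,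 with probability at least $1-e^{-t}$, $$\big|\langle\hat{\mathbf{u}}_k,\mathbf{x}\rangle-(1+b_k)^{1/2}\langle\mathbf{u}_k,\mathbf{x}\rangle\big|\le D_2\bigg(t^{1/2}\frac{\sigma\|\mathbf{M}\|+\sigma^2(d_2d_3)^{1/2}}{\bar g_k(\mathbf{M}\mathbf{M}^\top)}+\frac{\sigma^2d_1}{\bar g_k(\mathbf{M}\mathbf{M}^\top)}\Big(\frac{\delta(d_1,d_2,d_3)}{\bar g_k(\mathbf{M}\mathbf{M}^\top)}\Big)\bigg)\|\mathbf{x}\|_{\ell_2}.$$ In particular, taking $\mathbf{x}=\pm\mathbf{u}_k$, with the same probability, $$\big||\langle\hat{\mathbf{u}}_k,\mathbf{u}_k\rangle|-1\big|\le\big|\sqrt{1+b_k}-1\big|+D_2\bigg(t^{1/2}\frac{\sigma\|\mathbf{M}\|+\sigma^2(d_2d_3)^{1/2}}{\bar g_k(\mathbf{M}\mathbf{M}^\top)}+\frac{\sigma^2d_1}{\bar g_k(\mathbf{M}\mathbf{M}^\top)}\Big(\frac{\delta(d_1,d_2,d_3)}{\bar g_k(\mathbf{M}\mathbf{M}^\top)}\Big)\bigg).$$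
   Context: The mode-1 unfolding $\mathcal{M}_1:\mathbb{R}^{d_1\times d_2\times d_3}\to\mathbb{R}^{d_1\times(d_2d_3)}$ is given by $\mathcal{M}_1(\mathbf{A})(i_1,(i_2-1)d_3+i_3)=A(i_1,i_2,i_3)$. $\|\cdot\|$ is the operator norm of a matrix and $\|\cdot\|_{\ell_2}$ the Euclidean norm. Singular values are arranged in non-increasing order; the $k$-th left singular vector corresponds to the $k$-th largest singular value. For a rank $r$ matrix with nonzero singular values $\lambda_1\ge\dots\ge\lambda_r>0$, and with the conventions $\lambda_0=+\infty$, $\lambda_{r+1}=0$, the $k$-th eigengap is $\bar g_k:=\min(\lambda_k-\lambda_{k+1},\lambda_{k-1}-\lambda_k)$, $1\le k\le r$. In particular $\bar g_k(\mathbf{M}\mathbf{M}^\top)=\min(\lambda_k^2-\lambda_{k+1}^2,\lambda_{k-1}^2-\lambda_k^2)$ where $\lambda_j$ are the singular values of $\mathbf{M}$. *)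

theory Defs
  imports
    "HOL-Probability.Probability"
    "Jordan_Normal_Form.Char_Poly"
    "Jordan_Normal_Form.DL_Rank"
begin

text \<open>
  Since the dimensions are quantified after the absolute constants, matrices and vectors
  are those of \<^theory>\<open>Jordan_Normal_Form.Matrix\<close>, with the dimensions as values. A
  \<open>d1 \<times> d2 \<times> d3\<close> tensor is a function on index triples of which only the values on
  \<open>tensor_index d1 d2 d3\<close> matter. Tensor and matrix indices start at 0; the ranks \<open>k\<close> of
  singular values start at 1.
\<close>

type_synonym tensor = "nat \<times> nat \<times> nat \<Rightarrow> real"

definition tensor_index :: "nat \<Rightarrow> nat \<Rightarrow> nat \<Rightarrow> (nat \<times> nat \<times> nat) set" where
  "tensor_index d1 d2 d3 = {..<d1} \<times> {..<d2} \<times> {..<d3}"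

definition unfold1 :: "nat \<Rightarrow> nat \<Rightarrow> nat \<Rightarrow> tensor \<Rightarrow> real mat" where
  "unfold1 d1 d2 d3 A = mat d1 (d2 * d3) (\<lambda>(i, j). A (i, j div d3, j mod d3))"

lemma unfold1_index:
  assumes "i1 < d1" "i2 < d2" "i3 < d3"
  shows "unfold1 d1 d2 d3 A $$ (i1, i2 * d3 + i3) = A (i1, i2, i3)"
proof -
  have "i2 * d3 + i3 < Suc i2 * d3"
    using assms(3) by simp
  also have "\<dots> \<le> d2 * d3"
    using assms(2) by (intro mult_le_mono1) simp
  finally show ?thesis
    using assms by (simp add: unfold1_def)
qed

definition vnorm :: "real vec \<Rightarrow> real" where
  "vnorm v = L2_set (\<lambda>i. vec_index v i) {..<dim_vec v}"

definition op_norm :: "real mat \<Rightarrow> real" where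
  "op_norm M = (SUP x\<in>{x \<in> carrier_vec (dim_col M). vnorm x \<le> 1}. vnorm (M *\<^sub>v x))"

text \<open>
  The square roots of the eigenvalues of \<open>M M\<^sup>T\<close>, counted with multiplicity and in
  non-increasing order. This list has \<open>dim_row M\<close> entries: if \<open>dim_row M > dim_col M\<close>, it is
  the usual list of \<open>min (dim_row M) (dim_col M)\<close> singular values padded with zeros.
\<close>

definition sing_vals :: "real mat \<Rightarrow> real list" where
  "sing_vals M = map sqrt (rev (sorted_list_of_multiset (proots (char_poly (M * M\<^sup>T)))))"

text \<open>The \<open>j\<close>-th largest singular value (\<open>j \<ge> 1\<close>); 0 for \<open>j\<close> beyond the rank of \<open>M\<close>.\<close>

definition sing_val :: "real mat \<Rightarrow> nat \<Rightarrow> real" where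
  "sing_val M j = (if 1 \<le> j \<and> j \<le> length (sing_vals M) then sing_vals M ! (j - 1) else 0)"

definition is_left_sing_vec :: "real mat \<Rightarrow> nat \<Rightarrow> real vec \<Rightarrow> bool" where
  "is_left_sing_vec M k u \<longleftrightarrow>
     u \<in> carrier_vec (dim_row M) \<and> vnorm u = 1 \<and>
     (\<exists>v \<in> carrier_vec (dim_col M). vnorm v = 1 \<and>
        M *\<^sub>v v = sing_val M k \<cdot>\<^sub>v u \<and> M\<^sup>T *\<^sub>v u = sing_val M k \<cdot>\<^sub>v v)"

text \<open>
  The case \<open>k = 1\<close> is the convention that the 0-th singular value is \<open>+\<infinity>\<close>, so that the
  second argument of the minimum drops out.
\<close>

definition eigengap :: "real mat \<Rightarrow> nat \<Rightarrow> real" where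
  "eigengap B k =
     (if k = 1 then sing_val B 1 - sing_val B 2
      else min (sing_val B k - sing_val B (k + 1)) (sing_val B (k - 1) - sing_val B k))"

text \<open>The law of a tensor with i.i.d. centred normal entries of standard deviation \<open>\<sigma>\<close>.\<close>

definition gaussian_tensor :: "nat \<Rightarrow> nat \<Rightarrow> nat \<Rightarrow> real \<Rightarrow> tensor measure" where
  "gaussian_tensor d1 d2 d3 \<sigma> =
     Pi\<^sub>M (tensor_index d1 d2 d3) (\<lambda>_. density lborel (normal_density 0 \<sigma>))"

end

(* Put T = Y Y^T for the unfolding Y of the noisy tensor. With probability at least 1 - 4 exp(-4 d1),
   T - M M^T - d2 d3 sigma^2 I has operator norm O(delta) (a net of the unit ball and Chernoff bounds for
   its quadratic form). On this event, Weyl's inequality and the Davis-Kahan argument show that u_hat is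
   a Lipschitz function of the noise, with constant of order (|M| + sigma sqrt(d2 d3)) / g. A linear form
   <u_hat, x> therefore concentrates around any of its quantiles. For this one needs no differentiability
   and no extension of u_hat: property (tau) of the normal distribution bounds P(A) P(B) by
   exp(-r^2 / (4 sigma^2)) for sets A, B at distance r.

   It remains to find the centre. If x is orthogonal to u, then 0 is a median of <u_hat, x> up to the bad
   event: reflecting Y in u and in the right singular vector of M preserves M and the law of the noise, and
   it changes the sign of <u_hat, x>. For x = u let m be an approximate median of <u_hat, u>; then
   b = m^2 - 1. *)

theory Submission
  imports Defs
begin

text \<open>Off the good event \<open>u_hat\<close> has no useful regularity. On it, the gap makes
  the k-th left singular vector unique up to sign, and \<open>u\<close> fixes the sign. So the
  Lipschitz bound is claimed only for pairs of points of the event, which is exactly what a two-set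
  form of concentration can use. Comparing with M M^T + d2 d3 sigma^2 I instead of M M^T is free,
  since a multiple of the identity moves neither eigenvectors nor gaps; it leaves a fluctuation of
  order sigma^2 sqrt(d1 d2 d3) where sigma^2 d2 d3 would be too large. Splitting x into its part
  along u and the rest makes b independent of x: only the first part is biased. One approximate
  median, with tolerance (Lipschitz constant) * sigma, serves every t because t >= 1 absorbs the
  tolerance. The median inherits the range of <u_hat, u>, and the squared sine of the angle is
  quadratic in delta / g; a large gap constant turns this into |b| <= delta / g. The price of the
  event, 4 exp(-4 d1), is affordable because t <= d1.\<close>

no_notation inner (infix "\<bullet>" 70)
no_notation vec_nth (infixl "$" 90)

section \<open>Gaussian concentration\<close>

text \<open>Write \<open>f x\<close> as the length of the interval [0, f x) and exchange the two
  integrals.\<close>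

lemma nn_integral_layer_cake:
  fixes f :: "real \<Rightarrow> real"
  assumes f[measurable]: "f \<in> borel_measurable borel" and nonneg: "\<And>x. 0 \<le> f x"
  shows "(\<integral>\<^sup>+x. ennreal (f x) \<partial>lborel)
       = (\<integral>\<^sup>+s. indicator {0..} s * emeasure lborel {x. s < f x} \<partial>lborel)"
proof -
  have "(\<integral>\<^sup>+x. ennreal (f x) \<partial>lborel) = (\<integral>\<^sup>+x. (\<integral>\<^sup>+s. indicator {0..<f x} s \<partial>lborel) \<partial>lborel)"
    using nonneg by (intro nn_integral_cong) simp
  also have "\<dots> = (\<integral>\<^sup>+x. (\<integral>\<^sup>+s. indicator {p. 0 \<le> snd p \<and> snd p < f (fst p)} (x, s) \<partial>lborel) \<partial>lborel)"
    by (intro nn_integral_cong) (auto simp: indicator_def)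
  also have "\<dots> = (\<integral>\<^sup>+s. (\<integral>\<^sup>+x. indicator {p. 0 \<le> snd p \<and> snd p < f (fst p)} (x, s) \<partial>lborel) \<partial>lborel)"
    by (rule lborel_pair.Fubini'[symmetric]) (simp add: case_prod_beta')
  also have "\<dots> = (\<integral>\<^sup>+s. (\<integral>\<^sup>+x. indicator {0..} s * indicator {x. s < f x} x \<partial>lborel) \<partial>lborel)"
    by (intro nn_integral_cong) (auto simp: indicator_def)
  also have "\<dots> = (\<integral>\<^sup>+s. indicator {0..} s * emeasure lborel {x. s < f x} \<partial>lborel)"
    by (intro nn_integral_cong) (simp add: nn_integral_cmult)
  finally show ?thesis .
qed

text \<open>Each set has at most the length of its hull [Inf, Sup], and the suprema add up to at
  most \<open>r\<close>, the infima to at least \<open>-r\<close>. The sumset itself is never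
  measured; only its inclusion in a symmetric interval matters.\<close>

lemma emeasure_add_le_of_abs_add_less:
  fixes A B :: "real set"
  assumes [measurable]: "A \<in> sets borel" "B \<in> sets borel" and "A \<noteq> {}" "B \<noteq> {}"
    and less: "\<And>x y. x \<in> A \<Longrightarrow> y \<in> B \<Longrightarrow> \<bar>x + y\<bar> < r"
  shows "emeasure lborel A + emeasure lborel B \<le> ennreal (2 * r)"
proof -
  obtain a b where ab: "a \<in> A" "b \<in> B" using assms by auto
  have *: "x \<le> r - b" "- r - b \<le> x" if "x \<in> A" for x
    using less[OF that ab(2)] by linarith+
  have **: "x \<le> r - a" "- r - a \<le> x" if "x \<in> B" for x
    using less[OF ab(1) that] by linarith+
  have bA: "bdd_above A" "bdd_below A"
    by (rule bdd_aboveI[OF *(1)], assumption, rule bdd_belowI[OF *(2)], assumption)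
  have bB: "bdd_above B" "bdd_below B"
    by (rule bdd_aboveI[OF **(1)], assumption, rule bdd_belowI[OF **(2)], assumption)
  have "A \<subseteq> {Inf A..Sup A}" "B \<subseteq> {Inf B..Sup B}"
    using bA bB by (auto intro: cInf_lower cSup_upper)
  then have "emeasure lborel A \<le> emeasure lborel {Inf A..Sup A}" "emeasure lborel B \<le> emeasure lborel {Inf B..Sup B}"
    by (auto intro!: emeasure_mono)
  moreover have "Inf A \<le> Sup A" "Inf B \<le> Sup B"
    using ab bA bB by (meson cInf_lower cSup_upper order_trans)+
  ultimately have "emeasure lborel A + emeasure lborel B \<le> ennreal (Sup A - Inf A) + ennreal (Sup B - Inf B)"
    by (auto intro!: add_mono)
  also have "\<dots> = ennreal ((Sup A - Inf A) + (Sup B - Inf B))"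
    using \<open>Inf A \<le> Sup A\<close> \<open>Inf B \<le> Sup B\<close> by (simp add: ennreal_plus)
  also have "\<dots> \<le> ennreal (2 * r)"
  proof (rule ennreal_leI)
    have "Sup A \<le> r - y" if "y \<in> B" for y
    proof (rule cSup_least[OF \<open>A \<noteq> {}\<close>])
      show "x \<le> r - y" if "x \<in> A" for x using less[OF that \<open>y \<in> B\<close>] by linarith
    qed
    then have "y \<le> r - Sup A" if "y \<in> B" for y
      using that by (simp add: algebra_simps)
    then have "Sup B \<le> r - Sup A"
      using \<open>B \<noteq> {}\<close> by (intro cSup_least) auto
    moreover have "- r - y \<le> Inf A" if "y \<in> B" for y
    proof (rule cInf_greatest[OF \<open>A \<noteq> {}\<close>])
      show "- r - y \<le> x" if "x \<in> A" for x using less[OF that \<open>y \<in> B\<close>] by linarith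
    qed
    then have "- r - Inf A \<le> y" if "y \<in> B" for y
      using that by (simp add: algebra_simps)
    then have "- r - Inf A \<le> Inf B"
      using \<open>B \<noteq> {}\<close> by (intro cInf_greatest) auto
    ultimately show "(Sup A - Inf A) + (Sup B - Inf B) \<le> 2 * r" by linarith
  qed
  finally show ?thesis .
qed

text \<open>The parallelogram identity in the exponent: the quadratic cost is exactly the midpoint
  defect of the log-density, so this is an equality. It is the source of the factor 4 in all later
  concentration bounds.\<close>

lemma normal_density_mult_le_midpoint:
  fixes \<sigma> :: real assumes "0 < \<sigma>"
  shows "exp ((x - y)\<^sup>2 / (4 * \<sigma>\<^sup>2)) * (normal_density 0 \<sigma> x * normal_density 0 \<sigma> y)
       = (normal_density 0 \<sigma> ((x + y) / 2))\<^sup>2"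
proof -
  have e: "exp ((x - y)\<^sup>2 / (4 * \<sigma>\<^sup>2)) * (exp (- x\<^sup>2 / (2 * \<sigma>\<^sup>2)) * exp (- y\<^sup>2 / (2 * \<sigma>\<^sup>2)))
     = (exp (- ((x + y) / 2)\<^sup>2 / (2 * \<sigma>\<^sup>2)))\<^sup>2"
    using assms by (simp add: exp_add[symmetric] power2_eq_square field_simps)
  then show ?thesis
    by (simp add: normal_density_def power_mult_distrib power_divide)
qed

lemma normal_density_superlevel:
  fixes \<sigma> :: real assumes "0 < \<sigma>" "0 < s" "s < normal_density 0 \<sigma> a"
  obtains r where "0 < r" "{x. s < normal_density 0 \<sigma> x} = {-r<..<r}"
proof -
  let ?c = "1 / sqrt (2 * pi * \<sigma>\<^sup>2)"
  have c: "0 < ?c" using assms by simp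
  define q where "q = - 2 * \<sigma>\<^sup>2 * ln (s / ?c)"
  have *: "s < normal_density 0 \<sigma> x \<longleftrightarrow> x\<^sup>2 < q" for x
  proof -
    have "s < normal_density 0 \<sigma> x \<longleftrightarrow> s / ?c < exp (- x\<^sup>2 / (2 * \<sigma>\<^sup>2))"
      using c by (simp add: normal_density_def field_simps)
    also have "\<dots> \<longleftrightarrow> ln (s / ?c) < - x\<^sup>2 / (2 * \<sigma>\<^sup>2)"
      using c assms by (metis exp_less_cancel_iff exp_ln divide_pos_pos)
    also have "\<dots> \<longleftrightarrow> x\<^sup>2 < q"
      unfolding q_def using assms by (simp add: field_simps) (smt (verit))
    finally show ?thesis .
  qed
  have "0 < q" using * assms(3) zero_le_power2[of a] by (meson le_less_trans)
  show ?thesis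
  proof (rule that[of "sqrt q"])
    show "0 < sqrt q" using \<open>0 < q\<close> by simp
    have **: "x\<^sup>2 < q \<longleftrightarrow> \<bar>x\<bar> < sqrt q" for x
      using real_sqrt_less_iff[of "x\<^sup>2" q] by simp
    show "{x. s < normal_density 0 \<sigma> x} = {-sqrt q<..<sqrt q}"
      unfolding * ** by (auto simp: abs_less_iff)
  qed
qed

text \<open>Level 0 is a null set of levels, and levels from 1 on have empty superlevel sets. What
  remains are the levels at which functions normalized to supremum 1 have nonempty superlevel
  sets.\<close>

lemma nn_integral_le_of_superlevel:
  fixes f :: "real \<Rightarrow> real"
  assumes [measurable]: "f \<in> borel_measurable borel" and "\<And>x. 0 \<le> f x" "\<And>x. f x \<le> 1"
  shows "(\<integral>\<^sup>+x. ennreal (f x) \<partial>lborel)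
       = (\<integral>\<^sup>+s. indicator {0<..<1} s * emeasure lborel {x. s < f x} \<partial>lborel)"
proof -
  have "AE s in lborel. s \<noteq> (0::real)" by (rule AE_lborel_singleton)
  then have "AE s in lborel. indicator {0..} s * emeasure lborel {x. s < f x}
    = indicator {0<..<1} s * emeasure lborel {x. s < f x}"
  proof (rule eventually_mono)
    fix s :: real assume "s \<noteq> 0"
    have "{x. s < f x} = {}" if "1 \<le> s" using assms(3) that by (force simp: not_less intro: order_trans)
    then show "indicator {0..} s * emeasure lborel {x. s < f x}
      = indicator {0<..<1} s * emeasure lborel {x. s < f x}"
      using \<open>s \<noteq> 0\<close> by (cases "1 \<le> s") (auto simp: indicator_def)
  qed
  then show ?thesis
    unfolding nn_integral_layer_cake[OF assms(1,2)] by (rule nn_integral_cong_AE)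
qed

text \<open>The superlevel sets of the normal density are intervals, so that no Brunn-Minkowski inequality
  is needed.\<close>

lemma prekopa_leindler_normal:
  fixes f h :: "real \<Rightarrow> real"
  assumes \<sigma>: "0 < \<sigma>" and [measurable]: "f \<in> borel_measurable borel" "h \<in> borel_measurable borel"
    and nonneg: "\<And>x. 0 \<le> f x" "\<And>x. 0 \<le> h x"
    and le: "\<And>x y. f x * h y \<le> (normal_density 0 \<sigma> ((x + y) / 2))\<^sup>2"
  shows "(\<integral>\<^sup>+x. ennreal (f x) \<partial>lborel) * (\<integral>\<^sup>+x. ennreal (h x) \<partial>lborel) \<le> 1"
proof (cases "(\<exists>a. f a \<noteq> 0) \<and> (\<exists>b. h b \<noteq> 0)")
  case False
  then have "(\<integral>\<^sup>+x. ennreal (f x) \<partial>lborel) = 0 \<or> (\<integral>\<^sup>+x. ennreal (h x) \<partial>lborel) = 0"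
    by auto
  then show ?thesis by auto
next
  case True
  then obtain a b where a: "0 < f a" and b: "0 < h b"
    using nonneg by (metis less_eq_real_def)
  let ?\<phi> = "normal_density 0 \<sigma>"
  have peak: "?\<phi> x \<le> ?\<phi> 0" for x
    using \<sigma> by (simp add: normal_density_def divide_right_mono)
  have \<phi>0: "(?\<phi> x)\<^sup>2 \<le> (?\<phi> 0)\<^sup>2" for x using peak by (intro power_mono) auto
  \<comment> \<open>After division by their suprema both functions exceed every level s < 1
    somewhere, so their superlevel sets are nonempty, as the bound for sums of two sets requires.
    The geometric mean \<open>w\<close> is the matching normalization of the density at the
    midpoint.\<close>
  define U V where "U = Sup (range f)" and "V = Sup (range h)"
  have "f x \<le> (?\<phi> 0)\<^sup>2 / h b" for x
    using order_trans[OF le[of x b] \<phi>0] b by (simp add: field_simps)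
  then have bdf: "bdd_above (range f)" by (intro bdd_aboveI2)
  have "h x \<le> (?\<phi> 0)\<^sup>2 / f a" for x
    using order_trans[OF le[of a x] \<phi>0] a by (simp add: field_simps)
  then have bdh: "bdd_above (range h)" by (intro bdd_aboveI2)
  have fU: "f x \<le> U" for x unfolding U_def using bdf by (auto intro: cSup_upper)
  have hV: "h x \<le> V" for x unfolding V_def using bdh by (auto intro: cSup_upper)
  have U: "0 < U" using a fU[of a] by linarith
  have V: "0 < V" using b hV[of b] by linarith
  define w where "w = sqrt (U * V)"
  have w: "0 < w" unfolding w_def using U V by simp
  have level: "emeasure lborel {x. s < f x / U} + emeasure lborel {x. s < h x / V}
      \<le> 2 * emeasure lborel {x. s < min 1 (?\<phi> x / w)}" if s: "0 < s" "s < 1" for s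
  proof -
    have "s * U < U" "s * V < V" using s U V by auto
    then obtain a' b' where a': "s * U < f a'" and b': "s * V < h b'"
      unfolding U_def V_def using less_cSup_iff[OF _ bdf, of "s * Sup (range f)"] less_cSup_iff[OF _ bdh, of "s * Sup (range h)"] by auto
    have *: "s * w < ?\<phi> ((x + y) / 2)" if "s * U < f x" "s * V < h y" for x y
    proof -
      have "(s * w)\<^sup>2 = (s * U) * (s * V)"
        unfolding w_def using U V by (simp add: power_mult_distrib power2_eq_square[of s])
      also have "\<dots> < f x * h y"
      proof (rule mult_strict_mono[OF that])
        have "0 < s * U" using s U by simp
        then show "0 < f x" using that by linarith
        show "0 \<le> s * V" using s V by simp
      qed
      also have "\<dots> \<le> (?\<phi> ((x + y) / 2))\<^sup>2" by (rule le)
      finally show ?thesis by (rule power2_less_imp_less) simp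
    qed
    obtain r where r: "0 < r" "{x. s * w < ?\<phi> x} = {-r<..<r}"
      using normal_density_superlevel[OF \<sigma>, of "s * w"] *[OF a' b'] s w by (metis mult_pos_pos)
    have "emeasure lborel {x. s * U < f x} + emeasure lborel {x. s * V < h x} \<le> ennreal (2 * (2 * r))"
    proof (rule emeasure_add_le_of_abs_add_less)
      show "{x. s * U < f x} \<noteq> {}" "{x. s * V < h x} \<noteq> {}" using a' b' by auto
      fix x y assume "x \<in> {x. s * U < f x}" "y \<in> {x. s * V < h x}"
      then have "(x + y) / 2 \<in> {-r<..<r}" using * unfolding r(2)[symmetric] by auto
      then show "\<bar>x + y\<bar> < 2 * r" by auto
    qed auto
    moreover have "{x. s < min 1 (?\<phi> x / w)} = {-r<..<r}"
      using r(2) s w by (auto simp: field_simps)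
    then have "emeasure lborel {x. s < min 1 (?\<phi> x / w)} = ennreal (2 * r)"
      using r(1) by simp
    moreover have "{x. s < f x / U} = {x. s * U < f x}" "{x. s < h x / V} = {x. s * V < h x}"
      using U V by (auto simp: field_simps)
    moreover have "2 * ennreal (2 * r) = ennreal (2 * (2 * r))"
      using r(1) by (simp add: ennreal_mult)
    ultimately show ?thesis by simp
  qed
  \<comment> \<open>Integrate \<open>level\<close> over 0 < s < 1. The truncation by
    \<open>min 1\<close> puts the density in the range of the layer formula and is then simply
    dropped.\<close>
  have "(\<integral>\<^sup>+x. ennreal (f x / U) \<partial>lborel) + (\<integral>\<^sup>+x. ennreal (h x / V) \<partial>lborel)
     = (\<integral>\<^sup>+s. indicator {0<..<1} s * (emeasure lborel {x. s < f x / U} + emeasure lborel {x. s < h x / V}) \<partial>lborel)"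
    using U V fU hV nonneg
    by (subst (1 2) nn_integral_le_of_superlevel) (auto simp: nn_integral_add[symmetric] distrib_left)
  also have "\<dots> \<le> (\<integral>\<^sup>+s. 2 * (indicator {0<..<1} s * emeasure lborel {x. s < min 1 (?\<phi> x / w)}) \<partial>lborel)"
    using level by (intro nn_integral_mono) (auto simp: indicator_def)
  also have "\<dots> = 2 * (\<integral>\<^sup>+x. ennreal (min 1 (?\<phi> x / w)) \<partial>lborel)"
    using w by (subst nn_integral_cmult) (auto simp: nn_integral_le_of_superlevel)
  also have "\<dots> \<le> 2 * (\<integral>\<^sup>+x. ennreal (1 / w) * ennreal (?\<phi> x) \<partial>lborel)"
    using w by (intro mult_left_mono nn_integral_mono) (auto simp: ennreal_mult[symmetric] intro!: ennreal_leI)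
  also have "\<dots> = 2 * ennreal (1 / w)"
    using prob_space.emeasure_space_1[OF prob_space_normal_density[OF \<sigma>, of 0]]
    by (simp add: nn_integral_cmult emeasure_density)
  also have "\<dots> = ennreal (2 / w)"
    using w by (simp add: ennreal_mult[symmetric] ennreal_numeral[symmetric] del: ennreal_numeral)
  finally have sum: "(\<integral>\<^sup>+x. ennreal (f x / U) \<partial>lborel) + (\<integral>\<^sup>+x. ennreal (h x / V) \<partial>lborel) \<le> ennreal (2 / w)" .
  define p q where "p = enn2real (\<integral>\<^sup>+x. ennreal (f x / U) \<partial>lborel)" and "q = enn2real (\<integral>\<^sup>+x. ennreal (h x / V) \<partial>lborel)"
  have fin: "(\<integral>\<^sup>+x. ennreal (f x / U) \<partial>lborel) < \<top>" "(\<integral>\<^sup>+x. ennreal (h x / V) \<partial>lborel) < \<top>"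
    using sum by (auto simp: top.not_eq_extremum[symmetric] top_unique add_top)
  then have pq: "(\<integral>\<^sup>+x. ennreal (f x / U) \<partial>lborel) = ennreal p" "(\<integral>\<^sup>+x. ennreal (h x / V) \<partial>lborel) = ennreal q" "0 \<le> p" "0 \<le> q"
    unfolding p_def q_def by (auto simp: enn2real_nonneg)
  have "p + q \<le> 2 / w" using sum pq w by (simp add: ennreal_plus[symmetric] del: ennreal_plus)
  then have "w * (p + q) \<le> 2" using w by (simp add: field_simps)
  then have "(w * (p + q))\<^sup>2 \<le> 2\<^sup>2" using w pq by (intro power_mono) auto
  then have "w\<^sup>2 * (p + q)\<^sup>2 \<le> 4" by (simp add: power_mult_distrib)
  \<comment> \<open>The arithmetic-geometric mean inequality turns the additive bound p + q <= 2 / w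
    into p q <= 1 / w^2; since w^2 = U V, undoing the normalization gives 1.\<close>
  moreover have "4 * (p * q) \<le> (p + q)\<^sup>2"
    using sum_squares_bound[of p q] by (simp add: power2_sum)
  then have "w\<^sup>2 * (4 * (p * q)) \<le> w\<^sup>2 * (p + q)\<^sup>2" by (rule mult_left_mono) simp
  ultimately have "w\<^sup>2 * (4 * (p * q)) \<le> 4" by linarith
  then have fin: "w\<^sup>2 * (p * q) \<le> 1" by simp
  have "(\<integral>\<^sup>+x. ennreal (f x) \<partial>lborel) = (\<integral>\<^sup>+x. ennreal U * ennreal (f x / U) \<partial>lborel)"
    using U nonneg by (intro nn_integral_cong) (simp add: ennreal_mult[symmetric])
  also have "\<dots> = ennreal (U * p)" using U pq by (simp add: nn_integral_cmult ennreal_mult)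
  finally have F: "(\<integral>\<^sup>+x. ennreal (f x) \<partial>lborel) = ennreal (U * p)" .
  have "(\<integral>\<^sup>+x. ennreal (h x) \<partial>lborel) = (\<integral>\<^sup>+x. ennreal V * ennreal (h x / V) \<partial>lborel)"
    using V nonneg by (intro nn_integral_cong) (simp add: ennreal_mult[symmetric])
  also have "\<dots> = ennreal (V * q)" using V pq by (simp add: nn_integral_cmult ennreal_mult)
  finally have H: "(\<integral>\<^sup>+x. ennreal (h x) \<partial>lborel) = ennreal (V * q)" .
  have UV: "(U * p) * (V * q) = w\<^sup>2 * (p * q)" unfolding w_def using U V by simp
  then have "(U * p) * (V * q) \<le> 1" unfolding UV using fin by (simp only:)
  then show ?thesis unfolding F H using U V pq
    by (simp add: ennreal_mult[symmetric] ennreal_le_1 del: mult_le_0_iff)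
qed


section \<open>Property (tau) for product normal measures\<close>

abbreviation normal_measure :: "real \<Rightarrow> real measure" where
  "normal_measure \<sigma> \<equiv> density lborel (\<lambda>x. ennreal (normal_density 0 \<sigma> x))"

lemma product_sigma_finite_normal: "0 < \<sigma> \<Longrightarrow> product_sigma_finite (\<lambda>_. normal_measure \<sigma>)"
  unfolding product_sigma_finite_def by (simp add: prob_space_imp_sigma_finite prob_space_normal_density)

text \<open>Weighting \<open>a\<close> and \<open>b\<close> by the density turns the assumption,
  through the midpoint identity, into that of the Prekopa-Leindler inequality.\<close>

lemma property_tau_normal:
  fixes a b :: "real \<Rightarrow> ennreal"
  assumes \<sigma>: "0 < \<sigma>" and [measurable]: "a \<in> borel_measurable borel" "b \<in> borel_measurable borel"
    and le: "\<And>x y. a x * b y \<le> ennreal (exp ((x - y)\<^sup>2 / (4 * \<sigma>\<^sup>2)))"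
  shows "(\<integral>\<^sup>+x. a x \<partial>normal_measure \<sigma>) * (\<integral>\<^sup>+x. b x \<partial>normal_measure \<sigma>) \<le> 1"
proof (cases "(\<exists>x. a x \<noteq> 0) \<and> (\<exists>y. b y \<noteq> 0)")
  case False
  then have "(\<forall>x. a x = 0) \<or> (\<forall>x. b x = 0)" by auto
  then show ?thesis by auto
next
  case True
  then obtain x0 y0 where nz: "a x0 \<noteq> 0" "b y0 \<noteq> 0" by auto
  \<comment> \<open>A nonzero value of one function bounds the other, so neither is ever infinite
    and passing to real-valued functions loses nothing.\<close>
  have fa: "a x \<noteq> \<top>" for x
    using le[of x y0] nz by (auto simp: top_unique ennreal_top_mult)
  have fb: "b x \<noteq> \<top>" for x
    using le[of x0 x] nz by (auto simp: top_unique ennreal_mult_top)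
  let ?\<phi> = "normal_density 0 \<sigma>"
  define f h where "f x = enn2real (a x) * ?\<phi> x" and "h x = enn2real (b x) * ?\<phi> x" for x
  have [measurable]: "f \<in> borel_measurable borel" "h \<in> borel_measurable borel"
    unfolding f_def[abs_def] h_def[abs_def] by measurable
  have "(\<integral>\<^sup>+x. ennreal (f x) \<partial>lborel) * (\<integral>\<^sup>+x. ennreal (h x) \<partial>lborel) \<le> 1"
  proof (rule prekopa_leindler_normal[OF \<sigma>])
    show "0 \<le> f x" "0 \<le> h x" for x unfolding f_def h_def by (auto simp: enn2real_nonneg)
    fix x y
    have "ennreal (enn2real (a x) * enn2real (b y)) \<le> ennreal (exp ((x - y)\<^sup>2 / (4 * \<sigma>\<^sup>2)))"
      using le[of x y] fa[of x] fb[of y] by (simp add: ennreal_mult enn2real_nonneg less_top[symmetric])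
    then have *: "enn2real (a x) * enn2real (b y) \<le> exp ((x - y)\<^sup>2 / (4 * \<sigma>\<^sup>2))"
      by simp
    have "f x * h y = (enn2real (a x) * enn2real (b y)) * (?\<phi> x * ?\<phi> y)"
      unfolding f_def h_def by simp
    also have "\<dots> \<le> exp ((x - y)\<^sup>2 / (4 * \<sigma>\<^sup>2)) * (?\<phi> x * ?\<phi> y)"
      by (rule mult_right_mono[OF *]) simp
    also have "\<dots> = (?\<phi> ((x + y) / 2))\<^sup>2" by (rule normal_density_mult_le_midpoint[OF \<sigma>])
    finally show "f x * h y \<le> (?\<phi> ((x + y) / 2))\<^sup>2" .
  qed auto
  moreover have "(\<integral>\<^sup>+x. a x \<partial>normal_measure \<sigma>) = (\<integral>\<^sup>+x. ennreal (f x) \<partial>lborel)"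
    unfolding f_def using fa
    by (subst nn_integral_density) (auto intro!: nn_integral_cong simp: ennreal_mult enn2real_nonneg less_top[symmetric] mult.commute)
  moreover have "(\<integral>\<^sup>+x. b x \<partial>normal_measure \<sigma>) = (\<integral>\<^sup>+x. ennreal (h x) \<partial>lborel)"
    unfolding h_def using fb
    by (subst nn_integral_density) (auto intro!: nn_integral_cong simp: ennreal_mult enn2real_nonneg less_top[symmetric] mult.commute)
  ultimately show ?thesis by simp
qed

text \<open>Maurey's property (\<open>\<tau>\<close>) in the form of an inequality between two functions, which
  tensorizes by applying it to the partial integrals.\<close>

lemma property_tau_PiM_normal:
  fixes a b :: "('i \<Rightarrow> real) \<Rightarrow> ennreal"
  assumes \<sigma>: "0 < \<sigma>" and "finite I"
    and "a \<in> borel_measurable (Pi\<^sub>M I (\<lambda>_. normal_measure \<sigma>))"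
    and "b \<in> borel_measurable (Pi\<^sub>M I (\<lambda>_. normal_measure \<sigma>))"
    and "\<And>x y. x \<in> space (Pi\<^sub>M I (\<lambda>_. normal_measure \<sigma>)) \<Longrightarrow> y \<in> space (Pi\<^sub>M I (\<lambda>_. normal_measure \<sigma>)) \<Longrightarrow>
      a x * b y \<le> ennreal (exp ((\<Sum>i\<in>I. (x i - y i)\<^sup>2) / (4 * \<sigma>\<^sup>2)))"
  shows "(\<integral>\<^sup>+x. a x \<partial>Pi\<^sub>M I (\<lambda>_. normal_measure \<sigma>)) * (\<integral>\<^sup>+x. b x \<partial>Pi\<^sub>M I (\<lambda>_. normal_measure \<sigma>)) \<le> 1"
  using assms(2-)
proof (induction I arbitrary: a b rule: finite_induct)
  case empty
  interpret product_sigma_finite "\<lambda>_::'i. normal_measure \<sigma>"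
    by (rule product_sigma_finite_normal[OF \<sigma>])
  show ?case
    using empty(3)[of "\<lambda>_. undefined" "\<lambda>_. undefined"] empty(1,2)
    by (simp add: nn_integral_empty space_PiM)
next
  case (insert i I)
  interpret product_sigma_finite "\<lambda>_::'i. normal_measure \<sigma>"
    by (rule product_sigma_finite_normal[OF \<sigma>])
  interpret N: prob_space "normal_measure \<sigma>"
    by (rule prob_space_normal_density[OF \<sigma>])
  let ?N = "\<lambda>_::'i. normal_measure \<sigma>"
  note [measurable] = insert.prems(1,2)
  let ?A = "\<lambda>x. \<integral>\<^sup>+s. a (x(i := s)) \<partial>normal_measure \<sigma>"
  let ?B = "\<lambda>x. \<integral>\<^sup>+s. b (x(i := s)) \<partial>normal_measure \<sigma>"
  have upd: "(\<lambda>(x, s). x(i := s)) \<in> measurable (Pi\<^sub>M I ?N \<Otimes>\<^sub>M normal_measure \<sigma>) (Pi\<^sub>M (insert i I) ?N)"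
    by (rule measurable_add_dim)
  have A: "?A \<in> borel_measurable (Pi\<^sub>M I ?N)"
    using measurable_compose[OF upd insert.prems(1)] by (intro sigma_finite_measure.borel_measurable_nn_integral[OF prob_space_imp_sigma_finite[OF prob_space_normal_density[OF \<sigma>, of 0]]]) (simp add: case_prod_beta')
  have B: "?B \<in> borel_measurable (Pi\<^sub>M I ?N)"
    using measurable_compose[OF upd insert.prems(2)] by (intro sigma_finite_measure.borel_measurable_nn_integral[OF prob_space_imp_sigma_finite[OF prob_space_normal_density[OF \<sigma>, of 0]]]) (simp add: case_prod_beta')
  have "(\<integral>\<^sup>+x. ?A x \<partial>Pi\<^sub>M I ?N) * (\<integral>\<^sup>+x. ?B x \<partial>Pi\<^sub>M I ?N) \<le> 1"
  proof (rule insert.IH[OF A B])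
    fix x y assume x: "x \<in> space (Pi\<^sub>M I ?N)" and y: "y \<in> space (Pi\<^sub>M I ?N)"
    define D where "D = (\<Sum>i\<in>I. (x i - y i)\<^sup>2) / (4 * \<sigma>\<^sup>2)"
    have sp: "x(i := s) \<in> space (Pi\<^sub>M (insert i I) ?N)" "y(i := s) \<in> space (Pi\<^sub>M (insert i I) ?N)" for s
      using x y by (auto simp: space_PiM PiE_fun_upd)
    have m: "(\<lambda>s. a (x(i := s))) \<in> borel_measurable borel" "(\<lambda>s. b (y(i := s))) \<in> borel_measurable borel"
      using measurable_compose[OF measurable_Pair1'[OF x] measurable_compose[OF upd insert.prems(1)]]
        measurable_compose[OF measurable_Pair1'[OF y] measurable_compose[OF upd insert.prems(2)]]
      by (simp_all add: measurable_density_eq1 measurable_lborel1 fun_upd_def)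
    \<comment> \<open>The partial integrals inherit the assumption: for fixed \<open>x\<close> and
      \<open>y\<close> the one-dimensional case applies to the sections, once the factor exp (-D)
      has removed the cost of the coordinates in \<open>I\<close>.\<close>
    have "(\<integral>\<^sup>+s. ennreal (exp (- D)) * a (x(i := s)) \<partial>normal_measure \<sigma>) * ?B y \<le> 1"
    proof (rule property_tau_normal[OF \<sigma>])
      fix s t
      have "(\<Sum>j\<in>insert i I. ((x(i := s)) j - (y(i := t)) j)\<^sup>2) = (s - t)\<^sup>2 + (\<Sum>j\<in>I. (x j - y j)\<^sup>2)"
        using insert.hyps by (subst sum.insert) (auto intro!: sum.cong)
      then have "a (x(i := s)) * b (y(i := t)) \<le> ennreal (exp ((s - t)\<^sup>2 / (4 * \<sigma>\<^sup>2) + D))"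
        using insert.prems(3)[OF sp, of s t] by (simp add: D_def add_divide_distrib del: fun_upd_apply)
      then have "ennreal (exp (- D)) * (a (x(i := s)) * b (y(i := t))) \<le> ennreal (exp (- D)) * ennreal (exp ((s - t)\<^sup>2 / (4 * \<sigma>\<^sup>2) + D))"
        by (rule mult_left_mono) simp
      also have "\<dots> = ennreal (exp ((s - t)\<^sup>2 / (4 * \<sigma>\<^sup>2)))"
        by (simp add: ennreal_mult[symmetric] exp_add[symmetric])
      finally show "ennreal (exp (- D)) * a (x(i := s)) * b (y(i := t)) \<le> ennreal (exp ((s - t)\<^sup>2 / (4 * \<sigma>\<^sup>2)))"
        by (simp add: mult.assoc)
    qed (use m in measurable)
    then have "ennreal (exp D) * (ennreal (exp (- D)) * ?A x * ?B y) \<le> ennreal (exp D) * 1"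
      using m by (intro mult_left_mono) (simp_all add: nn_integral_cmult)
    moreover have "ennreal (exp D) * (ennreal (exp (- D)) * ?A x * ?B y) = ?A x * ?B y"
      by (simp add: mult.assoc[symmetric] ennreal_mult[symmetric] exp_add[symmetric])
    ultimately show "?A x * ?B y \<le> ennreal (exp ((\<Sum>i\<in>I. (x i - y i)\<^sup>2) / (4 * \<sigma>\<^sup>2)))"
      unfolding D_def by simp
  qed
  then show ?case
    using insert by (simp add: product_nn_integral_insert)
qed

text \<open>Apply property (tau) to c times the indicator of \<open>A\<close> and the indicator of
  \<open>B\<close>. The product is nonzero only for pairs at squared distance at least
  \<open>\<rho>\<close>, which allows c = exp (rho / (4 sigma^2)).\<close>

lemma PiM_normal_two_sets:
  fixes A B :: "('i \<Rightarrow> real) set"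
  assumes \<sigma>: "0 < \<sigma>" and I: "finite I"
    and A[measurable]: "A \<in> sets (Pi\<^sub>M I (\<lambda>_. normal_measure \<sigma>))"
    and B[measurable]: "B \<in> sets (Pi\<^sub>M I (\<lambda>_. normal_measure \<sigma>))"
    and far: "\<And>x y. x \<in> A \<Longrightarrow> y \<in> B \<Longrightarrow> \<rho> \<le> (\<Sum>i\<in>I. (x i - y i)\<^sup>2)"
  shows "measure (Pi\<^sub>M I (\<lambda>_. normal_measure \<sigma>)) A * measure (Pi\<^sub>M I (\<lambda>_. normal_measure \<sigma>)) B
    \<le> exp (- \<rho> / (4 * \<sigma>\<^sup>2))"
proof -
  let ?P = "Pi\<^sub>M I (\<lambda>_. normal_measure \<sigma>)"
  interpret prob_space ?P
    by (rule prob_space_PiM) (rule prob_space_normal_density[OF \<sigma>])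
  define c where "c = exp (\<rho> / (4 * \<sigma>\<^sup>2))"
  have "(\<integral>\<^sup>+x. ennreal c * indicator A x \<partial>?P) * (\<integral>\<^sup>+x. indicator B x \<partial>?P) \<le> 1"
  proof (rule property_tau_PiM_normal[OF \<sigma> I])
    fix x y
    have "c \<le> exp ((\<Sum>i\<in>I. (x i - y i)\<^sup>2) / (4 * \<sigma>\<^sup>2))" if "x \<in> A" "y \<in> B"
      unfolding c_def using far[OF that] by (simp add: divide_right_mono)
    then show "ennreal c * indicator A x * indicator B y \<le> ennreal (exp ((\<Sum>i\<in>I. (x i - y i)\<^sup>2) / (4 * \<sigma>\<^sup>2)))"
      by (auto simp: indicator_def intro!: ennreal_leI)
  qed auto
  then have "c * measure ?P A * measure ?P B \<le> 1"
    by (simp add: nn_integral_cmult emeasure_eq_measure ennreal_mult[symmetric] c_def ennreal_le_1)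
  then have "measure ?P A * measure ?P B \<le> 1 / c"
    unfolding c_def by (simp add: field_simps)
  then show ?thesis unfolding c_def by (simp add: exp_minus inverse_eq_divide)
qed

section \<open>Rotation invariance\<close>

text \<open>Checked on boxes, coordinate by coordinate. Both signs of \<open>c\<close> occur below:
  1 for translations, -1 for the substitution x -> y - x.\<close>

lemma PiM_lborel_affine:
  fixes c :: real and f :: "('i \<Rightarrow> real) \<Rightarrow> ennreal"
  assumes I: "finite I" and c: "\<bar>c\<bar> = 1" and f[measurable]: "f \<in> borel_measurable (Pi\<^sub>M I (\<lambda>_. lborel))"
  shows "(\<integral>\<^sup>+x. f (\<lambda>i\<in>I. y i + c * x i) \<partial>Pi\<^sub>M I (\<lambda>_. lborel)) = (\<integral>\<^sup>+x. f x \<partial>Pi\<^sub>M I (\<lambda>_. lborel))"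
proof -
  let ?M = "Pi\<^sub>M I (\<lambda>_. lborel :: real measure)"
  let ?T = "\<lambda>x. \<lambda>i\<in>I. y i + c * x i"
  interpret product_sigma_finite "\<lambda>_::'i. lborel :: real measure"
    by standard
  have T[measurable]: "?T \<in> measurable ?M ?M"
    by (intro measurable_restrict) simp
  have line: "emeasure lborel {t. b + c * t \<in> S} = emeasure lborel S" if [measurable]: "S \<in> sets borel" for b :: real and S
  proof -
    have "emeasure lborel S = emeasure (density (distr lborel borel (\<lambda>x. b + c * x)) (\<lambda>_. ennreal \<bar>c\<bar>)) S"
      using lborel_real_affine[of c b] c by auto
    also have "\<dots> = emeasure (distr lborel borel (\<lambda>x. b + c * x)) S"
      using c by (simp add: density_1)
    also have "\<dots> = emeasure lborel {t. b + c * t \<in> S}"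
      by (subst emeasure_distr) (auto simp: vimage_def)
    finally show ?thesis by simp
  qed
  have "distr ?M ?M ?T = ?M"
  proof (rule PiM_eqI[OF I])
    fix A :: "'i \<Rightarrow> real set" assume A: "\<And>i. i \<in> I \<Longrightarrow> A i \<in> sets lborel"
    have "?T -` Pi\<^sub>E I A \<inter> space ?M = Pi\<^sub>E I (\<lambda>i. {t. y i + c * t \<in> A i})"
      by (auto simp: space_PiM PiE_def Pi_def)
    then have "emeasure (distr ?M ?M ?T) (Pi\<^sub>E I A) = emeasure ?M (Pi\<^sub>E I (\<lambda>i. {t. y i + c * t \<in> A i}))"
      using A I by (subst emeasure_distr) (auto intro!: sets_PiM_I_finite)
    also have "\<dots> = (\<Prod>i\<in>I. emeasure lborel {t. y i + c * t \<in> A i})"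
    proof (rule emeasure_PiM[OF I])
      fix i assume "i \<in> I"
      then have [measurable]: "A i \<in> sets borel" using A by simp
      show "{t. y i + c * t \<in> A i} \<in> sets lborel" by simp
    qed
    also have "\<dots> = (\<Prod>i\<in>I. emeasure lborel (A i))"
      using A line by (intro prod.cong) auto
    finally show "emeasure (distr ?M ?M ?T) (Pi\<^sub>E I A) = (\<Prod>i\<in>I. emeasure lborel (A i))" .
  qed simp
  then show ?thesis
    using nn_integral_distr[OF T, of f] by simp
qed

text \<open>With a density that depends on the Euclidean norm alone, invariance of the Gaussian law
  under an isometry reduces to that of Lebesgue measure.\<close>

lemma PiM_normal_eq_density:
  assumes \<sigma>: "0 < \<sigma>" and I: "finite I"
  shows "Pi\<^sub>M I (\<lambda>_. normal_measure \<sigma>)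
    = density (Pi\<^sub>M I (\<lambda>_. lborel)) (\<lambda>x. \<Prod>i\<in>I. ennreal (normal_density 0 \<sigma> (x i)))"
proof (rule sym, rule product_sigma_finite.PiM_eqI[OF product_sigma_finite_normal[OF \<sigma>] I])
  interpret L: product_sigma_finite "\<lambda>_::'a. lborel :: real measure" by standard
  show "sets (density (Pi\<^sub>M I (\<lambda>_. lborel)) (\<lambda>x. \<Prod>i\<in>I. ennreal (normal_density 0 \<sigma> (x i))))
    = sets (Pi\<^sub>M I (\<lambda>_. normal_measure \<sigma>))"
    by (simp cong: sets_PiM_cong)
  fix A :: "'a \<Rightarrow> real set" assume "\<And>i. i \<in> I \<Longrightarrow> A i \<in> sets (normal_measure \<sigma>)"
  then have A: "A i \<in> sets borel" if "i \<in> I" for i using that by simp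
  have sA: "Pi\<^sub>E I A \<in> sets (Pi\<^sub>M I (\<lambda>_. lborel))" using A I by (auto intro!: sets_PiM_I_finite)
  have "emeasure (density (Pi\<^sub>M I (\<lambda>_. lborel)) (\<lambda>x. \<Prod>i\<in>I. ennreal (normal_density 0 \<sigma> (x i)))) (Pi\<^sub>E I A)
     = (\<integral>\<^sup>+x. (\<Prod>i\<in>I. ennreal (normal_density 0 \<sigma> (x i))) * indicator (Pi\<^sub>E I A) x \<partial>Pi\<^sub>M I (\<lambda>_. lborel))"
    by (rule emeasure_density[OF _ sA]) measurable
  also have "\<dots> = (\<integral>\<^sup>+x. (\<Prod>i\<in>I. ennreal (normal_density 0 \<sigma> (x i)) * indicator (A i) (x i)) \<partial>Pi\<^sub>M I (\<lambda>_. lborel))"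
  proof (rule nn_integral_cong)
    fix x :: "'a \<Rightarrow> real" assume "x \<in> space (Pi\<^sub>M I (\<lambda>_. lborel))"
    then have "indicator (Pi\<^sub>E I A) x = (\<Prod>i\<in>I. indicator (A i) (x i) :: ennreal)"
      using I by (auto simp: indicator_def space_PiM PiE_def Pi_def prod_zero_iff split: if_splits)
    then show "(\<Prod>i\<in>I. ennreal (normal_density 0 \<sigma> (x i))) * indicator (Pi\<^sub>E I A) x
      = (\<Prod>i\<in>I. ennreal (normal_density 0 \<sigma> (x i)) * indicator (A i) (x i))"
      by (simp add: prod.distrib)
  qed
  also have "\<dots> = (\<Prod>i\<in>I. \<integral>\<^sup>+t. ennreal (normal_density 0 \<sigma> t) * indicator (A i) t \<partial>lborel)"
    using A by (intro L.product_nn_integral_prod[OF I]) auto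
  also have "\<dots> = (\<Prod>i\<in>I. emeasure (normal_measure \<sigma>) (A i))"
    using A by (intro prod.cong) (auto simp: emeasure_density)
  finally show "emeasure (density (Pi\<^sub>M I (\<lambda>_. lborel)) (\<lambda>x. \<Prod>i\<in>I. ennreal (normal_density 0 \<sigma> (x i)))) (Pi\<^sub>E I A)
    = (\<Prod>i\<in>I. emeasure (normal_measure \<sigma>) (A i))" .
qed

lemma prod_normal_density:
  fixes x :: "'i \<Rightarrow> real"
  assumes "0 < \<sigma>" "finite I"
  shows "(\<Prod>i\<in>I. ennreal (normal_density 0 \<sigma> (x i)))
    = ennreal ((1 / sqrt (2 * pi * \<sigma>\<^sup>2)) ^ card I * exp (- (\<Sum>i\<in>I. (x i)\<^sup>2) / (2 * \<sigma>\<^sup>2)))"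
proof -
  have "(\<Prod>i\<in>I. normal_density 0 \<sigma> (x i))
    = (\<Prod>i\<in>I. 1 / sqrt (2 * pi * \<sigma>\<^sup>2)) * (\<Prod>i\<in>I. exp (- (x i)\<^sup>2 / (2 * \<sigma>\<^sup>2)))"
    by (simp only: normal_density_def prod.distrib diff_0_right)
  also have "\<dots> = (1 / sqrt (2 * pi * \<sigma>\<^sup>2)) ^ card I * exp (\<Sum>i\<in>I. - (x i)\<^sup>2 / (2 * \<sigma>\<^sup>2))"
    using assms by (simp add: exp_sum)
  also have "(\<Sum>i\<in>I. - (x i)\<^sup>2 / (2 * \<sigma>\<^sup>2)) = - (\<Sum>i\<in>I. (x i)\<^sup>2) / (2 * \<sigma>\<^sup>2)"
    by (simp add: sum_divide_distrib[symmetric] sum_negf)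
  finally show ?thesis by (simp add: prod_ennreal)
qed

text \<open>Both Lebesgue measure and its image under \<open>T\<close> are invariant under translations. By
  Fubini's theorem such measures are proportional, and a Gaussian integral shows that the factor is 1.\<close>

lemma PiM_normal_involutive_isometry:
  fixes T :: "('i \<Rightarrow> real) \<Rightarrow> 'i \<Rightarrow> real" and F :: "('i \<Rightarrow> real) \<Rightarrow> ennreal"
  assumes \<sigma>: "0 < \<sigma>" and I: "finite I"
    and T[measurable]: "T \<in> measurable (Pi\<^sub>M I (\<lambda>_. lborel)) (Pi\<^sub>M I (\<lambda>_. lborel))"
    and add: "\<And>x y. x \<in> extensional I \<Longrightarrow> y \<in> extensional I \<Longrightarrow> T (\<lambda>i\<in>I. x i + y i) = (\<lambda>i\<in>I. T x i + T y i)"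
    and inv: "\<And>x. x \<in> extensional I \<Longrightarrow> T (T x) = x"
    and iso: "\<And>x. x \<in> extensional I \<Longrightarrow> (\<Sum>i\<in>I. (T x i)\<^sup>2) = (\<Sum>i\<in>I. (x i)\<^sup>2)"
  shows "distr (Pi\<^sub>M I (\<lambda>_. normal_measure \<sigma>)) (Pi\<^sub>M I (\<lambda>_. normal_measure \<sigma>)) T = Pi\<^sub>M I (\<lambda>_. normal_measure \<sigma>)"
proof -
  let ?M = "Pi\<^sub>M I (\<lambda>_. lborel :: real measure)"
  let ?N = "Pi\<^sub>M I (\<lambda>_. normal_measure \<sigma>)"
  define G where "G x = (\<Prod>i\<in>I. ennreal (normal_density 0 \<sigma> (x i)))" for x :: "'i \<Rightarrow> real"
  interpret L: product_sigma_finite "\<lambda>_::'i. lborel :: real measure" by standard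
  interpret pair_sigma_finite ?M ?M
    using L.sigma_finite[OF I] by (simp add: pair_sigma_finite_def)
  have G[measurable]: "G \<in> borel_measurable ?M" unfolding G_def[abs_def] by measurable
  have N: "?N = density ?M G" unfolding G_def by (rule PiM_normal_eq_density[OF \<sigma> I])
  have sp: "x \<in> space ?M \<longleftrightarrow> x \<in> extensional I" for x by (simp add: space_PiM PiE_UNIV_domain PiE_def)
  have Text: "T x \<in> extensional I" if "x \<in> extensional I" for x
    using measurable_space[OF T, of x] that by (simp add: sp)
  have GT: "G (T x) = G x" if "x \<in> extensional I" for x
    unfolding G_def by (simp add: prod_normal_density[OF \<sigma> I] iso[OF that])
  have G1: "(\<integral>\<^sup>+x. G x \<partial>?M) = 1"
  proof -
    have "prob_space ?N" by (rule prob_space_PiM) (rule prob_space_normal_density[OF \<sigma>])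
    then have "emeasure ?N (space ?N) = 1" by (rule prob_space.emeasure_space_1)
    then show ?thesis unfolding N by (simp add: emeasure_density cong: nn_integral_cong)
  qed
  have "(\<integral>\<^sup>+y. G (T y) \<partial>?M) = (\<integral>\<^sup>+y. G y \<partial>?M)"
    by (intro nn_integral_cong) (simp add: GT sp)
  then have GT1: "(\<integral>\<^sup>+y. G (T y) \<partial>?M) = 1" using G1 by simp
  \<comment> \<open>Lebesgue measure is invariant under \<open>T\<close>, obtained without
    determinants. Insert the factor 1 as the integral of G (T y). Translating x by T y gives F (T y
    + x) G (T y); after an exchange, translating y by - T x gives F (T y) G (T y - x), because T (T
    x) = x; the integral over x is then again that of \<open>G\<close>.\<close>
  have key: "(\<integral>\<^sup>+x. F x \<partial>?M) = (\<integral>\<^sup>+x. F (T x) \<partial>?M)" if [measurable]: "F \<in> borel_measurable ?M" for F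
  proof -
    have meas: "(\<lambda>p. \<lambda>i\<in>I. fst p i + T (snd p) i) \<in> measurable (?M \<Otimes>\<^sub>M ?M) ?M"
      "(\<lambda>p. \<lambda>i\<in>I. T (snd p) i + - 1 * fst p i) \<in> measurable (?M \<Otimes>\<^sub>M ?M) ?M"
    proof -
      have "(\<lambda>p. T (snd p) i) \<in> borel_measurable (?M \<Otimes>\<^sub>M ?M)" "(\<lambda>p. fst p i) \<in> borel_measurable (?M \<Otimes>\<^sub>M ?M)"
        if "i \<in> I" for i
        using measurable_compose[OF measurable_compose[OF measurable_snd T] measurable_component_singleton[OF that]]
          measurable_compose[OF measurable_fst measurable_component_singleton[OF that, of "\<lambda>_. lborel :: real measure"],
            of "Pi\<^sub>M I (\<lambda>_. lborel)"] by simp_all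
      then show "(\<lambda>p. \<lambda>i\<in>I. fst p i + T (snd p) i) \<in> measurable (?M \<Otimes>\<^sub>M ?M) ?M"
        "(\<lambda>p. \<lambda>i\<in>I. T (snd p) i + - 1 * fst p i) \<in> measurable (?M \<Otimes>\<^sub>M ?M) ?M"
        by (auto intro!: measurable_restrict borel_measurable_add borel_measurable_diff)
    qed
    have "(\<integral>\<^sup>+x. F x \<partial>?M) = (\<integral>\<^sup>+x. F x \<partial>?M) * (\<integral>\<^sup>+y. G (T y) \<partial>?M)"
      using GT1 by simp
    also have "\<dots> = (\<integral>\<^sup>+y. (\<integral>\<^sup>+x. F x \<partial>?M) * G (T y) \<partial>?M)"
      by (simp add: nn_integral_cmult)
    also have "\<dots> = (\<integral>\<^sup>+y. (\<integral>\<^sup>+x. F (\<lambda>i\<in>I. T y i + 1 * x i) * G (T y) \<partial>?M) \<partial>?M)"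
    proof (rule nn_integral_cong)
      fix y
      have "(\<lambda>x. F (\<lambda>i\<in>I. T y i + 1 * x i)) \<in> borel_measurable ?M"
        by (rule measurable_compose[OF _ that]) (auto intro!: measurable_restrict)
      then show "(\<integral>\<^sup>+x. F x \<partial>?M) * G (T y) = (\<integral>\<^sup>+x. F (\<lambda>i\<in>I. T y i + 1 * x i) * G (T y) \<partial>?M)"
        using PiM_lborel_affine[OF I _ that, of 1 "T y"] by (simp add: nn_integral_multc)
    qed
    also have "\<dots> = (\<integral>\<^sup>+x. (\<integral>\<^sup>+y. F (\<lambda>i\<in>I. T y i + 1 * x i) * G (T y) \<partial>?M) \<partial>?M)"
      using measurable_compose[OF meas(1) that] by (intro Fubini') (simp add: case_prod_beta' add.commute)
    also have "\<dots> = (\<integral>\<^sup>+x. (\<integral>\<^sup>+y. F (T y) * G (\<lambda>i\<in>I. T y i + - 1 * x i) \<partial>?M) \<partial>?M)"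
    proof (rule nn_integral_cong)
      fix x assume "x \<in> space ?M"
      then have x: "x \<in> extensional I" by (simp add: sp)
      let ?S = "\<lambda>y. \<lambda>i\<in>I. - T x i + 1 * y i"
      \<comment> \<open>Additivity is available for sums only, so the difference is recovered by
        adding \<open>T x\<close> back.\<close>
      have eq: "T (?S y) = (\<lambda>i\<in>I. T y i + - 1 * x i)" if "y \<in> extensional I" for y
      proof -
        have "T (\<lambda>i\<in>I. ?S y i + T x i) = (\<lambda>i\<in>I. T (?S y) i + T (T x) i)"
          by (rule add[OF restrict_extensional Text[OF x]])
        moreover have "(\<lambda>i\<in>I. ?S y i + T x i) = y"
          using that by (auto simp: extensional_def)
        ultimately have *: "T y = (\<lambda>i\<in>I. T (?S y) i + x i)" using inv[OF x] by simp
        have "T (?S y) \<in> extensional I" by (rule Text[OF restrict_extensional])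
        then show ?thesis unfolding * by (auto simp: extensional_def)
      qed
      have "(\<lambda>y. T y i) \<in> borel_measurable ?M" if "i \<in> I" for i
        using measurable_compose[OF T measurable_component_singleton[OF that]] by simp
      then have m0: "(\<lambda>y. \<lambda>i\<in>I. T y i + 1 * x i) \<in> measurable ?M ?M"
        by (auto intro!: measurable_restrict borel_measurable_add)
      have m: "(\<lambda>y. F (\<lambda>i\<in>I. T y i + 1 * x i) * G (T y)) \<in> borel_measurable ?M"
        by (rule borel_measurable_times_ennreal[OF measurable_compose[OF m0 that] measurable_compose[OF T G]])
      have "(\<integral>\<^sup>+y. F (\<lambda>i\<in>I. T y i + 1 * x i) * G (T y) \<partial>?M)
        = (\<integral>\<^sup>+y. F (\<lambda>i\<in>I. T (?S y) i + 1 * x i) * G (T (?S y)) \<partial>?M)"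
        using PiM_lborel_affine[OF I _ m, of 1 "\<lambda>i. - T x i"] by simp
      also have "\<dots> = (\<integral>\<^sup>+y. F (T y) * G (\<lambda>i\<in>I. T y i + - 1 * x i) \<partial>?M)"
      proof (rule nn_integral_cong)
        fix y assume "y \<in> space ?M"
        then have y: "y \<in> extensional I" by (simp add: sp)
        have "(\<lambda>i\<in>I. T (?S y) i + 1 * x i) = T y"
          unfolding eq[OF y] using Text[OF y] by (auto simp: extensional_def)
        then show "F (\<lambda>i\<in>I. T (?S y) i + 1 * x i) * G (T (?S y)) = F (T y) * G (\<lambda>i\<in>I. T y i + - 1 * x i)"
          unfolding eq[OF y] by simp
      qed
      finally show "(\<integral>\<^sup>+y. F (\<lambda>i\<in>I. T y i + 1 * x i) * G (T y) \<partial>?M)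
        = (\<integral>\<^sup>+y. F (T y) * G (\<lambda>i\<in>I. T y i + - 1 * x i) \<partial>?M)" .
    qed
    also have "\<dots> = (\<integral>\<^sup>+y. (\<integral>\<^sup>+x. F (T y) * G (\<lambda>i\<in>I. T y i + - 1 * x i) \<partial>?M) \<partial>?M)"
      using measurable_compose[OF meas(2) G] measurable_compose[OF measurable_compose[OF measurable_snd T] that]
      by (intro Fubini'[symmetric]) (simp add: case_prod_beta')
    also have "\<dots> = (\<integral>\<^sup>+y. F (T y) * (\<integral>\<^sup>+x. G x \<partial>?M) \<partial>?M)"
    proof (rule nn_integral_cong)
      fix y
      have "(\<lambda>x. G (\<lambda>i\<in>I. T y i + - 1 * x i)) \<in> borel_measurable ?M"
        by (rule measurable_compose[OF _ G]) (auto intro!: measurable_restrict)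
      then show "(\<integral>\<^sup>+x. F (T y) * G (\<lambda>i\<in>I. T y i + - 1 * x i) \<partial>?M) = F (T y) * (\<integral>\<^sup>+x. G x \<partial>?M)"
        using PiM_lborel_affine[OF I _ G, of "-1" "T y"] by (simp add: nn_integral_cmult)
    qed
    finally show ?thesis using G1 by simp
  qed
  have TN: "T \<in> measurable ?N ?N" unfolding N using T by simp
  show ?thesis
  proof (rule measure_eqI)
    fix A assume "A \<in> sets (distr ?N ?N T)"
    then have A[measurable]: "A \<in> sets ?M" unfolding N by simp
    have "emeasure (distr ?N ?N T) A = (\<integral>\<^sup>+x. indicator A (T x) \<partial>?N)"
      using A TN by (subst emeasure_distr)
        (auto simp: N nn_integral_indicator[symmetric] indicator_def simp del: nn_integral_indicator intro!: nn_integral_cong)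
    also have "\<dots> = (\<integral>\<^sup>+x. G x * indicator A (T x) \<partial>?M)"
      unfolding N using A measurable_compose[OF T borel_measurable_indicator[OF A]] by (subst nn_integral_density) auto
    also have "\<dots> = (\<integral>\<^sup>+x. G (T x) * indicator A (T x) \<partial>?M)"
      by (intro nn_integral_cong) (simp add: GT sp)
    also have "\<dots> = (\<integral>\<^sup>+x. G x * indicator A x \<partial>?M)"
      by (rule key[symmetric]) simp
    also have "\<dots> = emeasure ?N A" unfolding N by (simp add: emeasure_density)
    finally show "emeasure (distr ?N ?N T) A = emeasure ?N A" .
  qed simp
qed

section \<open>Tail bounds\<close>

lemma measurable_component_normal:
  assumes "i \<in> I"
  shows "(\<lambda>x. x i) \<in> borel_measurable (Pi\<^sub>M I (\<lambda>_. normal_measure \<sigma>))"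
proof -
  have "measurable (Pi\<^sub>M I (\<lambda>_. normal_measure \<sigma>)) (normal_measure \<sigma>) = borel_measurable (Pi\<^sub>M I (\<lambda>_. normal_measure \<sigma>))"
    by (rule measurable_cong_sets) auto
  then show ?thesis
    using measurable_component_singleton[of i I "\<lambda>_. normal_measure \<sigma>"] assms by auto
qed

text \<open>Completing the square: the exponential tilt moves the mean to theta sigma^2.\<close>

lemma nn_integral_exp_linear_normal:
  assumes \<sigma>: "0 < \<sigma>"
  shows "(\<integral>\<^sup>+z. ennreal (exp (\<theta> * z)) \<partial>normal_measure \<sigma>) = ennreal (exp (\<theta>\<^sup>2 * \<sigma>\<^sup>2 / 2))"
proof -
  have *: "normal_density 0 \<sigma> z * exp (\<theta> * z) = exp (\<theta>\<^sup>2 * \<sigma>\<^sup>2 / 2) * normal_density (\<theta> * \<sigma>\<^sup>2) \<sigma> z" for z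
  proof -
    have "- z\<^sup>2 / (2 * \<sigma>\<^sup>2) + \<theta> * z = \<theta>\<^sup>2 * \<sigma>\<^sup>2 / 2 + - (z - \<theta> * \<sigma>\<^sup>2)\<^sup>2 / (2 * \<sigma>\<^sup>2)"
      using \<sigma> by (simp add: field_simps power2_eq_square)
    then have "exp (- z\<^sup>2 / (2 * \<sigma>\<^sup>2)) * exp (\<theta> * z)
      = exp (\<theta>\<^sup>2 * \<sigma>\<^sup>2 / 2) * exp (- (z - \<theta> * \<sigma>\<^sup>2)\<^sup>2 / (2 * \<sigma>\<^sup>2))"
      unfolding exp_add[symmetric] by simp
    then show ?thesis by (simp add: normal_density_def)
  qed
  have "(\<integral>\<^sup>+z. ennreal (exp (\<theta> * z)) \<partial>normal_measure \<sigma>)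
    = (\<integral>\<^sup>+z. ennreal (exp (\<theta>\<^sup>2 * \<sigma>\<^sup>2 / 2)) * ennreal (normal_density (\<theta> * \<sigma>\<^sup>2) \<sigma> z) \<partial>lborel)"
    by (subst nn_integral_density) (auto simp: ennreal_mult'[symmetric] * intro!: nn_integral_cong)
  also have "\<dots> = ennreal (exp (\<theta>\<^sup>2 * \<sigma>\<^sup>2 / 2))"
    using prob_space.emeasure_space_1[OF prob_space_normal_density[OF \<sigma>, of "\<theta> * \<sigma>\<^sup>2"]]
    by (simp add: nn_integral_cmult emeasure_density)
  finally show ?thesis .
qed

text \<open>Here the tilt changes the standard deviation, to sigma / sqrt (1 - 2 theta).\<close>

lemma nn_integral_exp_square_normal:
  assumes \<sigma>: "0 < \<sigma>" and \<theta>: "2 * \<theta> < 1"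
  shows "(\<integral>\<^sup>+z. ennreal (exp (\<theta> * (z\<^sup>2 / \<sigma>\<^sup>2 - 1))) \<partial>normal_measure \<sigma>)
    = ennreal (exp (- \<theta>) / sqrt (1 - 2 * \<theta>))"
proof -
  define \<tau> where "\<tau> = \<sigma> / sqrt (1 - 2 * \<theta>)"
  have \<tau>: "0 < \<tau>" "\<tau>\<^sup>2 = \<sigma>\<^sup>2 / (1 - 2 * \<theta>)" unfolding \<tau>_def using assms by (auto simp: power_divide)
  have *: "normal_density 0 \<sigma> z * exp (\<theta> * (z\<^sup>2 / \<sigma>\<^sup>2 - 1)) = exp (- \<theta>) / sqrt (1 - 2 * \<theta>) * normal_density 0 \<tau> z" for z
  proof -
    have "- z\<^sup>2 / (2 * \<sigma>\<^sup>2) + \<theta> * (z\<^sup>2 / \<sigma>\<^sup>2 - 1) = - \<theta> + - z\<^sup>2 / (2 * \<tau>\<^sup>2)"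
      unfolding \<tau>(2) using assms by (simp add: field_simps)
    then have e: "exp (- z\<^sup>2 / (2 * \<sigma>\<^sup>2)) * exp (\<theta> * (z\<^sup>2 / \<sigma>\<^sup>2 - 1)) = exp (- \<theta>) * exp (- z\<^sup>2 / (2 * \<tau>\<^sup>2))"
      unfolding exp_add[symmetric] by simp
    have s: "1 / sqrt (2 * pi * \<sigma>\<^sup>2) = 1 / sqrt (1 - 2 * \<theta>) * (1 / sqrt (2 * pi * \<tau>\<^sup>2))"
      unfolding \<tau>(2) using assms by (simp add: real_sqrt_mult real_sqrt_divide)
    have "normal_density 0 \<sigma> z * exp (\<theta> * (z\<^sup>2 / \<sigma>\<^sup>2 - 1))
      = 1 / sqrt (2 * pi * \<sigma>\<^sup>2) * (exp (- z\<^sup>2 / (2 * \<sigma>\<^sup>2)) * exp (\<theta> * (z\<^sup>2 / \<sigma>\<^sup>2 - 1)))"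
      by (simp add: normal_density_def)
    also have "\<dots> = exp (- \<theta>) / sqrt (1 - 2 * \<theta>) * normal_density 0 \<tau> z"
      unfolding e s by (simp add: normal_density_def)
    finally show ?thesis .
  qed
  have "(\<integral>\<^sup>+z. ennreal (exp (\<theta> * (z\<^sup>2 / \<sigma>\<^sup>2 - 1))) \<partial>normal_measure \<sigma>)
    = (\<integral>\<^sup>+z. ennreal (exp (- \<theta>) / sqrt (1 - 2 * \<theta>)) * ennreal (normal_density 0 \<tau> z) \<partial>lborel)"
    by (subst nn_integral_density) (use \<theta> in \<open>auto simp: ennreal_mult'[symmetric] * intro!: nn_integral_cong\<close>)
  also have "\<dots> = ennreal (exp (- \<theta>) / sqrt (1 - 2 * \<theta>))"
    using prob_space.emeasure_space_1[OF prob_space_normal_density[OF \<tau>(1), of 0]]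
    by (simp add: nn_integral_cmult emeasure_density)
  finally show ?thesis .
qed

text \<open>From |ln (1 + x) - x| <= 2 x^2 at x = -2 theta; its range |x| <= 1/2 is the condition on
  \<open>\<theta>\<close>.\<close>

lemma nn_integral_exp_square_normal_le:
  assumes \<sigma>: "0 < \<sigma>" and \<theta>: "\<bar>\<theta>\<bar> \<le> 1 / 4"
  shows "(\<integral>\<^sup>+z. ennreal (exp (\<theta> * (z\<^sup>2 / \<sigma>\<^sup>2 - 1))) \<partial>normal_measure \<sigma>) \<le> ennreal (exp (4 * \<theta>\<^sup>2))"
proof -
  have pos: "0 < 1 - 2 * \<theta>" using \<theta> by auto
  have "\<bar>ln (1 + - 2 * \<theta>) - - 2 * \<theta>\<bar> \<le> 2 * (- 2 * \<theta>)\<^sup>2"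
    by (rule abs_ln_one_plus_x_minus_x_bound) (use \<theta> in auto)
  then have "- 2 * \<theta> - 8 * \<theta>\<^sup>2 \<le> ln (1 - 2 * \<theta>)"
    by (simp add: power_mult_distrib)
  moreover have "ln (sqrt (1 - 2 * \<theta>)) = ln (1 - 2 * \<theta>) / 2" using pos by (simp add: ln_sqrt)
  ultimately have "- \<theta> - ln (sqrt (1 - 2 * \<theta>)) \<le> 4 * \<theta>\<^sup>2" by linarith
  then have "exp (- \<theta> - ln (sqrt (1 - 2 * \<theta>))) \<le> exp (4 * \<theta>\<^sup>2)" by simp
  then have "exp (- \<theta>) / sqrt (1 - 2 * \<theta>) \<le> exp (4 * \<theta>\<^sup>2)"
    using pos by (simp add: exp_diff)
  then show ?thesis using pos by (simp add: nn_integral_exp_square_normal[OF \<sigma>] ennreal_leI)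
qed

text \<open>Markov's inequality for the exponential of the sum, which factorizes by independence. A
  separate function for each coordinate covers linear forms and sums of squares over a subset
  alike.\<close>

lemma PiM_normal_chernoff:
  fixes f :: "'i \<Rightarrow> real \<Rightarrow> real"
  assumes \<sigma>: "0 < \<sigma>" and I: "finite I" and f[measurable]: "\<And>i. i \<in> I \<Longrightarrow> f i \<in> borel_measurable borel"
    and m: "\<And>i. i \<in> I \<Longrightarrow> (\<integral>\<^sup>+z. ennreal (exp (f i z)) \<partial>normal_measure \<sigma>) \<le> ennreal (exp (m i))"
  shows "measure (Pi\<^sub>M I (\<lambda>_. normal_measure \<sigma>))
      {x \<in> space (Pi\<^sub>M I (\<lambda>_. normal_measure \<sigma>)). b \<le> (\<Sum>i\<in>I. f i (x i))} \<le> exp ((\<Sum>i\<in>I. m i) - b)"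
proof -
  let ?P = "Pi\<^sub>M I (\<lambda>_. normal_measure \<sigma>)"
  interpret product_sigma_finite "\<lambda>_::'i. normal_measure \<sigma>"
    by (rule product_sigma_finite_normal[OF \<sigma>])
  interpret P: prob_space ?P by (rule prob_space_PiM) (rule prob_space_normal_density[OF \<sigma>])
  have [measurable]: "(\<lambda>x. \<Sum>i\<in>I. f i (x i)) \<in> borel_measurable ?P"
  proof (rule borel_measurable_sum)
    fix i assume "i \<in> I"
    then have "(\<lambda>x. x i) \<in> measurable ?P borel" by (rule measurable_component_normal)
    then show "(\<lambda>x. f i (x i)) \<in> borel_measurable ?P" using f[OF \<open>i \<in> I\<close>] by (rule measurable_compose)
  qed
  have "emeasure ?P {x \<in> space ?P. b \<le> (\<Sum>i\<in>I. f i (x i))}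
      = (\<integral>\<^sup>+x. indicator {x \<in> space ?P. b \<le> (\<Sum>i\<in>I. f i (x i))} x \<partial>?P)"
    by (rule nn_integral_indicator[symmetric]) measurable
  also have "\<dots> \<le> (\<integral>\<^sup>+x. ennreal (exp (- b)) * (\<Prod>i\<in>I. ennreal (exp (f i (x i)))) \<partial>?P)"
  proof (rule nn_integral_mono)
    fix x
    have "ennreal (exp (- b)) * (\<Prod>i\<in>I. ennreal (exp (f i (x i)))) = ennreal (exp ((\<Sum>i\<in>I. f i (x i)) - b))"
      using I by (simp add: prod_ennreal exp_sum[symmetric] ennreal_mult[symmetric] exp_add[symmetric])
    moreover have "1 \<le> exp ((\<Sum>i\<in>I. f i (x i)) - b)" if "b \<le> (\<Sum>i\<in>I. f i (x i))" using that by simp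
    ultimately show "indicator {x \<in> space ?P. b \<le> (\<Sum>i\<in>I. f i (x i))} x
        \<le> ennreal (exp (- b)) * (\<Prod>i\<in>I. ennreal (exp (f i (x i))))"
      by (auto simp: indicator_def)
  qed
  also have "\<dots> = ennreal (exp (- b)) * (\<integral>\<^sup>+x. (\<Prod>i\<in>I. ennreal (exp (f i (x i)))) \<partial>?P)"
  proof (rule nn_integral_cmult)
    show "(\<lambda>x. \<Prod>i\<in>I. ennreal (exp (f i (x i)))) \<in> borel_measurable ?P"
    proof (rule borel_measurable_prod_ennreal)
      fix i assume "i \<in> I"
      then have "(\<lambda>x. x i) \<in> measurable ?P borel" by (rule measurable_component_normal)
      from measurable_compose[OF this f[OF \<open>i \<in> I\<close>]]
      show "(\<lambda>x. ennreal (exp (f i (x i)))) \<in> borel_measurable ?P" by measurable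
    qed
  qed
  also have "\<dots> = ennreal (exp (- b)) * (\<Prod>i\<in>I. \<integral>\<^sup>+z. ennreal (exp (f i z)) \<partial>normal_measure \<sigma>)"
    by (subst product_nn_integral_prod[OF I]) auto
  also have "\<dots> \<le> ennreal (exp (- b)) * (\<Prod>i\<in>I. ennreal (exp (m i)))"
    using m by (intro mult_left_mono prod_mono_ennreal) auto
  also have "\<dots> = ennreal (exp ((\<Sum>i\<in>I. m i) - b))"
    using I by (simp add: prod_ennreal exp_sum[symmetric] ennreal_mult[symmetric] exp_add[symmetric])
  finally show ?thesis by (simp add: P.emeasure_eq_measure)
qed

lemma PiM_normal_linear_tail:
  fixes a :: "'i \<Rightarrow> real"
  assumes \<sigma>: "0 < \<sigma>" and I: "finite I" and A: "0 < A" "(\<Sum>i\<in>I. (a i)\<^sup>2) \<le> A\<^sup>2" and L: "0 < L"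
  shows "measure (Pi\<^sub>M I (\<lambda>_. normal_measure \<sigma>))
      {x \<in> space (Pi\<^sub>M I (\<lambda>_. normal_measure \<sigma>)). \<sigma> * A * sqrt (2 * L) \<le> (\<Sum>i\<in>I. a i * x i)} \<le> exp (- L)"
proof -
  \<comment> \<open>The minimizer of the Chernoff exponent: at this value the quadratic term is L
    and the linear term 2 L.\<close>
  define \<theta> where "\<theta> = sqrt (2 * L) / (\<sigma> * A)"
  have \<theta>: "0 < \<theta>" unfolding \<theta>_def using \<sigma> A L by simp
  have "measure (Pi\<^sub>M I (\<lambda>_. normal_measure \<sigma>))
      {x \<in> space (Pi\<^sub>M I (\<lambda>_. normal_measure \<sigma>)). \<theta> * (\<sigma> * A * sqrt (2 * L)) \<le> (\<Sum>i\<in>I. \<theta> * a i * x i)}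
    \<le> exp ((\<Sum>i\<in>I. (\<theta> * a i)\<^sup>2 * \<sigma>\<^sup>2 / 2) - \<theta> * (\<sigma> * A * sqrt (2 * L)))"
    by (rule PiM_normal_chernoff[OF \<sigma> I]) (auto simp: nn_integral_exp_linear_normal[OF \<sigma>])
  also have "\<theta> * (\<sigma> * A * sqrt (2 * L)) = 2 * L" unfolding \<theta>_def using \<sigma> A L by simp
  also have "(\<Sum>i\<in>I. (\<theta> * a i)\<^sup>2 * \<sigma>\<^sup>2 / 2) = \<theta>\<^sup>2 * \<sigma>\<^sup>2 / 2 * (\<Sum>i\<in>I. (a i)\<^sup>2)"
    by (simp add: sum_distrib_left power_mult_distrib algebra_simps)
  also have "\<dots> \<le> \<theta>\<^sup>2 * \<sigma>\<^sup>2 / 2 * A\<^sup>2" using A by (intro mult_left_mono) auto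
  also have "\<theta>\<^sup>2 * \<sigma>\<^sup>2 / 2 * A\<^sup>2 = L" unfolding \<theta>_def using \<sigma> A L by (simp add: power_divide power_mult_distrib)
  also have "{x \<in> space (Pi\<^sub>M I (\<lambda>_. normal_measure \<sigma>)). 2 * L \<le> (\<Sum>i\<in>I. \<theta> * a i * x i)}
    = {x \<in> space (Pi\<^sub>M I (\<lambda>_. normal_measure \<sigma>)). \<sigma> * A * sqrt (2 * L) \<le> (\<Sum>i\<in>I. a i * x i)}"
  proof -
    have "2 * L \<le> (\<Sum>i\<in>I. \<theta> * a i * x i) \<longleftrightarrow> \<sigma> * A * sqrt (2 * L) \<le> (\<Sum>i\<in>I. a i * x i)" for x :: "'i \<Rightarrow> real"
    proof -
      have "(\<Sum>i\<in>I. \<theta> * a i * x i) = \<theta> * (\<Sum>i\<in>I. a i * x i)" by (simp add: sum_distrib_left mult.assoc)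
      moreover have "2 * L = \<theta> * (\<sigma> * A * sqrt (2 * L))" unfolding \<theta>_def using \<sigma> A L by simp
      ultimately show ?thesis using \<theta> by (metis mult_le_cancel_left_pos)
    qed
    then show ?thesis by simp
  qed
  finally show ?thesis by simp
qed

text \<open>Coordinates outside \<open>J\<close> get the zero function. Leaving
  \<open>\<theta>\<close> in the event lets its two signs give the upper and the lower tail.\<close>

lemma PiM_normal_square_tail:
  assumes \<sigma>: "0 < \<sigma>" and I: "finite I" and J: "J \<subseteq> I" and \<theta>: "\<bar>\<theta>\<bar> \<le> 1 / 4"
  shows "measure (Pi\<^sub>M I (\<lambda>_. normal_measure \<sigma>))
      {x \<in> space (Pi\<^sub>M I (\<lambda>_. normal_measure \<sigma>)). b \<le> \<theta> * ((\<Sum>i\<in>J. (x i)\<^sup>2) / \<sigma>\<^sup>2 - real (card J))}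
    \<le> exp (4 * real (card J) * \<theta>\<^sup>2 - b)"
proof -
  have fJ: "finite J" using I J finite_subset by auto
  have IJ: "I \<inter> J = J" using J by auto
  let ?f = "\<lambda>i z. if i \<in> J then \<theta> * (z\<^sup>2 / \<sigma>\<^sup>2 - 1) else (0::real)"
  have "(\<Sum>i\<in>I. ?f i (x i)) = \<theta> * ((\<Sum>i\<in>J. (x i)\<^sup>2) / \<sigma>\<^sup>2 - real (card J))" for x :: "'a \<Rightarrow> real"
    using fJ by (simp add: sum.If_cases[OF I] IJ sum_distrib_left[symmetric] sum_subtractf sum_divide_distrib)
  moreover have "(\<Sum>i\<in>I. if i \<in> J then 4 * \<theta>\<^sup>2 else 0) = 4 * real (card J) * \<theta>\<^sup>2"
    by (simp add: sum.If_cases[OF I] IJ)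
  moreover have "measure (Pi\<^sub>M I (\<lambda>_. normal_measure \<sigma>))
      {x \<in> space (Pi\<^sub>M I (\<lambda>_. normal_measure \<sigma>)). b \<le> (\<Sum>i\<in>I. ?f i (x i))}
      \<le> exp ((\<Sum>i\<in>I. if i \<in> J then 4 * \<theta>\<^sup>2 else 0) - b)"
  proof (rule PiM_normal_chernoff[OF \<sigma> I])
    fix i
    have "(\<integral>\<^sup>+z. 1 \<partial>normal_measure \<sigma>) = 1"
      using prob_space.emeasure_space_1[OF prob_space_normal_density[OF \<sigma>, of 0]] by simp
    then show "(\<integral>\<^sup>+z. ennreal (exp (?f i z)) \<partial>normal_measure \<sigma>) \<le> ennreal (exp (if i \<in> J then 4 * \<theta>\<^sup>2 else 0))"
      using nn_integral_exp_square_normal_le[OF \<sigma> \<theta>] by simp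
  qed auto
  ultimately show ?thesis by simp
qed

text \<open>The shape is that of the error of the Gram matrix at a vector of length
  \<open>\<rho>\<close>, once the noise has been rotated: a cross term with the signal and a centred
  sum of squares. The factor 4 counts the two signs of each.\<close>

lemma PiM_normal_quadratic_tail:
  fixes a :: "'i \<Rightarrow> real"
  assumes \<sigma>: "0 < \<sigma>" and I: "finite I" and J: "J \<subseteq> I" and A: "0 < A" "(\<Sum>i\<in>J. (a i)\<^sup>2) \<le> A\<^sup>2"
    and \<rho>: "0 \<le> \<rho>" "\<rho> \<le> 1" and L: "0 < L"
  defines "n \<equiv> real (card J)"
  shows "measure (Pi\<^sub>M I (\<lambda>_. normal_measure \<sigma>))
      {x \<in> space (Pi\<^sub>M I (\<lambda>_. normal_measure \<sigma>)).
        3 * \<sigma> * A * sqrt L + 5 * \<sigma>\<^sup>2 * (sqrt (n * L) + L)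
        < \<bar>2 * \<rho> * (\<Sum>i\<in>J. a i * x i) + \<rho>\<^sup>2 * ((\<Sum>i\<in>J. (x i)\<^sup>2) - n * \<sigma>\<^sup>2)\<bar>} \<le> 4 * exp (- L)"
proof -
  let ?P = "Pi\<^sub>M I (\<lambda>_. normal_measure \<sigma>)"
  interpret P: prob_space ?P by (rule prob_space_PiM) (rule prob_space_normal_density[OF \<sigma>])
  have comp[measurable]: "(\<lambda>x. x i) \<in> borel_measurable ?P" if "i \<in> J" for i
    using that J by (intro measurable_component_normal) auto
  have fJ: "finite J" using I J finite_subset by auto
  have IJ: "I \<inter> J = J" using J by auto
  define lin where "lin x = (\<Sum>i\<in>J. a i * x i)" for x :: "'i \<Rightarrow> real"
  define sq where "sq x = (\<Sum>i\<in>J. (x i)\<^sup>2) / \<sigma>\<^sup>2 - n" for x :: "'i \<Rightarrow> real"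
  have [measurable]: "lin \<in> borel_measurable ?P" "sq \<in> borel_measurable ?P"
    unfolding lin_def[abs_def] sq_def[abs_def] by measurable
  define s where "s = \<sigma> * A * sqrt (2 * L)"
  \<comment> \<open>Chosen so that \<open>\<theta>\<close> is at most 1/4 for all n and L, while
    theta c = 5 L / 4 and 4 n theta^2 <= L / 4. The Chernoff exponent is then at most -L in both
    regimes, n large and L large.\<close>
  define c where "c = 5 * (sqrt (n * L) + L)"
  define \<theta> where "\<theta> = sqrt L / (4 * (sqrt n + sqrt L))"
  have n0: "0 \<le> n" unfolding n_def by simp
  have sL: "0 < sqrt L" using L by simp
  have den: "0 < sqrt n + sqrt L" using n0 sL by (simp add: add_nonneg_pos)
  have \<theta>0: "0 < \<theta>" "\<theta> \<le> 1 / 4" unfolding \<theta>_def using den sL n0 by (auto simp: field_simps)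
  have "c = 5 * sqrt L * (sqrt n + sqrt L)"
    unfolding c_def using L n0 by (simp add: real_sqrt_mult algebra_simps)
  moreover have "sqrt L / (4 * D) * (5 * sqrt L * D) = 5 / 4 * L" if "0 < D" for D
    using that L by simp
  ultimately have \<theta>c: "\<theta> * c = 5 / 4 * L"
    unfolding \<theta>_def using den by blast
  have "sqrt n * sqrt L \<le> (sqrt n + sqrt L) * sqrt L" using sL by (intro mult_right_mono) auto
  then have "sqrt n * \<theta> \<le> sqrt L / 4"
    unfolding \<theta>_def using den by (simp add: field_simps)
  then have "(sqrt n * \<theta>)\<^sup>2 \<le> (sqrt L / 4)\<^sup>2" using \<theta>0 n0 by (intro power_mono) auto
  then have n\<theta>: "n * \<theta>\<^sup>2 \<le> L / 16" using L n0 by (simp add: power_mult_distrib power_divide)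
  let ?E = "\<lambda>Q. {x \<in> space ?P. Q x}"
  have lin_tail: "measure ?P (?E (\<lambda>x. s \<le> \<epsilon> * lin x)) \<le> exp (- L)" if "\<bar>\<epsilon>\<bar> = 1" for \<epsilon>
  proof -
    have "(\<Sum>i\<in>I. (if i \<in> J then \<epsilon> * a i else 0) * x i) = \<epsilon> * lin x" for x
      unfolding lin_def by (simp add: if_distrib[of "\<lambda>u. u * _"] sum.If_cases[OF I] IJ sum_distrib_left mult.assoc cong: if_cong)
    moreover have "\<epsilon>\<^sup>2 = 1" using that by (metis power2_abs power_one)
    then have "(\<Sum>i\<in>I. (if i \<in> J then \<epsilon> * a i else 0)\<^sup>2) = (\<Sum>i\<in>J. (a i)\<^sup>2)"
      by (simp add: if_distrib[of "\<lambda>u. u\<^sup>2"] sum.If_cases[OF I] IJ power_mult_distrib cong: if_cong)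
    ultimately show ?thesis
      using PiM_normal_linear_tail[OF \<sigma> I A(1) _ L, of "\<lambda>i. if i \<in> J then \<epsilon> * a i else 0"] A(2)
      by (simp add: s_def)
  qed
  have sq_tail: "measure ?P (?E (\<lambda>x. c \<le> \<epsilon> * sq x)) \<le> exp (- L)" if "\<bar>\<epsilon>\<bar> = 1" for \<epsilon>
  proof -
    have e: "\<epsilon>\<^sup>2 = 1" using that by (metis power2_abs power_one)
    have "measure ?P (?E (\<lambda>x. \<theta> * c \<le> (\<epsilon> * \<theta>) * sq x)) \<le> exp (4 * n * (\<epsilon> * \<theta>)\<^sup>2 - \<theta> * c)"
      unfolding sq_def n_def using \<theta>0 that by (intro PiM_normal_square_tail[OF \<sigma> I J]) (simp add: abs_mult)
    also have "\<dots> \<le> exp (- L)" using n\<theta> \<theta>c by (simp add: power_mult_distrib e)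
    also have "(\<lambda>x. \<theta> * c \<le> (\<epsilon> * \<theta>) * sq x) = (\<lambda>x. c \<le> \<epsilon> * sq x)"
      using \<theta>0 by (simp add: mult.commute[of \<epsilon>] mult.assoc)
    finally show ?thesis .
  qed
  have "?E (\<lambda>x. 3 * \<sigma> * A * sqrt L + 5 * \<sigma>\<^sup>2 * (sqrt (n * L) + L)
        < \<bar>2 * \<rho> * (\<Sum>i\<in>J. a i * x i) + \<rho>\<^sup>2 * ((\<Sum>i\<in>J. (x i)\<^sup>2) - n * \<sigma>\<^sup>2)\<bar>)
     \<subseteq> (?E (\<lambda>x. s \<le> 1 * lin x) \<union> ?E (\<lambda>x. s \<le> - 1 * lin x)) \<union> (?E (\<lambda>x. c \<le> 1 * sq x) \<union> ?E (\<lambda>x. c \<le> - 1 * sq x))"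
    (is "?X \<subseteq> ?Y")
  proof
    fix x assume x: "x \<in> ?X"
    show "x \<in> ?Y"
    proof (rule ccontr)
      assume "x \<notin> ?Y"
      then have l: "\<bar>lin x\<bar> \<le> s" and q: "\<bar>sq x\<bar> \<le> c" using x by auto
      \<comment> \<open>Rounds 2 sqrt 2 up to the factor 3 of the statement.\<close>
      have "sqrt 2 \<le> 3 / 2" by (rule real_le_lsqrt) (auto simp: power2_eq_square)
      then have "2 * s \<le> 2 * (\<sigma> * A * (3 / 2 * sqrt L))"
        unfolding s_def using \<sigma> A sL by (simp add: real_sqrt_mult)
      moreover have "\<bar>2 * \<rho> * lin x\<bar> \<le> 2 * s"
        using mult_mono[OF \<rho>(2) l] \<rho> by (simp add: abs_mult)
      moreover have "\<rho>\<^sup>2 \<le> 1" using \<rho> by (simp add: power_le_one)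
      then have "\<bar>\<rho>\<^sup>2 * (\<sigma>\<^sup>2 * sq x)\<bar> \<le> 1 * (\<sigma>\<^sup>2 * c)"
        unfolding abs_mult using q by (intro mult_mono) auto
      moreover have "\<sigma>\<^sup>2 * sq x = (\<Sum>i\<in>J. (x i)\<^sup>2) - n * \<sigma>\<^sup>2"
        unfolding sq_def using \<sigma> by (simp add: field_simps)
      moreover have "2 * (\<sigma> * A * (3 / 2 * sqrt L)) = 3 * \<sigma> * A * sqrt L" by simp
      ultimately have "\<bar>2 * \<rho> * lin x\<bar> \<le> 3 * \<sigma> * A * sqrt L"
        "\<bar>\<rho>\<^sup>2 * ((\<Sum>i\<in>J. (x i)\<^sup>2) - n * \<sigma>\<^sup>2)\<bar> \<le> \<sigma>\<^sup>2 * c"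
        by (linarith, simp)
      then have "\<bar>2 * \<rho> * lin x + \<rho>\<^sup>2 * ((\<Sum>i\<in>J. (x i)\<^sup>2) - n * \<sigma>\<^sup>2)\<bar> \<le> 3 * \<sigma> * A * sqrt L + \<sigma>\<^sup>2 * c"
        by linarith
      then show False using x unfolding lin_def c_def by (simp add: algebra_simps)
    qed
  qed
  then have "measure ?P ?X \<le> measure ?P ?Y" by (rule P.finite_measure_mono) measurable
  also have "\<dots> \<le> (measure ?P (?E (\<lambda>x. s \<le> 1 * lin x)) + measure ?P (?E (\<lambda>x. s \<le> - 1 * lin x)))
    + (measure ?P (?E (\<lambda>x. c \<le> 1 * sq x)) + measure ?P (?E (\<lambda>x. c \<le> - 1 * sq x)))"
    by (intro order_trans[OF measure_Un_le] add_mono measure_Un_le) measurable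
  also have "\<dots> \<le> 4 * exp (- L)" using lin_tail[of 1] lin_tail[of "-1"] sq_tail[of 1] sq_tail[of "-1"] by simp
  finally show ?thesis .
qed

section \<open>Real symmetric matrices\<close>


lemma vnorm_nonneg[simp]: "0 \<le> vnorm v"
  by (simp add: vnorm_def L2_set_nonneg)

lemma vnorm_power2: "(vnorm v)\<^sup>2 = v \<bullet> v"
  by (simp add: vnorm_def L2_set_def scalar_prod_def sum_nonneg power2_eq_square lessThan_atLeast0)

lemma scalar_prod_self_nonneg[simp]: "0 \<le> (v :: real vec) \<bullet> v"
  by (simp add: vnorm_power2[symmetric])

lemma vnorm_eq_sqrt: "vnorm v = sqrt (v \<bullet> v)"
  by (simp add: vnorm_power2[symmetric])

lemma vnorm_eq_1_iff: "vnorm v = 1 \<longleftrightarrow> v \<bullet> v = 1"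
  by (simp add: vnorm_eq_sqrt)

lemma scalar_prod_self_eq_0_iff:
  assumes "v \<in> carrier_vec n" shows "(v :: real vec) \<bullet> v = 0 \<longleftrightarrow> v = 0\<^sub>v n"
  using assms by (auto simp: scalar_prod_def sum_nonneg_eq_0_iff power2_eq_square[symmetric])

lemma vnorm_eq_0_iff: "v \<in> carrier_vec n \<Longrightarrow> vnorm v = 0 \<longleftrightarrow> v = 0\<^sub>v n"
  by (simp add: vnorm_eq_sqrt scalar_prod_self_eq_0_iff)

lemma vnorm_zero[simp]: "vnorm (0\<^sub>v n) = 0"
  by (simp add: vnorm_eq_0_iff[of _ n])

lemma abs_scalar_prod_le:
  assumes "dim_vec v = dim_vec w" shows "\<bar>v \<bullet> w\<bar> \<le> vnorm v * vnorm w"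
proof -
  have "\<bar>v \<bullet> w\<bar> \<le> (\<Sum>i\<in>{..<dim_vec w}. \<bar>v $ i\<bar> * \<bar>w $ i\<bar>)"
    unfolding scalar_prod_def lessThan_atLeast0 by (rule order_trans[OF sum_abs]) (simp add: abs_mult)
  also have "\<dots> \<le> vnorm v * vnorm w"
    unfolding vnorm_def assms by (rule L2_set_mult_ineq)
  finally show ?thesis .
qed

lemma scalar_prod_le_vnorm:
  "v \<in> carrier_vec n \<Longrightarrow> w \<in> carrier_vec n \<Longrightarrow> v \<bullet> w \<le> vnorm v * vnorm w"
  using abs_scalar_prod_le[of v w] by auto

lemma vnorm_add_le:
  assumes "v \<in> carrier_vec n" "w \<in> carrier_vec n" shows "vnorm (v + w) \<le> vnorm v + vnorm w"
  using L2_set_triangle_ineq[of "\<lambda>i. v $ i" "\<lambda>i. w $ i" "{..<n}"] assms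
  by (auto simp: vnorm_def L2_set_def)

lemma vnorm_smult[simp]: "vnorm (c \<cdot>\<^sub>v v) = \<bar>c\<bar> * vnorm v"
  by (simp add: vnorm_def L2_set_def power_mult_distrib sum_distrib_left[symmetric] real_sqrt_mult)

lemma vnorm_diff_le:
  assumes "v \<in> carrier_vec n" "w \<in> carrier_vec n" shows "vnorm (v - w) \<le> vnorm v + vnorm w"
proof -
  have "v - w = v + (-1) \<cdot>\<^sub>v w" using assms by auto
  then show ?thesis using vnorm_add_le[of v n "(-1) \<cdot>\<^sub>v w"] assms by simp
qed

lemma vnorm_diff_power2:
  assumes [simp]: "v \<in> carrier_vec n" "w \<in> carrier_vec n"
  shows "(vnorm (v - w))\<^sup>2 = v \<bullet> v - 2 * (v \<bullet> w) + w \<bullet> w"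
  unfolding vnorm_power2
  by (simp add: minus_scalar_prod_distrib[of _ n] scalar_prod_minus_distrib[of _ n] comm_scalar_prod[of w n v])

lemma scalar_prod_mult_mat_vec:
  assumes "A \<in> carrier_mat m n" "x \<in> carrier_vec m" "y \<in> carrier_vec n"
  shows "x \<bullet> (A *\<^sub>v y) = (A\<^sup>T *\<^sub>v x) \<bullet> (y :: real vec)"
  using transpose_vec_mult_scalar[OF assms(1,3,2)] by simp

lemma mat_eqI_mult_vec:
  fixes A B :: "real mat"
  assumes A: "A \<in> carrier_mat m n" and B: "B \<in> carrier_mat m n"
    and eq: "\<And>x. x \<in> carrier_vec n \<Longrightarrow> A *\<^sub>v x = B *\<^sub>v x"
  shows "A = B"
proof (rule eq_matI)
  fix i j assume "i < dim_row B" "j < dim_col B"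
  then have i: "i < m" and j: "j < n" using B by auto
  have "(A *\<^sub>v unit_vec n j) $ i = (B *\<^sub>v unit_vec n j) $ i" using eq[of "unit_vec n j"] by simp
  then show "A $$ (i, j) = B $$ (i, j)" using A B i j by (simp add: scalar_prod_right_unit)
qed (use A B in auto)

section \<open>Householder reflections\<close>

text \<open>The identity if \<open>z = 0\<close>, since \<open>x / 0 = 0\<close>.\<close>

definition householder :: "nat \<Rightarrow> real vec \<Rightarrow> real mat" where
  "householder n z = mat n n (\<lambda>(i, j). (if i = j then 1 else 0) - 2 * z $ i * z $ j / (z \<bullet> z))"

lemma householder_carrier[simp]: "householder n z \<in> carrier_mat n n"
  by (simp add: householder_def)

lemma householder_transpose[simp]: "(householder n z)\<^sup>T = householder n z"
  by (rule eq_matI) (auto simp: householder_def)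

lemma householder_mult_vec:
  assumes z: "z \<in> carrier_vec n" and x: "x \<in> carrier_vec n"
  shows "householder n z *\<^sub>v x = x - (2 * (z \<bullet> x) / (z \<bullet> z)) \<cdot>\<^sub>v z"
proof (rule eq_vecI)
  fix i assume "i < dim_vec (x - (2 * (z \<bullet> x) / (z \<bullet> z)) \<cdot>\<^sub>v z)"
  then have i: "i < n" using z by simp
  define s where "s = z \<bullet> z"
  have "(householder n z *\<^sub>v x) $ i = (\<Sum>j\<in>{0..<n}. ((if i = j then 1 else 0) - 2 * z $ i * z $ j / s) * x $ j)"
    using i x by (simp add: householder_def scalar_prod_def s_def)
  also have "\<dots> = (\<Sum>j\<in>{0..<n}. (if i = j then x $ j else 0) - 2 * z $ i / s * (z $ j * x $ j))"
    by (intro sum.cong) (auto simp: algebra_simps)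
  also have "\<dots> = x $ i - 2 * z $ i / s * (z \<bullet> x)"
    unfolding sum_subtractf sum_distrib_left[symmetric] using i x by (simp add: scalar_prod_def)
  finally show "(householder n z *\<^sub>v x) $ i = (x - (2 * (z \<bullet> x) / (z \<bullet> z)) \<cdot>\<^sub>v z) $ i"
    using i z x by (simp add: s_def algebra_simps)
qed (use z in \<open>simp add: householder_def\<close>)

lemma householder_involutive_vec:
  assumes z[simp]: "z \<in> carrier_vec n" and x[simp]: "x \<in> carrier_vec n"
  shows "householder n z *\<^sub>v (householder n z *\<^sub>v x) = x"
proof -
  define c where "c = 2 * (z \<bullet> x) / (z \<bullet> z)"
  have H: "householder n z *\<^sub>v x = x - c \<cdot>\<^sub>v z" unfolding c_def by (rule householder_mult_vec) auto
  have "2 * (z \<bullet> (x - c \<cdot>\<^sub>v z)) / (z \<bullet> z) = - c"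
    by (cases "z \<bullet> z = 0") (auto simp: scalar_prod_minus_distrib[of _ n] c_def field_simps)
  then show ?thesis
    unfolding H by (subst householder_mult_vec[OF z])
      (auto intro!: eq_vecI simp: carrier_vecD[OF z] carrier_vecD[OF x])
qed

lemma householder_square[simp]:
  assumes z[simp]: "z \<in> carrier_vec n" shows "householder n z * householder n z = 1\<^sub>m n"
  by (rule mat_eqI_mult_vec[OF mult_carrier_mat[OF householder_carrier householder_carrier]])
    (auto simp: assoc_mult_mat_vec[of _ n n _ n] householder_involutive_vec)

text \<open>For vectors of equal length the hyperplane orthogonal to a - b is their mirror. The case
  a = b is included, as the reflection then degenerates to the identity, so later uses need no case
  distinction.\<close>

lemma householder_maps:
  assumes [simp]: "a \<in> carrier_vec n" "b \<in> carrier_vec n" and eq: "a \<bullet> a = b \<bullet> b"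
  shows "householder n (a - b) *\<^sub>v a = b"
proof -
  have z: "a - b \<in> carrier_vec n" by simp
  have "(a - b) \<bullet> (a - b) = 2 * ((a - b) \<bullet> a)"
    by (simp add: scalar_prod_minus_distrib[of _ n] minus_scalar_prod_distrib[of _ n] comm_scalar_prod[of b n a] eq)
  then have "2 * ((a - b) \<bullet> a) / ((a - b) \<bullet> (a - b)) = 1 \<or> a - b = 0\<^sub>v n"
    using scalar_prod_self_eq_0_iff[OF z] by auto
  then show ?thesis
    unfolding householder_mult_vec[OF z assms(1)]
  proof
    assume "a - b = 0\<^sub>v n"
    then have "a $ i = b $ i" if "i < n" for i
      using that assms(1,2) by (metis carrier_vecD eq_iff_diff_eq_0 index_minus_vec(1) index_zero_vec(1))
    then have "a = b" by (intro eq_vecI) (auto simp: carrier_vecD[OF assms(1)] carrier_vecD[OF assms(2)])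
    then show "a - (2 * ((a - b) \<bullet> a) / ((a - b) \<bullet> (a - b))) \<cdot>\<^sub>v (a - b) = b" by auto
  qed auto
qed

section \<open>The spectral theorem for real symmetric matrices\<close>

text \<open>Factor over the complex numbers, show that every root is real, and pull the
  factorization back along the injective embedding of real polynomials.\<close>

lemma char_poly_real_symmetric_splits:
  fixes A :: "real mat"
  assumes A: "A \<in> carrier_mat n n" and sym: "A\<^sup>T = A"
  shows "\<exists>es. length es = n \<and> char_poly A = (\<Prod>a\<leftarrow>es. [:- a, 1:])"
proof -
  let ?A = "map_mat complex_of_real A"
  have cA: "?A \<in> carrier_mat n n" using A by simp
  obtain as where as: "char_poly ?A = (\<Prod>a\<leftarrow>as. [:- a, 1:])" "length as = n"
    using char_poly_factorized[OF cA] by auto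
  have real: "a \<in> \<real>" if "a \<in> set as" for a
  proof -
    have "poly (char_poly ?A) a = 0" unfolding as using that by (auto simp: poly_prod_list prod_list_zero_iff)
    then obtain v where v: "v \<in> carrier_vec n" "v \<noteq> 0\<^sub>v n" "?A *\<^sub>v v = a \<cdot>\<^sub>v v"
      using eigenvalue_root_char_poly[OF cA] cA unfolding eigenvalue_def eigenvector_def by auto
    have Av: "(\<Sum>j<n. complex_of_real (A $$ (i, j)) * v $ j) = a * v $ i" if "i < n" for i
    proof -
      have "(?A *\<^sub>v v) $ i = (a \<cdot>\<^sub>v v) $ i" using v(3) by simp
      then show ?thesis using that A v(1) by (simp add: scalar_prod_def lessThan_atLeast0)
    qed
    have symA: "A $$ (i, j) = A $$ (j, i)" if "i < n" "j < n" for i j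
      using sym that A by (metis carrier_matD index_transpose_mat(1))
    \<comment> \<open>The Hermitian form of \<open>A\<close> at the eigenvector \<open>v\<close>: it
      equals its own conjugate by symmetry, and it is \<open>a\<close> times the squared norm of
      \<open>v\<close>.\<close>
    define q where "q = (\<Sum>i<n. \<Sum>j<n. cnj (v $ i) * (complex_of_real (A $$ (i, j)) * v $ j))"
    have q: "q = a * (\<Sum>i<n. cnj (v $ i) * v $ i)"
      unfolding q_def sum_distrib_left[symmetric] using Av by (simp add: sum_distrib_left mult_ac)
    have "cnj q = (\<Sum>i<n. \<Sum>j<n. v $ i * (complex_of_real (A $$ (i, j)) * cnj (v $ j)))"
      unfolding q_def by simp
    also have "\<dots> = (\<Sum>i<n. \<Sum>j<n. v $ j * (complex_of_real (A $$ (j, i)) * cnj (v $ i)))"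
      by (rule sum.swap)
    also have "\<dots> = q"
      unfolding q_def by (intro sum.cong refl) (simp add: symA mult_ac)
    finally have "cnj q = q" .
    define r where "r = (\<Sum>i<n. (cmod (v $ i))\<^sup>2)"
    have r: "(\<Sum>i<n. cnj (v $ i) * v $ i) = complex_of_real r"
      unfolding r_def of_real_sum by (intro sum.cong refl) (simp add: complex_norm_square mult.commute del: of_real_power)
    have "r \<noteq> 0"
    proof
      assume "r = 0"
      then have "v $ i = 0" if "i < n" for i using that by (simp add: r_def sum_nonneg_eq_0_iff)
      then have "v = 0\<^sub>v n" using v(1) by (intro eq_vecI) auto
      then show False using v by simp
    qed
    have "cnj a * complex_of_real r = a * complex_of_real r"
      using \<open>cnj q = q\<close> unfolding q r by simp
    then have "cnj a = a" using \<open>r \<noteq> 0\<close> by simp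
    then show "a \<in> \<real>" by (simp add: Reals_cnj_iff)
  qed
  interpret mp: map_poly_inj_comm_ring_hom complex_of_real ..
  have "char_poly ?A = map_poly complex_of_real (char_poly A)" by (rule of_real_hom.char_poly_hom[OF A])
  then have "map_poly complex_of_real (char_poly A) = (\<Prod>a\<leftarrow>as. [:- a, 1:])"
    using as(1) by (simp only:)
  also have "\<dots> = (\<Prod>a\<leftarrow>map Re as. map_poly complex_of_real [:- a, 1:])"
    using real by (induction as) auto
  also have "\<dots> = map_poly complex_of_real (\<Prod>a\<leftarrow>map Re as. [:- a, 1:])"
    by (simp add: mp.hom_prod_list comp_def)
  finally have "char_poly A = (\<Prod>a\<leftarrow>map Re as. [:- a, 1:])"
    by (rule mp.injectivity)
  then show ?thesis using as(2) by (intro exI[of _ "map Re as"]) simp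
qed


text \<open>Induction by deflation. The same list \<open>es\<close> appears in the diagonalization
  and in the characteristic polynomial, which ties it to \<open>sing_vals\<close>.\<close>

lemma real_symmetric_spectral:
  fixes A :: "real mat"
  assumes "A \<in> carrier_mat n n" and "A\<^sup>T = A"
  shows "\<exists>P es. P \<in> carrier_mat n n \<and> P\<^sup>T * P = 1\<^sub>m n \<and> length es = n \<and> sorted_wrt (\<ge>) es \<and>
    char_poly A = (\<Prod>a\<leftarrow>es. [:- a, 1:]) \<and> A = P * mat_diag n (\<lambda>i. es ! i) * P\<^sup>T"
  using assms
proof (induction n arbitrary: A)
  case 0
  obtain es where "length es = 0" "char_poly A = (\<Prod>a\<leftarrow>es. [:- a, 1:])"
    using char_poly_real_symmetric_splits[OF 0] by auto
  then show ?case using 0 by (intro exI[of _ "0\<^sub>m 0 0"] exI[of _ "[]"]) auto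
next
  case (Suc n)
  let ?N = "Suc n"
  note A[simp] = Suc.prems(1)
  obtain fs where fs: "length fs = ?N" "char_poly A = (\<Prod>a\<leftarrow>fs. [:- a, 1:])"
    using char_poly_real_symmetric_splits[OF Suc.prems] by auto
  \<comment> \<open>Splitting off the largest root keeps \<open>e # es\<close> decreasing, because
    the roots of the remaining block are roots of \<open>char_poly A\<close> too.\<close>
  define e where "e = Max (set fs)"
  have "set fs \<noteq> {}" using fs(1) by auto
  then have e: "e \<in> set fs" "\<And>a. a \<in> set fs \<Longrightarrow> a \<le> e" unfolding e_def by auto
  have "poly (char_poly A) e = 0" unfolding fs using e by (auto simp: poly_prod_list prod_list_zero_iff)
  then obtain w where w: "w \<in> carrier_vec ?N" "w \<noteq> 0\<^sub>v ?N" "A *\<^sub>v w = e \<cdot>\<^sub>v w"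
    using eigenvalue_root_char_poly[OF A] A unfolding eigenvalue_def eigenvector_def by auto
  define v where "v = (1 / vnorm w) \<cdot>\<^sub>v w"
  have nw: "vnorm w \<noteq> 0" using w by (simp add: vnorm_eq_0_iff)
  have v[simp]: "v \<in> carrier_vec ?N" and "vnorm v = 1" and Av: "A *\<^sub>v v = e \<cdot>\<^sub>v v"
    unfolding v_def using w nw by (auto simp: mult_mat_vec[OF A] smult_smult_assoc mult.commute)
  let ?u = "unit_vec ?N 0 :: real vec"
  \<comment> \<open>One reflection exchanges the first basis vector and the eigenvector, so
    \<open>H * A * H\<close> is block diagonal with \<open>e\<close> in the corner.\<close>
  define H where "H = householder ?N (?u - v)"
  have [simp]: "H \<in> carrier_mat ?N ?N" "H\<^sup>T = H" unfolding H_def by auto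
  have HH: "H * H = 1\<^sub>m ?N" unfolding H_def by (rule householder_square) simp
  have Hu: "H *\<^sub>v ?u = v" unfolding H_def
    using \<open>vnorm v = 1\<close> by (intro householder_maps) (auto simp: vnorm_eq_1_iff)
  have Hv: "H *\<^sub>v v = ?u"
    unfolding Hu[symmetric] unfolding H_def by (rule householder_involutive_vec) auto
  define B where "B = H * A * H"
  have B[simp]: "B \<in> carrier_mat ?N ?N" unfolding B_def by (auto intro!: mult_carrier_mat[of _ _ ?N])
  have BT: "B\<^sup>T = B"
    unfolding B_def using Suc.prems(2)
    by (simp add: transpose_mult[of _ ?N ?N _ ?N] assoc_mult_mat[of _ ?N ?N _ ?N _ ?N] mult_carrier_mat[of _ _ ?N])
  have Bu: "B *\<^sub>v ?u = e \<cdot>\<^sub>v ?u"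
    unfolding B_def
    by (simp add: assoc_mult_mat_vec[of _ ?N ?N _ ?N] mult_carrier_mat[of _ _ ?N] Hu Av Hv mult_mat_vec[of _ ?N ?N])
  have colB: "B $$ (i, 0) = (if i = 0 then e else 0)" if "i < ?N" for i
  proof -
    have "(B *\<^sub>v ?u) $ i = (e \<cdot>\<^sub>v ?u) $ i" unfolding Bu ..
    then show ?thesis using that carrier_matD[OF B] by (auto simp: scalar_prod_right_unit split: if_splits)
  qed
  have symB: "B $$ (i, j) = B $$ (j, i)" if "i < ?N" "j < ?N" for i j
    using BT that B by (metis carrier_matD index_transpose_mat(1))
  define A' where "A' = mat n n (\<lambda>(i, j). B $$ (Suc i, Suc j))"
  define E where "E = mat 1 1 (\<lambda>_. e)"
  have A': "A' \<in> carrier_mat n n" "A'\<^sup>T = A'"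
    unfolding A'_def using symB by (auto intro!: eq_matI)
  have E: "E \<in> carrier_mat 1 1" unfolding E_def by simp
  have Bblock: "B = four_block_mat E (0\<^sub>m 1 n) (0\<^sub>m n 1) A'"
  proof (rule eq_matI)
    fix i j assume "i < dim_row (four_block_mat E (0\<^sub>m 1 n) (0\<^sub>m n 1) A')" "j < dim_col (four_block_mat E (0\<^sub>m 1 n) (0\<^sub>m n 1) A')"
    then have ij: "i < ?N" "j < ?N" by (auto simp: E_def A'_def)
    then show "B $$ (i, j) = four_block_mat E (0\<^sub>m 1 n) (0\<^sub>m n 1) A' $$ (i, j)"
      using colB[of i] colB[of j] symB[of 0 j]
      by (cases i; cases j) (auto simp: E_def A'_def)
  qed (use carrier_matD[OF B] in \<open>auto simp: E_def A'_def\<close>)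
  have "similar_mat A B"
    unfolding similar_mat_def similar_mat_wit_def Let_def
  proof (intro exI[of _ H] conjI)
    show "A = H * B * H"
    proof -
      have "H * B * H = (H * H) * A * (H * H)" unfolding B_def
        by (simp add: assoc_mult_mat[of _ ?N ?N _ ?N _ ?N] mult_carrier_mat[of _ _ ?N])
      then show ?thesis unfolding HH by (simp add: left_mult_one_mat[OF A] right_mult_one_mat[OF A])
    qed
  qed (use HH carrier_matD[OF A] in auto)
  then have "char_poly A = char_poly B" by (rule char_poly_similar)
  also have "\<dots> = char_poly E * char_poly A'"
    unfolding Bblock by (rule char_poly_four_block_zeros_col[OF E _ A'(1)]) simp
  also have "char_poly E = [:- e, 1:]"
    using char_poly_upper_triangular[OF E] by (simp add: E_def diag_mat_def upper_triangular_def)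
  finally have cp: "char_poly A = [:- e, 1:] * char_poly A'" .
  obtain P es where P[simp]: "P \<in> carrier_mat n n" and PP: "P\<^sup>T * P = 1\<^sub>m n" and es: "length es = n" "sorted_wrt (\<ge>) es"
    "char_poly A' = (\<Prod>a\<leftarrow>es. [:- a, 1:])" and PDP: "A' = P * mat_diag n (\<lambda>i. es ! i) * P\<^sup>T"
    using Suc.IH[OF A'] by auto
  have le: "a \<le> e" if "a \<in> set es" for a
  proof -
    have "poly (char_poly A') a = 0" unfolding es using that by (auto simp: poly_prod_list prod_list_zero_iff)
    then have "poly (char_poly A) a = 0" unfolding cp by simp
    then have "a \<in> set fs" unfolding fs by (auto simp: poly_prod_list prod_list_zero_iff)
    then show ?thesis by (rule e(2))
  qed
  define F where "F = four_block_mat (1\<^sub>m 1) (0\<^sub>m 1 n) (0\<^sub>m n 1) P"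
  have F[simp]: "F \<in> carrier_mat ?N ?N" unfolding F_def using four_block_carrier_mat[of "1\<^sub>m 1" 1 1 P n n] by simp
  have FT: "F\<^sup>T = four_block_mat (1\<^sub>m 1) (0\<^sub>m 1 n) (0\<^sub>m n 1) P\<^sup>T"
    unfolding F_def by (subst transpose_four_block_mat[of _ 1 1 _ n _ n]) auto
  have FF: "F\<^sup>T * F = 1\<^sub>m ?N"
    unfolding FT unfolding F_def
    by (subst mult_four_block_mat[of _ 1 1 _ n _ n _ _ 1 _ n]) 
       (auto simp: PP left_mult_zero_mat[OF P] right_mult_zero_mat[of "P\<^sup>T" n n])
  define D where "D = mat_diag n (\<lambda>i. es ! i)"
  have Dc[simp]: "D \<in> carrier_mat n n" unfolding D_def by simp
  have D: "mat_diag ?N (\<lambda>i. (e # es) ! i) = four_block_mat E (0\<^sub>m 1 n) (0\<^sub>m n 1) D"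
    unfolding D_def by (rule eq_matI) (auto simp: mat_diag_def E_def nth_Cons')
  have FDF: "F * mat_diag ?N (\<lambda>i. (e # es) ! i) * F\<^sup>T = B"
    unfolding D FT unfolding F_def Bblock PDP D_def[symmetric]
    using E
    apply (subst mult_four_block_mat[of _ 1 1 _ n _ n _ _ 1 _ n]) apply auto[6]
    apply (subst mult_four_block_mat[of _ 1 1 _ n _ n _ _ 1 _ n])
    by (auto simp: mult_carrier_mat[of _ n n] left_mult_zero_mat[OF Dc] right_mult_zero_mat[OF P]
      left_mult_zero_mat[of "P\<^sup>T" n n] left_mult_one_mat[OF E[simplified]] right_mult_one_mat[OF E[simplified]]
      right_mult_zero_mat[of "P * D" n n])
  have [simp]: "F\<^sup>T \<in> carrier_mat ?N ?N" by simp
  show ?case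
  proof (intro exI[of _ "H * F"] exI[of _ "e # es"] conjI)
    show "H * F \<in> carrier_mat ?N ?N" by (auto intro!: mult_carrier_mat[of _ _ ?N])
    have HFT: "(H * F)\<^sup>T = F\<^sup>T * H" by (simp add: transpose_mult[of _ ?N ?N _ ?N])
    have "(H * F)\<^sup>T * (H * F) = F\<^sup>T * (H * H) * F" unfolding HFT
      by (simp add: assoc_mult_mat[of _ ?N ?N _ ?N _ ?N] mult_carrier_mat[of _ _ ?N])
    then show "(H * F)\<^sup>T * (H * F) = 1\<^sub>m ?N" unfolding HH by (simp add: FF right_mult_one_mat[of "F\<^sup>T" ?N ?N])
    show "length (e # es) = ?N" using es by simp
    show "sorted_wrt (\<ge>) (e # es)" using es le by simp
    show "char_poly A = (\<Prod>a\<leftarrow>e # es. [:- a, 1:])" unfolding cp es by simp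
    have "H * F * mat_diag ?N (\<lambda>i. (e # es) ! i) * (H * F)\<^sup>T
      = H * (F * mat_diag ?N (\<lambda>i. (e # es) ! i) * F\<^sup>T) * H" unfolding HFT
      by (simp add: assoc_mult_mat[of _ ?N ?N _ ?N _ ?N] mult_carrier_mat[of _ _ ?N])
    also have "\<dots> = H * B * H" unfolding FDF ..
    also have "\<dots> = (H * H) * A * (H * H)" unfolding B_def
      by (simp add: assoc_mult_mat[of _ ?N ?N _ ?N _ ?N] mult_carrier_mat[of _ _ ?N])
    finally show "A = H * F * mat_diag ?N (\<lambda>i. (e # es) ! i) * (H * F)\<^sup>T"
      unfolding HH by (simp add: left_mult_one_mat[OF A] right_mult_one_mat[OF A])
  qed
qed


section \<open>Singular values and the spectrum of the Gram matrix\<close>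

lemma sorted_eigenvalue_list:
  assumes "sorted_wrt (\<ge>) es" and "p = (\<Prod>a\<leftarrow>es. [:- a, 1:])"
  shows "rev (sorted_list_of_multiset (proots p)) = (es :: real list)"
proof -
  have "proots (\<Prod>a\<leftarrow>es. [:- a, 1:]) = mset es" for es :: "real list"
  proof (induction es)
    case (Cons a es)
    have "proots ([:- a, 1:] * (\<Prod>a\<leftarrow>es. [:- a, 1:])) = {#a#} + mset es"
      by (subst proots_mult) (auto simp: prod_list_zero_iff Cons.IH simp del: mult_pCons_left)
    then show ?case by simp
  qed simp
  then have "proots p = mset es" unfolding assms(2) .
  moreover have "sorted (rev es)"
    using assms(1) by (simp add: sorted_wrt_rev)
  ultimately show ?thesis
    by (metis mset_rev rev_rev_ident sorted_list_of_multiset_mset sorted_sort_id)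
qed

text \<open>\<open>eigengap\<close> is defined through the singular values of its argument but is
  applied to \<open>M * M\<^sup>T\<close>. For a positive semidefinite matrix singular values are
  eigenvalues, since \<open>S * S\<^sup>T\<close> is the square of \<open>S\<close>.\<close>

lemma sing_vals_of_spectral:
  assumes P: "P \<in> carrier_mat n n" "P\<^sup>T * P = 1\<^sub>m n" and es: "length es = n" "sorted_wrt (\<ge>) es" "\<forall>a\<in>set es. 0 \<le> a"
    and S: "S = P * mat_diag n (\<lambda>i. es ! i) * P\<^sup>T"
  shows "sing_vals S = es"
proof -
  note [simp] = P(1)
  let ?D = "mat_diag n (\<lambda>i. es ! i)" and ?E = "mat_diag n (\<lambda>i. (es ! i)\<^sup>2)"
  have Pc: "P * P\<^sup>T = 1\<^sub>m n"
    using mat_mult_left_right_inverse[OF _ P(1) P(2)] P(1) by simp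
  have [simp]: "S \<in> carrier_mat n n" unfolding S by (auto intro!: mult_carrier_mat[of _ _ n])
  have "?D\<^sup>T = ?D" by (rule eq_matI) (auto simp: mat_diag_def)
  then have "S\<^sup>T = S" unfolding S
    by (simp add: transpose_mult[of _ n n _ n] assoc_mult_mat[of _ n n _ n _ n] mult_carrier_mat[of _ _ n])
  then have "S * S\<^sup>T = P * ?D * (P\<^sup>T * P) * ?D * P\<^sup>T" unfolding S
    by (simp add: assoc_mult_mat[of _ n n _ n _ n] mult_carrier_mat[of _ _ n])
  also have "\<dots> = P * (?D * ?D) * P\<^sup>T" unfolding P(2)
    by (simp add: assoc_mult_mat[of _ n n _ n _ n] mult_carrier_mat[of _ _ n] left_mult_one_mat[of _ n n]
        del: mat_diag_diag)
  also have "?D * ?D = ?E" by (simp add: power2_eq_square)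
  finally have SS: "S * S\<^sup>T = P * ?E * P\<^sup>T" .
  have "similar_mat (S * S\<^sup>T) ?E"
    unfolding similar_mat_def similar_mat_wit_def Let_def
  proof (rule exI[of _ P], rule exI[of _ "P\<^sup>T"], intro conjI)
    show "S * S\<^sup>T = P * ?E * P\<^sup>T" by (rule SS)
  qed (use Pc P carrier_matD[of S n n] in \<open>auto intro!: mult_carrier_mat[of _ _ n]\<close>)
  then have "char_poly (S * S\<^sup>T) = char_poly ?E" by (rule char_poly_similar)
  also have "\<dots> = (\<Prod>a\<leftarrow>diag_mat ?E. [:- a, 1:])"
    by (rule char_poly_upper_triangular[OF mat_diag_dim]) (auto simp: upper_triangular_def mat_diag_def)
  also have "diag_mat ?E = map (\<lambda>a. a\<^sup>2) es"
    using es(1) by (intro nth_equalityI) (auto simp: diag_mat_def mat_diag_def)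
  finally have cp: "char_poly (S * S\<^sup>T) = (\<Prod>a\<leftarrow>map (\<lambda>a. a\<^sup>2) es. [:- a, 1:])" .
  have "sorted_wrt (\<ge>) (map (\<lambda>a. a\<^sup>2) es)"
    unfolding sorted_wrt_map using es by (intro sorted_wrt_mono_rel[OF _ es(2)]) (auto intro: power_mono)
  from sorted_eigenvalue_list[OF this cp]
  have "sing_vals S = map sqrt (map (\<lambda>a. a\<^sup>2) es)" unfolding sing_vals_def by simp
  also have "\<dots> = es" using es(3) by (simp add: map_idI)
  finally show ?thesis .
qed

text \<open>The interface between the definitions and linear algebra. The eigenbasis is indexed from
  0 and singular values from 1, hence the \<open>Suc\<close>; the clause on
  \<open>sing_val (M * M\<^sup>T) i\<close> makes the eigengap of the Gram matrix a gap of
  squares.\<close>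

lemma gram_spectral:
  fixes M :: "real mat"
  assumes M: "M \<in> carrier_mat d m"
  obtains P where "P \<in> carrier_mat d d" "P\<^sup>T * P = 1\<^sub>m d"
    "M * M\<^sup>T = P * mat_diag d (\<lambda>i. (sing_val M (Suc i))\<^sup>2) * P\<^sup>T"
    "\<And>i j. i \<le> j \<Longrightarrow> sing_val M (Suc j) \<le> sing_val M (Suc i)" "\<And>i. 0 \<le> sing_val M i"
    "\<And>i. sing_val (M * M\<^sup>T) i = (sing_val M i)\<^sup>2" "\<And>i. d < i \<Longrightarrow> sing_val M i = 0"
proof -
  let ?S = "M * M\<^sup>T"
  have S: "?S \<in> carrier_mat d d" using M by auto
  have T: "?S\<^sup>T = ?S" using M by (simp add: transpose_mult[of _ d m _ d])
  obtain P es where P: "P \<in> carrier_mat d d" "P\<^sup>T * P = 1\<^sub>m d" and es: "length es = d" "sorted_wrt (\<ge>) es"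
    and cp: "char_poly ?S = (\<Prod>a\<leftarrow>es. [:- a, 1:])" and PDP: "?S = P * mat_diag d (\<lambda>i. es ! i) * P\<^sup>T"
    using real_symmetric_spectral[OF S T] by auto
  \<comment> \<open>An eigenvalue \<open>a\<close> with eigenvector \<open>w\<close> satisfies a
    |w|^2 = |M^T w|^2.\<close>
  have nonneg: "0 \<le> a" if "a \<in> set es" for a
  proof -
    have "poly (char_poly ?S) a = 0" unfolding cp using that by (auto simp: poly_prod_list prod_list_zero_iff)
    then obtain w where "eigenvector ?S w a"
      using eigenvalue_root_char_poly[OF S] unfolding eigenvalue_def by blast
    then have w: "w \<in> carrier_vec d" "w \<noteq> 0\<^sub>v d" "?S *\<^sub>v w = a \<cdot>\<^sub>v w"
      using S unfolding eigenvector_def by (simp_all only: carrier_matD simp_thms)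
    have "a * (w \<bullet> w) = w \<bullet> (?S *\<^sub>v w)" using w by simp
    also have "\<dots> = w \<bullet> (M *\<^sub>v (M\<^sup>T *\<^sub>v w))" using w M by (simp add: assoc_mult_mat_vec[of _ d m _ d])
    also have "\<dots> = (M\<^sup>T *\<^sub>v w) \<bullet> (M\<^sup>T *\<^sub>v w)" using w M by (intro scalar_prod_mult_mat_vec[of _ d m]) auto
    also have "\<dots> \<ge> 0" by simp
    finally have "0 \<le> a * (w \<bullet> w)" .
    moreover have "0 < w \<bullet> w"
      using w scalar_prod_self_eq_0_iff[of w d] scalar_prod_self_nonneg[of w] by linarith
    ultimately show "0 \<le> a" by (simp add: zero_le_mult_iff)
  qed
  have sv: "sing_vals M = map sqrt es" unfolding sing_vals_def sorted_eigenvalue_list[OF es(2) cp] ..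
  have sv1: "sing_val M (Suc i) = (if i < d then sqrt (es ! i) else 0)" for i
    unfolding sing_val_def sv using es by auto
  have sv0: "sing_val M 0 = 0" "sing_val (M * M\<^sup>T) 0 = 0" unfolding sing_val_def by auto
  have nn: "0 \<le> es ! i" if "i < d" for i using nonneg that es by simp
  have svS: "sing_vals ?S = es" using P es nonneg PDP by (intro sing_vals_of_spectral) auto
  show thesis
  proof (rule that[OF P])
    show "?S = P * mat_diag d (\<lambda>i. (sing_val M (Suc i))\<^sup>2) * P\<^sup>T"
    proof -
      have "mat_diag d (\<lambda>i. (sing_val M (Suc i))\<^sup>2) = mat_diag d (\<lambda>i. es ! i)"
        by (rule eq_matI) (auto simp: mat_diag_def sv1 nn)
      then show ?thesis using PDP by simp
    qed
    show "sing_val M (Suc j) \<le> sing_val M (Suc i)" if "i \<le> j" for i j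
      using that es sorted_wrt_nth_less[OF es(2), of i j] nn by (cases "i = j") (auto simp: sv1)
    show "0 \<le> sing_val M i" for i using nn by (cases i) (auto simp: sv0 sv1)
    show "sing_val ?S i = (sing_val M i)\<^sup>2" for i
      using nn es by (cases i) (auto simp: sv0 sv1 sing_val_def[of ?S] svS)
    show "sing_val M i = 0" if "d < i" for i using that by (cases i) (auto simp: sv0 sv1)
  qed
qed

lemma mult_mat_vec_diff:
  fixes A :: "real mat"
  assumes "A \<in> carrier_mat m n" "x \<in> carrier_vec n" "y \<in> carrier_vec n"
  shows "A *\<^sub>v (x - y) = A *\<^sub>v x - A *\<^sub>v y"
  using assms by (intro eq_vecI) (auto simp: scalar_prod_minus_distrib[of _ n] carrier_vecD[OF assms(2)] carrier_vecD[OF assms(3)])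

section \<open>Operator norms and quadratic forms\<close>

lemma sum_power2_eq_scalar_prod:
  assumes "x \<in> carrier_vec n" shows "(\<Sum>i<n. (x $ i)\<^sup>2) = (x :: real vec) \<bullet> x"
  using assms by (simp add: scalar_prod_def power2_eq_square lessThan_atLeast0)

text \<open>Cauchy-Schwarz in each row. It makes the suprema below finite, and later bounds a
  difference of matrices by the Euclidean distance of the noise tensors.\<close>

lemma vnorm_mult_mat_vec_le_frobenius:
  assumes A: "A \<in> carrier_mat m n" and x: "x \<in> carrier_vec n"
  shows "vnorm (A *\<^sub>v x) \<le> sqrt (\<Sum>i<m. \<Sum>j<n. (A $$ (i, j))\<^sup>2) * vnorm x"
proof -
  have "((A *\<^sub>v x) $ i)\<^sup>2 \<le> (\<Sum>j<n. (A $$ (i, j))\<^sup>2) * (x \<bullet> x)" if i: "i < m" for i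
  proof -
    have r: "row A i \<in> carrier_vec n" using A by auto
    have "\<bar>row A i \<bullet> x\<bar>\<^sup>2 \<le> (vnorm (row A i) * vnorm x)\<^sup>2"
      using abs_scalar_prod_le[of "row A i" x] A x by (intro power_mono) auto
    also have "\<dots> = (row A i \<bullet> row A i) * (x \<bullet> x)" by (simp add: power_mult_distrib vnorm_power2)
    also have "row A i \<bullet> row A i = (\<Sum>j<n. (A $$ (i, j))\<^sup>2)"
      using A i by (simp add: sum_power2_eq_scalar_prod[OF r, symmetric])
    finally show ?thesis using A i by simp
  qed
  then have "(\<Sum>i<m. ((A *\<^sub>v x) $ i)\<^sup>2) \<le> (\<Sum>i<m. (\<Sum>j<n. (A $$ (i, j))\<^sup>2) * (x \<bullet> x))"
    by (intro sum_mono) auto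
  then have "(A *\<^sub>v x) \<bullet> (A *\<^sub>v x) \<le> (\<Sum>i<m. \<Sum>j<n. (A $$ (i, j))\<^sup>2) * (x \<bullet> x)"
    unfolding sum_power2_eq_scalar_prod[OF mult_mat_vec_carrier[OF A x]] sum_distrib_right[symmetric] .
  then show ?thesis
    by (simp add: vnorm_eq_sqrt real_sqrt_mult[symmetric])
qed

lemma op_norm_bdd_above:
  assumes M: "M \<in> carrier_mat m n"
  shows "bdd_above ((\<lambda>x. vnorm (M *\<^sub>v x)) ` {x \<in> carrier_vec (dim_col M). vnorm x \<le> 1})"
proof (rule bdd_aboveI2)
  fix y assume y: "y \<in> {x \<in> carrier_vec (dim_col M). vnorm x \<le> 1}"
  have "vnorm (M *\<^sub>v y) \<le> sqrt (\<Sum>i<m. \<Sum>j<n. (M $$ (i, j))\<^sup>2) * vnorm y"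
    using y M by (intro vnorm_mult_mat_vec_le_frobenius) auto
  also have "\<dots> \<le> sqrt (\<Sum>i<m. \<Sum>j<n. (M $$ (i, j))\<^sup>2) * 1"
    using y by (intro mult_left_mono) (auto intro!: sum_nonneg)
  finally show "vnorm (M *\<^sub>v y) \<le> sqrt (\<Sum>i<m. \<Sum>j<n. (M $$ (i, j))\<^sup>2) * 1" .
qed

lemma op_norm_bound:
  assumes M: "M \<in> carrier_mat m n" and x: "x \<in> carrier_vec n"
  shows "vnorm (M *\<^sub>v x) \<le> op_norm M * vnorm x"
proof (cases "vnorm x = 0")
  case True
  then show ?thesis using vnorm_mult_mat_vec_le_frobenius[OF M x] by simp
next
  case False
  define y where "y = (1 / vnorm x) \<cdot>\<^sub>v x"
  have "vnorm (M *\<^sub>v y) \<le> op_norm M"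
    unfolding op_norm_def using op_norm_bdd_above[OF M] x M False by (intro cSUP_upper) (auto simp: y_def)
  moreover have "M *\<^sub>v y = (1 / vnorm x) \<cdot>\<^sub>v (M *\<^sub>v x)" unfolding y_def using M x by (simp add: mult_mat_vec)
  moreover have "0 < vnorm x" using False by (simp add: order_less_le)
  ultimately show ?thesis by (simp add: field_simps)
qed

lemma op_norm_nonneg:
  assumes M: "M \<in> carrier_mat m n" shows "0 \<le> op_norm M"
proof -
  have "vnorm (M *\<^sub>v 0\<^sub>v n) \<le> op_norm M"
    unfolding op_norm_def using op_norm_bdd_above[OF M] M by (intro cSUP_upper) auto
  then show ?thesis using vnorm_nonneg order_trans by blast
qed

text \<open>|M^T x|^2 = <x, M M^T x> <= |x| |M| |M^T x|; cancel one factor.\<close>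

lemma op_norm_transpose_bound:
  assumes M: "M \<in> carrier_mat m n" and x: "x \<in> carrier_vec m"
  shows "vnorm (M\<^sup>T *\<^sub>v x) \<le> op_norm M * vnorm x"
proof (cases "vnorm (M\<^sup>T *\<^sub>v x) = 0")
  case True
  then show ?thesis using op_norm_nonneg[OF M] by simp
next
  case False
  have "(vnorm (M\<^sup>T *\<^sub>v x))\<^sup>2 = x \<bullet> (M *\<^sub>v (M\<^sup>T *\<^sub>v x))"
    unfolding vnorm_power2 using M x by (subst scalar_prod_mult_mat_vec[of M m n]) auto
  also have "\<dots> \<le> vnorm x * vnorm (M *\<^sub>v (M\<^sup>T *\<^sub>v x))"
    using M x by (intro scalar_prod_le_vnorm[of _ m]) auto
  also have "\<dots> \<le> vnorm x * (op_norm M * vnorm (M\<^sup>T *\<^sub>v x))"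
    using M x by (intro mult_left_mono op_norm_bound) auto
  finally have "vnorm (M\<^sup>T *\<^sub>v x) * vnorm (M\<^sup>T *\<^sub>v x) \<le> (op_norm M * vnorm x) * vnorm (M\<^sup>T *\<^sub>v x)"
    by (simp add: power2_eq_square mult_ac)
  moreover have "0 < vnorm (M\<^sup>T *\<^sub>v x)" using False by (simp add: order_less_le)
  ultimately show ?thesis by (simp add: mult_le_cancel_right)
qed

text \<open>Polarization of the form at \<open>b \<cdot>\<^sub>v x\<close> and
  \<open>a \<cdot>\<^sub>v y\<close>, where y = G x, a = |x| and b = |y|. The scaling gives both
  vectors the same length, so that the parallelogram sum loses nothing.\<close>

lemma vnorm_le_of_quadratic_form:
  fixes G :: "real mat"
  assumes G[simp]: "G \<in> carrier_mat d d" and sym: "G\<^sup>T = G"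
    and quad: "\<And>x. x \<in> carrier_vec d \<Longrightarrow> \<bar>x \<bullet> (G *\<^sub>v x)\<bar> \<le> \<epsilon> * (x \<bullet> x)"
    and x[simp]: "x \<in> carrier_vec d"
  shows "vnorm (G *\<^sub>v x) \<le> \<epsilon> * vnorm x"
proof -
  define y where "y = G *\<^sub>v x"
  have [simp]: "y \<in> carrier_vec d" unfolding y_def by (rule mult_mat_vec_carrier[OF G x])
  define a b where "a = vnorm x" and "b = vnorm y"
  have ab0: "0 \<le> a" "0 \<le> b" unfolding a_def b_def by auto
  have e: "0 \<le> \<epsilon> * a\<^sup>2" using quad[OF x] unfolding a_def vnorm_power2 by linarith
  define x' y' where "x' = b \<cdot>\<^sub>v x" and "y' = a \<cdot>\<^sub>v y"
  have [simp]: "x' \<in> carrier_vec d" "y' \<in> carrier_vec d" unfolding x'_def y'_def by auto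
  have Gy: "G *\<^sub>v z \<in> carrier_vec d" if "z \<in> carrier_vec d" for z using that by (rule mult_mat_vec_carrier[OF G])
  have Gadd: "(x' + y') \<bullet> (G *\<^sub>v (x' + y')) = x' \<bullet> (G *\<^sub>v x') + 2 * (y' \<bullet> (G *\<^sub>v x')) + y' \<bullet> (G *\<^sub>v y')"
    "(x' - y') \<bullet> (G *\<^sub>v (x' - y')) = x' \<bullet> (G *\<^sub>v x') - 2 * (y' \<bullet> (G *\<^sub>v x')) + y' \<bullet> (G *\<^sub>v y')"
  proof -
    have "x' \<bullet> (G *\<^sub>v y') = y' \<bullet> (G *\<^sub>v x')"
      by (subst scalar_prod_mult_mat_vec[of _ d d]) (auto simp: sym Gy comm_scalar_prod[of _ d])
    then show "(x' + y') \<bullet> (G *\<^sub>v (x' + y')) = x' \<bullet> (G *\<^sub>v x') + 2 * (y' \<bullet> (G *\<^sub>v x')) + y' \<bullet> (G *\<^sub>v y')"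
      "(x' - y') \<bullet> (G *\<^sub>v (x' - y')) = x' \<bullet> (G *\<^sub>v x') - 2 * (y' \<bullet> (G *\<^sub>v x')) + y' \<bullet> (G *\<^sub>v y')"
      by (simp_all add: mult_add_distrib_mat_vec[of _ d d] mult_mat_vec_diff[of _ d d] Gy
          add_scalar_prod_distrib[of _ d] scalar_prod_add_distrib[of _ d]
          minus_scalar_prod_distrib[of _ d] scalar_prod_minus_distrib[of _ d])
  qed
  have "4 * (y' \<bullet> (G *\<^sub>v x')) = (x' + y') \<bullet> (G *\<^sub>v (x' + y')) - (x' - y') \<bullet> (G *\<^sub>v (x' - y'))"
    unfolding Gadd by simp
  also have "\<dots> \<le> \<epsilon> * ((x' + y') \<bullet> (x' + y')) + \<epsilon> * ((x' - y') \<bullet> (x' - y'))"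
    using quad[of "x' + y'"] quad[of "x' - y'"] by (simp add: abs_le_iff)
  also have "\<dots> = 2 * \<epsilon> * (x' \<bullet> x' + y' \<bullet> y')"
    by (simp add: add_scalar_prod_distrib[of _ d] scalar_prod_add_distrib[of _ d]
        minus_scalar_prod_distrib[of _ d] scalar_prod_minus_distrib[of _ d] comm_scalar_prod[of y' d x'] algebra_simps)
  also have "x' \<bullet> x' + y' \<bullet> y' = 2 * a\<^sup>2 * b\<^sup>2"
    unfolding x'_def y'_def by (simp add: a_def b_def vnorm_power2 power2_eq_square[of a] power2_eq_square[of b])
       (simp add: a_def b_def vnorm_power2[symmetric] power2_eq_square)
  also have "y' \<bullet> (G *\<^sub>v x') = a * b * b\<^sup>2"
    unfolding x'_def y'_def by (simp add: mult_mat_vec[of _ d d] Gy y_def[symmetric] b_def vnorm_power2)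
  finally have main: "a * b * b\<^sup>2 \<le> \<epsilon> * (a\<^sup>2 * b\<^sup>2)" by simp
  show ?thesis
  proof (cases "a = 0 \<or> b = 0")
    case True
    then show ?thesis
    proof
      assume "a = 0"
      then show ?thesis using vnorm_mult_mat_vec_le_frobenius[OF G x] unfolding a_def by simp
    next
      assume "b = 0"
      moreover have "0 \<le> \<epsilon> * a"
      proof (cases "a = 0")
        case False
        then have "0 < a\<^sup>2" by simp
        then have "0 \<le> \<epsilon>" using e by (simp add: zero_le_mult_iff)
        then show ?thesis using ab0 by simp
      qed simp
      ultimately show ?thesis unfolding b_def a_def y_def by simp
    qed
  next
    case False
    then have "0 < a * b\<^sup>2" using ab0 by simp
    moreover have "(a * b\<^sup>2) * b \<le> (a * b\<^sup>2) * (\<epsilon> * a)" using main by (simp add: power2_eq_square mult_ac)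
    ultimately have "b \<le> \<epsilon> * a" by (simp add: mult_le_cancel_left)
    then show ?thesis unfolding a_def b_def y_def .
  qed
qed

text \<open>Let \<open>B\<close> be the supremum of the form over the ball, finite by the Frobenius
  bound. For a net point \<open>w\<close> near \<open>y\<close>, symmetry gives <y, G y> - <w, G w>
  = <y - w, G (y + w)>, at most (1/4) B 2. Hence B <= tau + B / 2.\<close>

lemma quadratic_form_le_of_net:
  fixes G :: "real mat"
  assumes G[simp]: "G \<in> carrier_mat d d" and sym: "G\<^sup>T = G"
    and net: "\<And>x. x \<in> carrier_vec d \<Longrightarrow> vnorm x \<le> 1 \<Longrightarrow> \<exists>w\<in>W. w \<in> carrier_vec d \<and> vnorm w \<le> 1 \<and> vnorm (x - w) \<le> 1 / 4"
    and tau: "\<And>w. w \<in> W \<Longrightarrow> \<bar>w \<bullet> (G *\<^sub>v w)\<bar> \<le> \<tau>" and x: "x \<in> carrier_vec d"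
  shows "\<bar>x \<bullet> (G *\<^sub>v x)\<bar> \<le> 2 * \<tau> * (x \<bullet> x)"
proof -
  have Gc: "G *\<^sub>v z \<in> carrier_vec d" if "z \<in> carrier_vec d" for z using that by (rule mult_mat_vec_carrier[OF G])
  let ?X = "{x \<in> carrier_vec d. vnorm x \<le> 1}"
  define B where "B = (SUP x\<in>?X. \<bar>x \<bullet> (G *\<^sub>v x)\<bar>)"
  define F where "F = sqrt (\<Sum>i<d. \<Sum>j<d. (G $$ (i, j))\<^sup>2)"
  have F0: "0 \<le> F" unfolding F_def by (intro real_sqrt_ge_zero sum_nonneg) auto
  have bdd: "bdd_above ((\<lambda>x. \<bar>x \<bullet> (G *\<^sub>v x)\<bar>) ` ?X)"
  proof (rule bdd_aboveI2)
    fix y assume y: "y \<in> ?X"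
    then have yc: "y \<in> carrier_vec d" by simp
    have "\<bar>y \<bullet> (G *\<^sub>v y)\<bar> \<le> vnorm y * vnorm (G *\<^sub>v y)" using yc carrier_vecD[OF Gc[OF yc]] by (intro abs_scalar_prod_le) simp
    also have "\<dots> \<le> 1 * (F * 1)"
    proof (intro mult_mono)
      have "vnorm (G *\<^sub>v y) \<le> F * vnorm y" unfolding F_def by (rule vnorm_mult_mat_vec_le_frobenius[OF G yc])
      also have "\<dots> \<le> F * 1" using y F0 by (intro mult_left_mono) auto
      finally show "vnorm (G *\<^sub>v y) \<le> F * 1" .
    qed (use y in auto)
    finally show "\<bar>y \<bullet> (G *\<^sub>v y)\<bar> \<le> 1 * (F * 1)" .
  qed
  have le: "\<bar>y \<bullet> (G *\<^sub>v y)\<bar> \<le> B" if "y \<in> carrier_vec d" "vnorm y \<le> 1" for y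
    unfolding B_def using bdd that by (intro cSUP_upper) auto
  have scale: "\<bar>y \<bullet> (G *\<^sub>v y)\<bar> \<le> C * (y \<bullet> y)"
    if C: "\<And>y. y \<in> carrier_vec d \<Longrightarrow> vnorm y \<le> 1 \<Longrightarrow> \<bar>y \<bullet> (G *\<^sub>v y)\<bar> \<le> C" and y: "y \<in> carrier_vec d" for C y
  proof (cases "vnorm y = 0")
    case True
    then have "y = 0\<^sub>v d" using y by (simp add: vnorm_eq_0_iff[of _ d])
    then show ?thesis using Gc[OF y] by simp
  next
    case False
    define z where "z = (1 / vnorm y) \<cdot>\<^sub>v y"
    have z: "z \<in> carrier_vec d" "vnorm z \<le> 1" unfolding z_def using y False by auto
    have "z \<bullet> (G *\<^sub>v z) = (y \<bullet> (G *\<^sub>v y)) / (y \<bullet> y)"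
      unfolding z_def using y Gc[OF y] by (simp add: mult_mat_vec[OF G] vnorm_power2[symmetric] power2_eq_square)
    moreover have pos: "0 < y \<bullet> y" using False by (simp add: vnorm_power2[symmetric])
    ultimately have "\<bar>y \<bullet> (G *\<^sub>v y)\<bar> = \<bar>z \<bullet> (G *\<^sub>v z)\<bar> * (y \<bullet> y)" by (simp add: abs_divide)
    then show ?thesis using C[OF z] pos by (simp add: mult_right_mono)
  qed
  have quadB: "\<bar>y \<bullet> (G *\<^sub>v y)\<bar> \<le> B * (y \<bullet> y)" if "y \<in> carrier_vec d" for y
    using le that by (rule scale)
  have B0: "0 \<le> B" using order_trans[OF abs_ge_zero le[of "0\<^sub>v d"]] by simp
  have "\<bar>y \<bullet> (G *\<^sub>v y)\<bar> \<le> \<tau> + B / 2" if y: "y \<in> carrier_vec d" "vnorm y \<le> 1" for y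
  proof -
    obtain w where w: "w \<in> W" "w \<in> carrier_vec d" "vnorm w \<le> 1" "vnorm (y - w) \<le> 1 / 4" using net[OF y] by auto
    have "(y - w) \<bullet> (G *\<^sub>v (y + w)) = y \<bullet> (G *\<^sub>v y) - w \<bullet> (G *\<^sub>v w) + (y \<bullet> (G *\<^sub>v w) - w \<bullet> (G *\<^sub>v y))"
      using y w by (simp add: mult_add_distrib_mat_vec[of _ d d] Gc
          scalar_prod_add_distrib[of _ d] minus_scalar_prod_distrib[of _ d])
    moreover have "y \<bullet> (G *\<^sub>v w) = w \<bullet> (G *\<^sub>v y)"
      using y w by (subst scalar_prod_mult_mat_vec[of _ d d]) (auto simp: sym Gc comm_scalar_prod[of _ d])
    ultimately have "\<bar>y \<bullet> (G *\<^sub>v y)\<bar> \<le> \<bar>w \<bullet> (G *\<^sub>v w)\<bar> + \<bar>(y - w) \<bullet> (G *\<^sub>v (y + w))\<bar>" by linarith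
    also have "\<bar>(y - w) \<bullet> (G *\<^sub>v (y + w))\<bar> \<le> vnorm (y - w) * vnorm (G *\<^sub>v (y + w))"
      using y w carrier_vecD[OF Gc[of "y + w"]] by (intro abs_scalar_prod_le) (auto simp: carrier_vecD[OF w(2)])
    also have "\<dots> \<le> (1 / 4) * (B * 2)"
    proof (intro mult_mono)
      have "vnorm (G *\<^sub>v (y + w)) \<le> B * vnorm (y + w)"
        using quadB y w by (intro vnorm_le_of_quadratic_form[OF G sym]) auto
      also have "\<dots> \<le> B * 2" using B0 vnorm_add_le[of y d w] y w by (intro mult_left_mono) auto
      finally show "vnorm (G *\<^sub>v (y + w)) \<le> B * 2" .
    qed (use w in auto)
    finally show ?thesis using tau[OF w(1)] by simp
  qed
  then have "B \<le> \<tau> + B / 2" unfolding B_def by (intro cSUP_least) (auto intro: exI[of _ "0\<^sub>v d"])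
  then have "B \<le> 2 * \<tau>" by simp
  then have "\<bar>y \<bullet> (G *\<^sub>v y)\<bar> \<le> 2 * \<tau>" if "y \<in> carrier_vec d" "vnorm y \<le> 1" for y using le[OF that] by simp
  then show ?thesis using x by (rule scale)
qed

section \<open>Coordinates in an eigenbasis and spectral gaps\<close>

context
  fixes d :: nat and S P :: "real mat" and \<mu> :: "nat \<Rightarrow> real"
  assumes P[simp]: "P \<in> carrier_mat d d" and PP: "P\<^sup>T * P = 1\<^sub>m d"
    and S: "S = P * mat_diag d \<mu> * P\<^sup>T"
begin

lemma spectral_carrier: "S \<in> carrier_mat d d"
  unfolding S by (auto intro!: mult_carrier_mat[of _ _ d])

lemma spectral_coords_carrier: "x \<in> carrier_vec d \<Longrightarrow> P\<^sup>T *\<^sub>v x \<in> carrier_vec d"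
  by (rule mult_mat_vec_carrier[of _ d d]) auto

lemma spectral_coords_mult:
  assumes x: "x \<in> carrier_vec d" and i: "i < d"
  shows "(P\<^sup>T *\<^sub>v (S *\<^sub>v x)) $ i = \<mu> i * (P\<^sup>T *\<^sub>v x) $ i"
proof -
  have "P\<^sup>T * S = (P\<^sup>T * P) * mat_diag d \<mu> * P\<^sup>T"
    unfolding S by (simp add: assoc_mult_mat[of _ d d _ d _ d] mult_carrier_mat[of _ _ d])
  also have "\<dots> = mat_diag d \<mu> * P\<^sup>T" unfolding PP by (simp add: left_mult_one_mat[of _ d d])
  finally have "P\<^sup>T *\<^sub>v (S *\<^sub>v x) = mat_diag d \<mu> *\<^sub>v (P\<^sup>T *\<^sub>v x)"
    using x spectral_carrier by (simp add: assoc_mult_mat_vec[of _ d d _ d, symmetric])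
  then have "(P\<^sup>T *\<^sub>v (S *\<^sub>v x)) $ i = (\<Sum>j = 0..<d. (if i = j then \<mu> j else 0) * (P\<^sup>T *\<^sub>v x) $ j)"
    using i carrier_vecD[OF spectral_coords_carrier[OF x]]
    by (simp add: mat_diag_def scalar_prod_def)
  also have "\<dots> = (\<Sum>j = 0..<d. if i = j then \<mu> j * (P\<^sup>T *\<^sub>v x) $ j else 0)"
    by (intro sum.cong) auto
  also have "\<dots> = \<mu> i * (P\<^sup>T *\<^sub>v x) $ i" using i by simp
  finally show ?thesis .
qed

lemma spectral_coords_scalar_prod:
  assumes x: "x \<in> carrier_vec d" and y: "y \<in> carrier_vec d"
  shows "(P\<^sup>T *\<^sub>v x) \<bullet> (P\<^sup>T *\<^sub>v y) = x \<bullet> y"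
proof -
  have "P * P\<^sup>T = 1\<^sub>m d" using mat_mult_left_right_inverse[of "P\<^sup>T" d P] PP by simp
  then have "P *\<^sub>v (P\<^sup>T *\<^sub>v y) = y" using y by (simp add: assoc_mult_mat_vec[of _ d d _ d, symmetric])
  moreover have "x \<bullet> (P *\<^sub>v (P\<^sup>T *\<^sub>v y)) = (P\<^sup>T *\<^sub>v x) \<bullet> (P\<^sup>T *\<^sub>v y)"
    by (rule scalar_prod_mult_mat_vec[OF P x spectral_coords_carrier[OF y]])
  ultimately show ?thesis by simp
qed

lemma spectral_quadratic_form:
  assumes x: "x \<in> carrier_vec d"
  shows "x \<bullet> (S *\<^sub>v x) = (\<Sum>i<d. \<mu> i * ((P\<^sup>T *\<^sub>v x) $ i)\<^sup>2)"
proof -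
  have Sx: "S *\<^sub>v x \<in> carrier_vec d" using x by (rule mult_mat_vec_carrier[OF spectral_carrier])
  have "x \<bullet> (S *\<^sub>v x) = (P\<^sup>T *\<^sub>v x) \<bullet> (P\<^sup>T *\<^sub>v (S *\<^sub>v x))"
    by (rule spectral_coords_scalar_prod[OF x Sx, symmetric])
  also have "\<dots> = (\<Sum>i<d. (P\<^sup>T *\<^sub>v x) $ i * (P\<^sup>T *\<^sub>v (S *\<^sub>v x)) $ i)"
    using carrier_vecD[OF spectral_coords_carrier[OF Sx]] by (simp add: scalar_prod_def lessThan_atLeast0)
  also have "\<dots> = (\<Sum>i<d. \<mu> i * ((P\<^sup>T *\<^sub>v x) $ i)\<^sup>2)"
    by (intro sum.cong refl) (use spectral_coords_mult[OF x] in \<open>simp add: power2_eq_square\<close>)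
  finally show ?thesis .
qed

lemma spectral_norm:
  assumes x: "x \<in> carrier_vec d" shows "(\<Sum>i<d. ((P\<^sup>T *\<^sub>v x) $ i)\<^sup>2) = x \<bullet> x"
  using sum_power2_eq_scalar_prod[OF spectral_coords_carrier[OF x]] spectral_coords_scalar_prod[OF x x] by simp

text \<open>In eigencoordinates \<open>u\<close> lives on coordinate \<open>k\<close> alone, because
  all other eigenvalues differ from \<open>\<mu> k\<close>. A vector orthogonal to \<open>u\<close>
  thus has no k-th coordinate, and S - mu_k stretches each of the others by at least
  \<open>g\<close>.\<close>

lemma spectral_gap:
  assumes u: "u \<in> carrier_vec d" "vnorm u = 1" "S *\<^sub>v u = \<mu> k \<cdot>\<^sub>v u" and k: "k < d"
    and g: "0 < g" "\<And>i. i < d \<Longrightarrow> i \<noteq> k \<Longrightarrow> g \<le> \<bar>\<mu> i - \<mu> k\<bar>"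
    and p: "p \<in> carrier_vec d" "p \<bullet> u = 0"
  shows "g * vnorm p \<le> vnorm (S *\<^sub>v p - \<mu> k \<cdot>\<^sub>v p)"
proof -
  let ?a = "P\<^sup>T *\<^sub>v u" and ?c = "P\<^sup>T *\<^sub>v p"
  have ac: "?a \<in> carrier_vec d" "?c \<in> carrier_vec d" using u p by (auto intro: spectral_coords_carrier)
  have Sp: "S *\<^sub>v p \<in> carrier_vec d" using p(1) by (rule mult_mat_vec_carrier[OF spectral_carrier])
  have a0: "?a $ i = 0" if "i < d" "i \<noteq> k" for i
  proof -
    have "\<mu> i * ?a $ i = (P\<^sup>T *\<^sub>v (\<mu> k \<cdot>\<^sub>v u)) $ i"
      using spectral_coords_mult[OF u(1) that(1)] u(3) by simp
    also have "\<dots> = \<mu> k * ?a $ i" using u(1) that by (simp add: mult_mat_vec[of _ d d] carrier_matD[OF P])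
    finally have "(\<mu> i - \<mu> k) * ?a $ i = 0" by (simp add: algebra_simps)
    then show ?thesis using g(2)[OF that] g(1) by auto
  qed
  have single: "(\<Sum>i<d. ?c $ i * ?a $ i) = ?c $ k * ?a $ k" "(\<Sum>i<d. (?a $ i)\<^sup>2) = (?a $ k)\<^sup>2"
  proof -
    have "(\<Sum>i<d. ?c $ i * ?a $ i) = (\<Sum>i<d. if i = k then ?c $ k * ?a $ k else 0)"
      by (intro sum.cong) (auto simp: a0)
    then show "(\<Sum>i<d. ?c $ i * ?a $ i) = ?c $ k * ?a $ k" using k by simp
    have "(\<Sum>i<d. (?a $ i)\<^sup>2) = (\<Sum>i<d. if i = k then (?a $ k)\<^sup>2 else 0)"
      by (intro sum.cong) (auto simp: a0)
    then show "(\<Sum>i<d. (?a $ i)\<^sup>2) = (?a $ k)\<^sup>2" using k by simp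
  qed
  have "(?a $ k)\<^sup>2 = 1" using single spectral_norm[OF u(1)] u(2) by (simp add: vnorm_eq_1_iff)
  moreover have "?c $ k * ?a $ k = 0"
    using single spectral_coords_scalar_prod[OF p(1) u(1)] p(2) carrier_vecD[OF ac(1)]
    by (simp add: scalar_prod_def lessThan_atLeast0)
  ultimately have ck: "?c $ k = 0" by auto
  have dc: "S *\<^sub>v p - \<mu> k \<cdot>\<^sub>v p \<in> carrier_vec d" using Sp p by auto
  have coord: "(P\<^sup>T *\<^sub>v (S *\<^sub>v p - \<mu> k \<cdot>\<^sub>v p)) $ i = (\<mu> i - \<mu> k) * ?c $ i" if "i < d" for i
    using that p(1) Sp spectral_coords_mult[OF p(1) that]
    by (simp add: mult_mat_vec_diff[of _ d d] mult_mat_vec[of _ d d] carrier_matD[OF P] left_diff_distrib)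
  have "g\<^sup>2 * (vnorm p)\<^sup>2 = (\<Sum>i<d. g\<^sup>2 * (?c $ i)\<^sup>2)"
    unfolding vnorm_power2 spectral_norm[OF p(1), symmetric] by (simp add: sum_distrib_left)
  also have "\<dots> \<le> (\<Sum>i<d. ((\<mu> i - \<mu> k) * ?c $ i)\<^sup>2)"
  proof (rule sum_mono)
    fix i assume i: "i \<in> {..<d}"
    show "g\<^sup>2 * (?c $ i)\<^sup>2 \<le> ((\<mu> i - \<mu> k) * ?c $ i)\<^sup>2"
    proof (cases "i = k")
      case False
      then have "g\<^sup>2 \<le> \<bar>\<mu> i - \<mu> k\<bar>\<^sup>2" using i g by (intro power_mono) auto
      then show ?thesis by (simp add: power_mult_distrib mult_right_mono)
    qed (simp add: ck)
  qed
  also have "\<dots> = (vnorm (S *\<^sub>v p - \<mu> k \<cdot>\<^sub>v p))\<^sup>2"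
    unfolding vnorm_power2 spectral_norm[OF dc, symmetric] by (intro sum.cong) (auto simp: coord)
  finally have "(g * vnorm p)\<^sup>2 \<le> (vnorm (S *\<^sub>v p - \<mu> k \<cdot>\<^sub>v p))\<^sup>2" by (simp add: power_mult_distrib)
  then show ?thesis by (rule power2_le_imp_le) simp
qed

end

section \<open>Weyl's inequality\<close>

text \<open>The conditions form a \<open>d \<times> d\<close> linear system whose row \<open>k\<close> is zero.\<close>

lemma exists_vec_in_both_spans:
  fixes P Q :: "real mat"
  assumes P[simp]: "P \<in> carrier_mat d d" and Q[simp]: "Q \<in> carrier_mat d d" and k: "k < d"
  obtains x where "x \<in> carrier_vec d" "x \<noteq> 0\<^sub>v d"
    "\<And>i. k < i \<Longrightarrow> i < d \<Longrightarrow> (P\<^sup>T *\<^sub>v x) $ i = 0" "\<And>i. i < k \<Longrightarrow> (Q\<^sup>T *\<^sub>v x) $ i = 0"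
proof -
  define B where "B = mat d d (\<lambda>(i, j). if i < k then Q $$ (j, i) else if i = k then 0 else P $$ (j, i))"
  have B: "B \<in> carrier_mat d d" unfolding B_def by simp
  have "B\<^sup>T *\<^sub>v unit_vec d k = 0\<^sub>v d"
    using k by (intro eq_vecI) (auto simp: B_def scalar_prod_right_unit)
  then have "Determinant.det (B\<^sup>T) = 0"
  proof -
    have "unit_vec d k \<noteq> (0\<^sub>v d :: real vec)"
    proof
      assume "unit_vec d k = (0\<^sub>v d :: real vec)"
      then have "unit_vec d k $ k = (0\<^sub>v d :: real vec) $ k" by simp
      then show False using k by simp
    qed
    moreover have BT: "B\<^sup>T \<in> carrier_mat d d" using B by simp
    ultimately show ?thesis
      unfolding det_0_iff_vec_prod_zero[OF BT] using \<open>B\<^sup>T *\<^sub>v unit_vec d k = 0\<^sub>v d\<close>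
      by (intro exI[of _ "unit_vec d k"] conjI unit_vec_carrier)
  qed
  then have "Determinant.det B = 0" using det_transpose[OF B] by simp
  then obtain x where x: "x \<in> carrier_vec d" "x \<noteq> 0\<^sub>v d" "B *\<^sub>v x = 0\<^sub>v d"
    using det_0_iff_vec_prod_zero[OF B] by blast
  have row: "row B i \<bullet> x = 0" if "i < d" for i
    using arg_cong[OF x(3), of "\<lambda>v. v $ i"] that B by simp
  show thesis
  proof (rule that[OF x(1,2)])
    show "(P\<^sup>T *\<^sub>v x) $ i = 0" if "k < i" "i < d" for i
    proof -
      have "row B i = row P\<^sup>T i" using that carrier_matD[OF P] by (intro eq_vecI) (auto simp: B_def)
      then show ?thesis using row[OF that(2)] that carrier_matD[OF P] by simp
    qed
    show "(Q\<^sup>T *\<^sub>v x) $ i = 0" if "i < k" for i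
    proof -
      have "row B i = row Q\<^sup>T i" using that k carrier_matD[OF Q] by (intro eq_vecI) (auto simp: B_def)
      then show ?thesis using row[of i] that k carrier_matD[OF Q] by simp
    qed
  qed
qed

text \<open>Compare the two forms at a vector spanned by the eigenvectors 0..k of \<open>S\<close>
  and also by the eigenvectors from k on of \<open>T\<close>. A one-sided comparison with an
  arbitrary constant \<open>c\<close> can absorb a multiple of the identity and be used in both
  directions.\<close>

lemma weyl:
  fixes S T :: "real mat"
  assumes P: "P \<in> carrier_mat d d" "P\<^sup>T * P = 1\<^sub>m d" "S = P * mat_diag d \<mu> * P\<^sup>T"
    and Q: "Q \<in> carrier_mat d d" "Q\<^sup>T * Q = 1\<^sub>m d" "T = Q * mat_diag d \<nu> * Q\<^sup>T"
    and mono: "\<And>i j. i \<le> j \<Longrightarrow> \<mu> j \<le> \<mu> i" "\<And>i j. i \<le> j \<Longrightarrow> \<nu> j \<le> \<nu> i"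
    and k: "k < d" and le: "\<And>x. x \<in> carrier_vec d \<Longrightarrow> x \<bullet> (S *\<^sub>v x) \<le> x \<bullet> (T *\<^sub>v x) + c * (x \<bullet> x)"
  shows "\<mu> k \<le> \<nu> k + c"
proof -
  obtain x where x: "x \<in> carrier_vec d" "x \<noteq> 0\<^sub>v d"
    and xP: "\<And>i. k < i \<Longrightarrow> i < d \<Longrightarrow> (P\<^sup>T *\<^sub>v x) $ i = 0" and xQ: "\<And>i. i < k \<Longrightarrow> (Q\<^sup>T *\<^sub>v x) $ i = 0"
    using exists_vec_in_both_spans[OF P(1) Q(1) k] by metis
  have pos: "0 < x \<bullet> x"
    using x scalar_prod_self_eq_0_iff[OF x(1)] scalar_prod_self_nonneg[of x] by linarith
  have "\<mu> k * (x \<bullet> x) = (\<Sum>i<d. \<mu> k * ((P\<^sup>T *\<^sub>v x) $ i)\<^sup>2)"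
    unfolding spectral_norm[OF P x(1), symmetric] by (simp add: sum_distrib_left)
  also have "\<dots> \<le> x \<bullet> (S *\<^sub>v x)"
    unfolding spectral_quadratic_form[OF P x(1)]
  proof (rule sum_mono)
    fix i assume "i \<in> {..<d}"
    then show "\<mu> k * ((P\<^sup>T *\<^sub>v x) $ i)\<^sup>2 \<le> \<mu> i * ((P\<^sup>T *\<^sub>v x) $ i)\<^sup>2"
      using xP[of i] mono(1)[of i k] by (cases "k < i") (auto intro: mult_right_mono)
  qed
  also have "\<dots> \<le> x \<bullet> (T *\<^sub>v x) + c * (x \<bullet> x)" by (rule le[OF x(1)])
  also have "x \<bullet> (T *\<^sub>v x) \<le> (\<Sum>i<d. \<nu> k * ((Q\<^sup>T *\<^sub>v x) $ i)\<^sup>2)"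
    unfolding spectral_quadratic_form[OF Q x(1)]
  proof (rule sum_mono)
    fix i assume "i \<in> {..<d}"
    then show "\<nu> i * ((Q\<^sup>T *\<^sub>v x) $ i)\<^sup>2 \<le> \<nu> k * ((Q\<^sup>T *\<^sub>v x) $ i)\<^sup>2"
      using xQ[of i] mono(2)[of k i] by (cases "i < k") (auto intro: mult_right_mono)
  qed
  also have "\<dots> = \<nu> k * (x \<bullet> x)"
    unfolding spectral_norm[OF Q x(1), symmetric] by (simp add: sum_distrib_left)
  finally have "\<mu> k * (x \<bullet> x) \<le> (\<nu> k + c) * (x \<bullet> x)" by (simp add: algebra_simps)
  then show ?thesis using pos by (simp add: mult_le_cancel_right)
qed

section \<open>Perturbation of eigenvectors\<close>

text \<open>Pythagoras. For a unit vector \<open>w\<close> this is the squared sine of its angle to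
  \<open>u\<close>, the quantity that all estimates below control.\<close>

lemma vnorm_reject:
  assumes u: "u \<in> carrier_vec d" "vnorm u = 1" and w: "w \<in> carrier_vec d"
  shows "(vnorm (w - (w \<bullet> u) \<cdot>\<^sub>v u))\<^sup>2 = w \<bullet> w - (w \<bullet> u)\<^sup>2"
proof -
  have "u \<bullet> u = 1" using u by (simp add: vnorm_eq_1_iff)
  moreover have "(w \<bullet> u) \<cdot>\<^sub>v u \<in> carrier_vec d" using u by simp
  ultimately show ?thesis
    using vnorm_diff_power2[OF w] u(1) w by (simp add: scalar_prod_smult_distrib[of _ d] power2_eq_square)
qed

text \<open>Let p be the part of \<open>w\<close> orthogonal to \<open>u\<close> and q = (S - mu) p.
  Then q is orthogonal to \<open>u\<close> and equals (theta - mu) w - (T - S) w, so that |q|^2 <=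
  eta |q| |p| + |q| epsilon, while the gap gives gamma |p| <= |q|. The gap enters as a lower bound
  on the complement of \<open>u\<close>, so the lemma can be reused around a perturbed
  matrix.\<close>

lemma davis_kahan:
  fixes S :: "real mat"
  assumes S[simp]: "S \<in> carrier_mat d d" and sym: "S\<^sup>T = S"
    and u[simp]: "u \<in> carrier_vec d" and nu: "vnorm u = 1" and Su: "S *\<^sub>v u = \<mu> \<cdot>\<^sub>v u"
    and gap: "\<And>p. p \<in> carrier_vec d \<Longrightarrow> p \<bullet> u = 0 \<Longrightarrow> \<gamma> * vnorm p \<le> vnorm (S *\<^sub>v p - \<mu> \<cdot>\<^sub>v p)"
    and w[simp]: "w \<in> carrier_vec d" and nw: "vnorm w = 1" and Tw: "T *\<^sub>v w = \<theta> \<cdot>\<^sub>v w"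
    and near: "vnorm (T *\<^sub>v w - S *\<^sub>v w) \<le> \<epsilon>" and \<eta>: "\<bar>\<theta> - \<mu>\<bar> \<le> \<eta>"
  shows "(\<gamma> - \<eta>) * vnorm (w - (w \<bullet> u) \<cdot>\<^sub>v u) \<le> \<epsilon>"
proof -
  define a where "a = w \<bullet> u"
  define p where "p = w - a \<cdot>\<^sub>v u"
  have p[simp]: "p \<in> carrier_vec d" unfolding p_def by simp
  have [simp]: "S *\<^sub>v w \<in> carrier_vec d" by (rule mult_mat_vec_carrier[OF S w])
  have uu: "u \<bullet> u = 1" using nu by (simp add: vnorm_eq_1_iff)
  have pu: "p \<bullet> u = 0" unfolding p_def by (simp add: minus_scalar_prod_distrib[of _ d] uu a_def)
  define q where "q = S *\<^sub>v p - \<mu> \<cdot>\<^sub>v p"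
  have Sp: "S *\<^sub>v p \<in> carrier_vec d" by (rule mult_mat_vec_carrier[OF S p])
  have q[simp]: "q \<in> carrier_vec d" unfolding q_def using Sp by simp
  define e where "e = T *\<^sub>v w - S *\<^sub>v w"
  have e[simp]: "e \<in> carrier_vec d" unfolding e_def Tw by simp
  have "(S *\<^sub>v p) \<bullet> u = \<mu> * (p \<bullet> u)"
    using scalar_prod_mult_mat_vec[OF S p u] by (simp add: Su sym scalar_prod_smult_distrib[of _ d])
  then have qu: "q \<bullet> u = 0" unfolding q_def using Sp by (simp add: minus_scalar_prod_distrib[of _ d] smult_scalar_prod_distrib[of _ d] pu)
  have "q = (\<theta> - \<mu>) \<cdot>\<^sub>v w - e"
    unfolding q_def p_def e_def Tw
    by (intro eq_vecI) (auto simp: mult_mat_vec_diff[of _ d d] mult_mat_vec[of _ d d] Su carrier_vecD[OF w] carrier_vecD[OF u] carrier_matD[OF S] algebra_simps)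
  then have "q \<bullet> q = (\<theta> - \<mu>) * (q \<bullet> w) - q \<bullet> e"
    by (metis e q scalar_prod_minus_distrib scalar_prod_smult_distrib smult_carrier_vec w)
  moreover have "q \<bullet> p = q \<bullet> w"
    unfolding p_def by (simp add: scalar_prod_minus_distrib[of _ d] scalar_prod_smult_distrib[of _ d] qu)
  ultimately have qq: "q \<bullet> q = (\<theta> - \<mu>) * (q \<bullet> p) - q \<bullet> e" by simp
  have "q \<bullet> q \<le> \<bar>\<theta> - \<mu>\<bar> * \<bar>q \<bullet> p\<bar> + \<bar>q \<bullet> e\<bar>"
  proof -
    have "(\<theta> - \<mu>) * (q \<bullet> p) \<le> \<bar>\<theta> - \<mu>\<bar> * \<bar>q \<bullet> p\<bar>" unfolding abs_mult[symmetric] by (rule abs_ge_self)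
    then show ?thesis unfolding qq by linarith
  qed
  also have "\<dots> \<le> \<eta> * (vnorm q * vnorm p) + vnorm q * \<epsilon>"
  proof (intro add_mono mult_mono)
    show "\<bar>q \<bullet> p\<bar> \<le> vnorm q * vnorm p" by (rule abs_scalar_prod_le) (simp add: carrier_vecD[OF q] carrier_vecD[OF p])
    have "\<bar>q \<bullet> e\<bar> \<le> vnorm q * vnorm e" by (rule abs_scalar_prod_le) (simp add: carrier_vecD[OF q] carrier_vecD[OF e])
    also have "\<dots> \<le> vnorm q * \<epsilon>" using near unfolding e_def by (intro mult_left_mono) auto
    finally show "\<bar>q \<bullet> e\<bar> \<le> vnorm q * \<epsilon>" .
  qed (use \<eta> in auto)
  finally have "vnorm q * vnorm q \<le> vnorm q * (\<eta> * vnorm p + \<epsilon>)"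
    by (simp add: vnorm_power2[symmetric] power2_eq_square algebra_simps)
  moreover have "0 \<le> \<eta> * vnorm p + \<epsilon>"
    using near \<eta> by (intro add_nonneg_nonneg mult_nonneg_nonneg) (auto intro: order_trans[OF vnorm_nonneg])
  ultimately have "vnorm q \<le> \<eta> * vnorm p + \<epsilon>"
    by (cases "vnorm q = 0") (auto simp: mult_le_cancel_left order_less_le)
  moreover have "\<gamma> * vnorm p \<le> vnorm q" unfolding q_def by (rule gap[OF p pu])
  ultimately show ?thesis unfolding p_def a_def by (simp add: algebra_simps)
qed

text \<open>Davis-Kahan with gap 9/10 gamma bounds the sine of the angle between \<open>w\<close>
  and \<open>u\<close> by 1/9. A vector q orthogonal to \<open>w\<close> therefore keeps at least
  9/10 of its length after removing its \<open>u\<close>-part, since 81/100 <= 80/81. Replacing S -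
  mu by T - theta costs gamma / 5, and 9/10 - 1/5 exceeds 1/2.\<close>

lemma gap_transfer:
  fixes S T :: "real mat"
  assumes S[simp]: "S \<in> carrier_mat d d" and sym: "S\<^sup>T = S"
    and u[simp]: "u \<in> carrier_vec d" and nu: "vnorm u = 1" and Su: "S *\<^sub>v u = \<mu> \<cdot>\<^sub>v u"
    and gap: "\<And>p. p \<in> carrier_vec d \<Longrightarrow> p \<bullet> u = 0 \<Longrightarrow> \<gamma> * vnorm p \<le> vnorm (S *\<^sub>v p - \<mu> \<cdot>\<^sub>v p)"
    and T[simp]: "T \<in> carrier_mat d d"
    and w[simp]: "w \<in> carrier_vec d" and nw: "vnorm w = 1" and Tw: "T *\<^sub>v w = \<theta> \<cdot>\<^sub>v w"
    and near: "\<And>x. x \<in> carrier_vec d \<Longrightarrow> vnorm (T *\<^sub>v x - S *\<^sub>v x) \<le> \<gamma> / 10 * vnorm x"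
    and \<theta>: "\<bar>\<theta> - \<mu>\<bar> \<le> \<gamma> / 10" and \<gamma>: "0 < \<gamma>"
  shows "1 - (w \<bullet> u)\<^sup>2 \<le> 1 / 81"
    and "\<And>q. q \<in> carrier_vec d \<Longrightarrow> q \<bullet> w = 0 \<Longrightarrow> \<gamma> / 2 * vnorm q \<le> vnorm (T *\<^sub>v q - \<theta> \<cdot>\<^sub>v q)"
proof -
  have "(\<gamma> - \<gamma> / 10) * vnorm (w - (w \<bullet> u) \<cdot>\<^sub>v u) \<le> \<gamma> / 10"
    using near[OF w] nw by (intro davis_kahan[OF S sym u nu Su gap w nw Tw _ \<theta>]) auto
  then have "9 * vnorm (w - (w \<bullet> u) \<cdot>\<^sub>v u) \<le> 1" using \<gamma> by (simp add: field_simps)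
  then have "(vnorm (w - (w \<bullet> u) \<cdot>\<^sub>v u))\<^sup>2 \<le> (1 / 9)\<^sup>2" by (intro power_mono) auto
  then show small: "1 - (w \<bullet> u)\<^sup>2 \<le> 1 / 81"
    using nw unfolding vnorm_reject[OF u nu w] by (simp add: vnorm_eq_1_iff power_divide)
  fix q assume q[simp]: "q \<in> carrier_vec d" and qw: "q \<bullet> w = 0"
  have [simp]: "S *\<^sub>v q \<in> carrier_vec d" "T *\<^sub>v q \<in> carrier_vec d" by (rule mult_mat_vec_carrier[of _ d d]; simp)+
  define r where "r = q - (q \<bullet> u) \<cdot>\<^sub>v u"
  have r[simp]: "r \<in> carrier_vec d" unfolding r_def by simp
  have uu: "u \<bullet> u = 1" using nu by (simp add: vnorm_eq_1_iff)
  have ru: "r \<bullet> u = 0" unfolding r_def by (simp add: minus_scalar_prod_distrib[of _ d] uu)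
  define s where "s = u - (u \<bullet> w) \<cdot>\<^sub>v w"
  have s[simp]: "s \<in> carrier_vec d" unfolding s_def by simp
  have "(vnorm s)\<^sup>2 = 1 - (w \<bullet> u)\<^sup>2"
    unfolding s_def vnorm_reject[OF w nw u] by (simp add: uu comm_scalar_prod[of u d w])
  then have s81: "(vnorm s)\<^sup>2 \<le> 1 / 81" using small by simp
  have "q \<bullet> s = q \<bullet> u" unfolding s_def by (simp add: scalar_prod_minus_distrib[of _ d] scalar_prod_smult_distrib[of _ d] qw)
  then have "\<bar>q \<bullet> u\<bar> \<le> vnorm q * vnorm s"
    using abs_scalar_prod_le[of q s] carrier_vecD[OF q] carrier_vecD[OF s] by simp
  then have "\<bar>q \<bullet> u\<bar>\<^sup>2 \<le> (vnorm q * vnorm s)\<^sup>2" by (rule power_mono) simp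
  also have "\<dots> \<le> (vnorm q)\<^sup>2 * (1 / 81)" unfolding power_mult_distrib using s81 by (intro mult_left_mono) auto
  finally have qu: "(q \<bullet> u)\<^sup>2 \<le> (vnorm q)\<^sup>2 * (1 / 81)" by simp
  have "(vnorm r)\<^sup>2 = (vnorm q)\<^sup>2 - (q \<bullet> u)\<^sup>2"
    unfolding r_def vnorm_reject[OF u nu q] by (simp add: vnorm_power2)
  moreover have "(9 / 10 * vnorm q)\<^sup>2 = 81 / 100 * (vnorm q)\<^sup>2" by (simp add: power_mult_distrib power_divide)
  ultimately have "(9 / 10 * vnorm q)\<^sup>2 \<le> (vnorm r)\<^sup>2" using qu zero_le_power2[of "vnorm q"] by linarith
  then have rq: "9 / 10 * vnorm q \<le> vnorm r" by (rule power2_le_imp_le) simp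
  have "S *\<^sub>v q - \<mu> \<cdot>\<^sub>v q = S *\<^sub>v r - \<mu> \<cdot>\<^sub>v r"
    unfolding r_def
    by (intro eq_vecI) (auto simp: mult_mat_vec_diff[of _ d d] mult_mat_vec[of _ d d] Su carrier_vecD[OF q] carrier_vecD[OF u] carrier_matD[OF S] algebra_simps)
  then have "\<gamma> * vnorm r \<le> vnorm (S *\<^sub>v q - \<mu> \<cdot>\<^sub>v q)" using gap[OF r ru] by simp
  also have "\<dots> = vnorm ((T *\<^sub>v q - \<theta> \<cdot>\<^sub>v q) + ((\<theta> - \<mu>) \<cdot>\<^sub>v q - (T *\<^sub>v q - S *\<^sub>v q)))"
    by (intro arg_cong[of _ _ vnorm] eq_vecI) (auto simp: carrier_vecD[OF q] carrier_matD[OF S] carrier_matD[OF T] algebra_simps)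
  also have "\<dots> \<le> vnorm (T *\<^sub>v q - \<theta> \<cdot>\<^sub>v q) + (vnorm ((\<theta> - \<mu>) \<cdot>\<^sub>v q) + vnorm (T *\<^sub>v q - S *\<^sub>v q))"
    by (intro order_trans[OF vnorm_add_le[of _ d]] add_left_mono vnorm_diff_le[of _ d]) auto
  also have "vnorm ((\<theta> - \<mu>) \<cdot>\<^sub>v q) \<le> \<gamma> / 10 * vnorm q" using mult_right_mono[OF \<theta>, of "vnorm q"] by simp
  also have "vnorm (T *\<^sub>v q - S *\<^sub>v q) \<le> \<gamma> / 10 * vnorm q" by (rule near) simp
  finally have "\<gamma> * vnorm r \<le> vnorm (T *\<^sub>v q - \<theta> \<cdot>\<^sub>v q) + (\<gamma> / 10 * vnorm q + \<gamma> / 10 * vnorm q)" by simp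
  moreover have "\<gamma> * (9 / 10 * vnorm q) \<le> \<gamma> * vnorm r" using rq \<gamma> by (intro mult_left_mono) auto
  moreover have "0 \<le> \<gamma> * vnorm q" using \<gamma> by simp
  ultimately show "\<gamma> / 2 * vnorm q \<le> vnorm (T *\<^sub>v q - \<theta> \<cdot>\<^sub>v q)" by simp
qed

text \<open>With c = <w, w'> the squared chord is 2 (1 - c) and the squared sine 1 - c^2, which
  dominates 1 - c for 0 <= c <= 1. The sign of c is where closeness to \<open>u\<close> and the sign
  convention enter: c >= 64/81 - 1/81.\<close>

lemma vnorm_diff_of_reject:
  assumes u[simp]: "u \<in> carrier_vec d" and nu: "vnorm u = 1"
    and w[simp]: "w \<in> carrier_vec d" "w' \<in> carrier_vec d" and nw: "vnorm w = 1" "vnorm w' = 1"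
    and small: "1 - (w \<bullet> u)\<^sup>2 \<le> 1 / 81" "1 - (w' \<bullet> u)\<^sup>2 \<le> 1 / 81" and pos: "0 < w \<bullet> u" "0 < w' \<bullet> u"
  shows "(vnorm (w - w'))\<^sup>2 \<le> 2 * (vnorm (w' - (w' \<bullet> w) \<cdot>\<^sub>v w))\<^sup>2"
proof -
  have uu: "u \<bullet> u = 1" "w \<bullet> w = 1" "w' \<bullet> w' = 1" using nu nw by (simp_all add: vnorm_eq_1_iff)
  define a b where "a = w \<bullet> u" and "b = w' \<bullet> u"
  define p p' where "p = w - a \<cdot>\<^sub>v u" and "p' = w' - b \<cdot>\<^sub>v u"
  have [simp]: "p \<in> carrier_vec d" "p' \<in> carrier_vec d" unfolding p_def p'_def by auto
  have "(vnorm p)\<^sup>2 \<le> (1 / 9)\<^sup>2" "(vnorm p')\<^sup>2 \<le> (1 / 9)\<^sup>2"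
    unfolding p_def p'_def a_def b_def using small by (simp_all add: vnorm_reject[of u d] nu uu power_divide)
  then have "vnorm p \<le> 1 / 9" "vnorm p' \<le> 1 / 9" by (auto intro: power2_le_imp_le)
  then have "vnorm p * vnorm p' \<le> 1 / 9 * (1 / 9)" by (intro mult_mono) auto
  then have pp: "- 1 / 81 \<le> p \<bullet> p'"
    using abs_scalar_prod_le[of p p'] carrier_vecD[of p d] carrier_vecD[of p' d] by (simp add: abs_le_iff)
  have ab: "8 / 9 \<le> a" "8 / 9 \<le> b"
  proof -
    have "(8 / 9)\<^sup>2 \<le> a\<^sup>2" "(8 / 9)\<^sup>2 \<le> b\<^sup>2"
      using small unfolding a_def b_def by (simp_all add: power_divide)
    moreover have "0 \<le> a" "0 \<le> b" using pos unfolding a_def b_def by auto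
    ultimately show "8 / 9 \<le> a" "8 / 9 \<le> b" by (blast intro: power2_le_imp_le)+
  qed
  have "p \<bullet> p' = w \<bullet> w' - a * b"
    unfolding p_def p'_def
    by (simp add: minus_scalar_prod_distrib[of _ d] scalar_prod_minus_distrib[of _ d] smult_scalar_prod_distrib[of _ d]
        scalar_prod_smult_distrib[of _ d] uu a_def b_def comm_scalar_prod[of u d])
  moreover have "8 / 9 * (8 / 9) \<le> a * b" using ab by (intro mult_mono) auto
  ultimately have c0: "0 \<le> w \<bullet> w'" using pp by simp
  have c1: "w \<bullet> w' \<le> 1" using scalar_prod_le_vnorm[of w d w'] nw by simp
  have "(w \<bullet> w')\<^sup>2 \<le> w \<bullet> w'" using c0 c1 by (simp add: power2_eq_square mult_left_le)
  moreover have "(vnorm (w - w'))\<^sup>2 = 2 - 2 * (w \<bullet> w')"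
    by (simp add: vnorm_diff_power2[of _ d] uu)
  moreover have "(vnorm (w' - (w' \<bullet> w) \<cdot>\<^sub>v w))\<^sup>2 = 1 - (w \<bullet> w')\<^sup>2"
    unfolding vnorm_reject[OF w(1) nw(1) w(2)] by (simp add: uu comm_scalar_prod[of w' d w])
  ultimately show ?thesis by simp
qed

text \<open>Davis-Kahan is applied directly between \<open>T\<close> and \<open>T'\<close>, so the
  bound is in terms of their difference; \<open>S\<close> only supplies a common frame. The
  transferred gap gamma / 2 minus the eigenvalue distance gamma / 5 leaves 3/10 gamma, and sqrt 2 *
  10/3 <= 5.\<close>

lemma eigenvector_lipschitz:
  fixes S T T' :: "real mat"
  assumes S[simp]: "S \<in> carrier_mat d d" and sym: "S\<^sup>T = S" and symT: "T\<^sup>T = T"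
    and u[simp]: "u \<in> carrier_vec d" and nu: "vnorm u = 1" and Su: "S *\<^sub>v u = \<mu> \<cdot>\<^sub>v u"
    and gap: "\<And>p. p \<in> carrier_vec d \<Longrightarrow> p \<bullet> u = 0 \<Longrightarrow> \<gamma> * vnorm p \<le> vnorm (S *\<^sub>v p - \<mu> \<cdot>\<^sub>v p)" and \<gamma>: "0 < \<gamma>"
    and T[simp]: "T \<in> carrier_mat d d"
    and w[simp]: "w \<in> carrier_vec d" and nw: "vnorm w = 1" and Tw: "T *\<^sub>v w = \<theta> \<cdot>\<^sub>v w"
    and near: "\<And>x. x \<in> carrier_vec d \<Longrightarrow> vnorm (T *\<^sub>v x - S *\<^sub>v x) \<le> \<gamma> / 10 * vnorm x"
    and \<theta>: "\<bar>\<theta> - \<mu>\<bar> \<le> \<gamma> / 10" and pos: "0 < w \<bullet> u"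
    and T'[simp]: "T' \<in> carrier_mat d d"
    and w'[simp]: "w' \<in> carrier_vec d" and nw': "vnorm w' = 1" and Tw': "T' *\<^sub>v w' = \<theta>' \<cdot>\<^sub>v w'"
    and near': "\<And>x. x \<in> carrier_vec d \<Longrightarrow> vnorm (T' *\<^sub>v x - S *\<^sub>v x) \<le> \<gamma> / 10 * vnorm x"
    and \<theta>': "\<bar>\<theta>' - \<mu>\<bar> \<le> \<gamma> / 10" and pos': "0 < w' \<bullet> u"
    and D: "vnorm (T' *\<^sub>v w' - T *\<^sub>v w') \<le> D"
  shows "vnorm (w - w') \<le> 5 / \<gamma> * D"
proof -
  note gt = gap_transfer[OF S sym u nu Su gap T w nw Tw near \<theta> \<gamma>]
  note gt' = gap_transfer[OF S sym u nu Su gap T' w' nw' Tw' near' \<theta>' \<gamma>]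
  have "(\<gamma> / 2 - \<gamma> / 5) * vnorm (w' - (w' \<bullet> w) \<cdot>\<^sub>v w) \<le> D"
  proof (rule davis_kahan[OF T symT w nw Tw gt(2) w' nw' Tw' D])
    show "\<bar>\<theta>' - \<theta>\<bar> \<le> \<gamma> / 5" using \<theta> \<theta>' by linarith
  qed
  then have pD: "vnorm (w' - (w' \<bullet> w) \<cdot>\<^sub>v w) \<le> 10 / 3 * (D / \<gamma>)" using \<gamma> by (simp add: field_simps)
  have "(vnorm (w - w'))\<^sup>2 \<le> 2 * (vnorm (w' - (w' \<bullet> w) \<cdot>\<^sub>v w))\<^sup>2"
    by (rule vnorm_diff_of_reject[OF u nu w w' nw nw' gt(1) gt'(1) pos pos'])
  also have "\<dots> \<le> 2 * (10 / 3 * (D / \<gamma>))\<^sup>2" using pD by (intro mult_left_mono power_mono) auto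
  also have "\<dots> \<le> (5 * (D / \<gamma>))\<^sup>2" unfolding power_mult_distrib mult.assoc[symmetric]
    by (intro mult_right_mono) (auto simp: power_divide)
  also have "5 * (D / \<gamma>) = 5 / \<gamma> * D" by simp
  finally have "(vnorm (w - w'))\<^sup>2 \<le> (5 / \<gamma> * D)\<^sup>2" .
  moreover have "0 \<le> D" using D order_trans[OF vnorm_nonneg] by blast
  then have "0 \<le> 5 / \<gamma> * D" using \<gamma> by simp
  ultimately show ?thesis by (rule power2_le_imp_le)
qed

section \<open>Nets of the unit ball\<close>

text \<open>Two geometric series, with zero counted once: 2 + 1.\<close>

lemma sum_half_power_abs_le: "(\<Sum>z\<in>{- int N..int N}. (1 / 2 :: real) ^ nat \<bar>z\<bar>) \<le> 3"
proof -
  let ?f = "\<lambda>z. (1 / 2 :: real) ^ nat \<bar>z\<bar>" and ?A = "int ` {..N}" and ?B = "(\<lambda>i. - int i) ` {1..N}"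
  have sub: "{- int N..int N} \<subseteq> ?A \<union> ?B"
  proof
    fix z assume z: "z \<in> {- int N..int N}"
    show "z \<in> ?A \<union> ?B"
    proof (cases "0 \<le> z")
      case True
      then show ?thesis using z by (intro UnI1 image_eqI[of _ _ "nat z"]) auto
    next
      case False
      then show ?thesis using z by (intro UnI2 image_eqI[of _ _ "nat (- z)"]) auto
    qed
  qed
  have "(\<Sum>i\<le>N. (1 / 2 :: real) ^ i) = 2 - (1 / 2) ^ N" by (induction N) auto
  then have geo: "(\<Sum>i\<le>N. (1 / 2 :: real) ^ i) \<le> 2" by simp
  have "sum ?f {- int N..int N} \<le> sum ?f (?A \<union> ?B)" by (intro sum_mono2 sub) auto
  also have "\<dots> = sum ?f ?A + sum ?f ?B" by (intro sum.union_disjoint) auto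
  also have "\<dots> = (\<Sum>i\<le>N. (1 / 2 :: real) ^ i) + (\<Sum>i\<in>{1..N}. (1 / 2 :: real) ^ i)"
    by (subst (1 2) sum.reindex) (auto simp: inj_on_def)
  also have "(\<Sum>i\<in>{1..N}. (1 / 2 :: real) ^ i) = (\<Sum>i\<le>N. (1 / 2 :: real) ^ i) - 1"
    by (induction N) auto
  finally show ?thesis using geo by simp
qed

text \<open>Counting by the weights \<open>2^{-|z|}\<close>, which multiply to at least \<open>2^{-m}\<close> on each point.\<close>

lemma card_lattice_l1_ball_le:
  "real (card {z \<in> {..<d} \<rightarrow>\<^sub>E {- int N..int N}. (\<Sum>i<d. nat \<bar>z i\<bar>) \<le> m}) \<le> 2 ^ m * 3 ^ d"
proof -
  let ?B = "{..<d} \<rightarrow>\<^sub>E {- int N..int N}"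
  let ?Z = "{z \<in> ?B. (\<Sum>i<d. nat \<bar>z i\<bar>) \<le> m}"
  have finB: "finite ?B" by (intro finite_PiE) auto
  have "real (card ?Z) * (1 / 2) ^ m = (\<Sum>z\<in>?Z. (1 / 2) ^ m)" by simp
  also have "\<dots> \<le> (\<Sum>z\<in>?Z. \<Prod>i<d. (1 / 2) ^ nat \<bar>z i\<bar>)"
  proof (rule sum_mono)
    fix z assume "z \<in> ?Z"
    then have "(\<Sum>i<d. nat \<bar>z i\<bar>) \<le> m" by blast
    then have "(1 / 2 :: real) ^ m \<le> (1 / 2) ^ (\<Sum>i<d. nat \<bar>z i\<bar>)"
      by (rule power_decreasing) simp_all
    also have "\<dots> = (\<Prod>i<d. (1 / 2) ^ nat \<bar>z i\<bar>)" by (rule power_sum)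
    finally show "(1 / 2 :: real) ^ m \<le> (\<Prod>i<d. (1 / 2) ^ nat \<bar>z i\<bar>)" .
  qed
  also have "\<dots> \<le> (\<Sum>z\<in>?B. \<Prod>i<d. (1 / 2) ^ nat \<bar>z i\<bar>)"
    by (rule sum_mono2[OF finB]) (blast, simp add: prod_nonneg)
  also have "\<dots> = (\<Prod>i<d. \<Sum>z\<in>{- int N..int N}. (1 / 2) ^ nat \<bar>z\<bar>)"
    by (rule prod_sum_PiE[symmetric]) auto
  also have "\<dots> \<le> (\<Prod>i<d. 3)" by (intro prod_mono conjI sum_nonneg sum_half_power_abs_le) auto
  finally show ?thesis by (simp add: field_simps)
qed

lemma unit_ball_net:
  assumes d: "0 < d"
  obtains W where "finite W" "real (card W) \<le> 48 ^ d" "\<And>w. w \<in> W \<Longrightarrow> w \<in> carrier_vec d \<and> vnorm w \<le> 1"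
    "\<And>x. x \<in> carrier_vec d \<Longrightarrow> vnorm x \<le> 1 \<Longrightarrow> \<exists>w\<in>W. vnorm (x - w) \<le> 1 / 4"
proof -
  \<comment> \<open>An error of at most 1 / s in each coordinate amounts to sqrt d / s = 1/4 in
    norm.\<close>
  define s where "s = 4 * sqrt (real d)"
  have s: "0 < s" unfolding s_def using d by simp
  \<comment> \<open>By Cauchy-Schwarz a rounded point has l1 norm at most s * sqrt d = 4 d, which
    keeps the count exponential in d: 2^(4 d) 3^d = 48^d. The box alone would give a power of d in
    the base; it serves for finiteness.\<close>
  let ?Z = "{z \<in> {..<d} \<rightarrow>\<^sub>E {- int (4 * d)..int (4 * d)}. (\<Sum>i<d. nat \<bar>z i\<bar>) \<le> 4 * d}"
  define f where "f z = vec d (\<lambda>i. real_of_int (z i) / s)" for z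
  define W where "W = {w \<in> f ` ?Z. vnorm w \<le> 1}"
  have finZ: "finite ?Z" by (rule finite_subset[of _ "{..<d} \<rightarrow>\<^sub>E {- int (4 * d)..int (4 * d)}"]) (auto intro!: finite_PiE)
  have sub: "W \<subseteq> f ` ?Z" unfolding W_def by auto
  have "card W \<le> card ?Z" using card_mono[OF finite_imageI[OF finZ] sub] card_image_le[OF finZ, of f] by simp
  then have "real (card W) \<le> 2 ^ (4 * d) * 3 ^ d" using card_lattice_l1_ball_le[of d "4 * d" "4 * d"] by linarith
  also have "(2 :: real) ^ (4 * d) * 3 ^ d = 48 ^ d" by (simp add: power_mult power_mult_distrib[symmetric])
  finally have cardW: "real (card W) \<le> 48 ^ d" .
  show thesis
  proof (rule that[OF _ cardW])
    show "finite W" by (rule finite_subset[OF sub finite_imageI[OF finZ]])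
    have "f z \<in> carrier_vec d" for z unfolding f_def by simp
    then show "w \<in> carrier_vec d \<and> vnorm w \<le> 1" if "w \<in> W" for w using that unfolding W_def by blast
    fix x :: "real vec" assume x: "x \<in> carrier_vec d" "vnorm x \<le> 1"
    \<comment> \<open>Rounding toward zero, not to the nearest integer: no coordinate grows in
      absolute value, so the net point stays in the ball and in the l1 bound.\<close>
    define r where "r i = (if 0 \<le> x $ i then \<lfloor>s * x $ i\<rfloor> else - \<lfloor>- (s * x $ i)\<rfloor>)" for i
    have r1: "\<bar>real_of_int (r i)\<bar> \<le> s * \<bar>x $ i\<bar>" for i
    proof (cases "0 \<le> x $ i")
      case True
      then have "0 \<le> s * x $ i" using s by simp
      then show ?thesis using True unfolding r_def by (simp add: of_int_floor_le)
    next
      case False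
      then have "0 \<le> - (s * x $ i)" using s by (simp add: mult_le_0_iff)
      then have "0 \<le> \<lfloor>- (s * x $ i)\<rfloor>" "real_of_int \<lfloor>- (s * x $ i)\<rfloor> \<le> - (s * x $ i)"
        by (auto simp: of_int_floor_le)
      then show ?thesis using False unfolding r_def by simp
    qed
    have r2: "\<bar>s * x $ i - real_of_int (r i)\<bar> \<le> 1" for i
    proof (cases "0 \<le> x $ i")
      case True
      then show ?thesis unfolding r_def if_P[OF True] using floor_correct[of "s * x $ i"] by linarith
    next
      case False
      then show ?thesis unfolding r_def if_not_P[OF False] using floor_correct[of "- (s * x $ i)"] by linarith
    qed
    define w where "w = f (restrict r {..<d})"
    have w: "w \<in> carrier_vec d" "\<And>i. i < d \<Longrightarrow> w $ i = real_of_int (r i) / s" unfolding w_def f_def by auto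
    have sumx: "(\<Sum>i<d. (x $ i)\<^sup>2) \<le> 1"
      using x(2) power_mono[of "vnorm x" 1 2] by (simp add: sum_power2_eq_scalar_prod[OF x(1)] vnorm_power2)
    have w1: "vnorm w \<le> 1"
    proof -
      have "\<bar>w $ i\<bar> \<le> \<bar>x $ i\<bar>" if "i < d" for i
        unfolding w(2)[OF that] using r1[of i] s by (simp add: abs_divide divide_le_eq mult.commute)
      then have "(\<Sum>i<d. (w $ i)\<^sup>2) \<le> (\<Sum>i<d. (x $ i)\<^sup>2)" by (intro sum_mono) (auto simp: abs_le_square_iff)
      then have "(vnorm w)\<^sup>2 \<le> 1\<^sup>2" using sumx by (simp add: sum_power2_eq_scalar_prod[OF w(1)] vnorm_power2)
      then show ?thesis by (rule power2_le_imp_le) simp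
    qed
    have xw: "vnorm (x - w) \<le> 1 / 4"
    proof -
      have "\<bar>(x - w) $ i\<bar> \<le> 1 / s" if "i < d" for i
      proof -
        have "(x - w) $ i = (s * x $ i - real_of_int (r i)) / s" using that x w s by (simp add: field_simps)
        then show ?thesis using r2[of i] s by (simp add: divide_right_mono)
      qed
      then have "((x - w) $ i)\<^sup>2 \<le> (1 / s)\<^sup>2" if "i < d" for i
        using that s by (subst abs_le_square_iff[symmetric]) auto
      then have "(\<Sum>i<d. ((x - w) $ i)\<^sup>2) \<le> (\<Sum>i<d. (1 / s)\<^sup>2)" by (intro sum_mono) auto
      also have "\<dots> = (1 / 4)\<^sup>2" unfolding s_def using d by (simp add: power_divide power_mult_distrib)
      finally have "(vnorm (x - w))\<^sup>2 \<le> (1 / 4)\<^sup>2"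
        unfolding vnorm_power2 sum_power2_eq_scalar_prod[OF minus_carrier_vec[OF x(1) w(1)]] .
      then show ?thesis by (rule power2_le_imp_le) simp
    qed
    have "real (\<Sum>i<d. nat \<bar>r i\<bar>) \<le> real (4 * d)"
    proof -
      have "real (\<Sum>i<d. nat \<bar>r i\<bar>) = (\<Sum>i<d. \<bar>real_of_int (r i)\<bar>)" by simp
      also have "\<dots> \<le> (\<Sum>i<d. s * \<bar>x $ i\<bar>)" by (intro sum_mono r1)
      also have "\<dots> = s * (\<Sum>i<d. \<bar>x $ i\<bar> * \<bar>1\<bar>)" by (simp add: sum_distrib_left)
      also have "\<dots> \<le> s * (L2_set (\<lambda>i. x $ i) {..<d} * L2_set (\<lambda>i. 1) {..<d})"
        using s by (intro mult_left_mono L2_set_mult_ineq) auto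
      also have "\<dots> \<le> s * (1 * sqrt (real d))"
      proof (intro mult_left_mono mult_mono)
        show "L2_set (\<lambda>i. x $ i) {..<d} \<le> 1" using x(2) by (simp add: vnorm_def carrier_vecD[OF x(1)])
        show "L2_set (\<lambda>i. 1) {..<d} \<le> sqrt (real d)" by (simp add: L2_set_def)
      qed (use s in \<open>auto simp: L2_set_nonneg\<close>)
      also have "\<dots> = real (4 * d)" unfolding s_def by simp
      finally show ?thesis .
    qed
    then have l1: "(\<Sum>i<d. nat \<bar>r i\<bar>) \<le> 4 * d" by (simp only: of_nat_le_iff)
    have "\<bar>r i\<bar> \<le> int (4 * d)" if "i < d" for i
    proof -
      have "nat \<bar>r i\<bar> \<le> (\<Sum>i<d. nat \<bar>r i\<bar>)" using that by (intro member_le_sum) auto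
      then show ?thesis using l1 by linarith
    qed
    then have "restrict r {..<d} \<in> ?Z" using l1 by (auto simp: abs_le_iff minus_le_iff)
    then have "w \<in> W" unfolding W_def w_def using w1[unfolded w_def] by blast
    then show "\<exists>w\<in>W. vnorm (x - w) \<le> 1 / 4" using xw by blast
  qed
qed

section \<open>Perturbation of left singular vectors\<close>

lemma gram_quadratic_form:
  fixes Y :: "real mat"
  assumes "Y \<in> carrier_mat d n" "x \<in> carrier_vec d"
  shows "x \<bullet> (Y * Y\<^sup>T *\<^sub>v x) = (Y\<^sup>T *\<^sub>v x) \<bullet> (Y\<^sup>T *\<^sub>v x)"
proof -
  have "Y * Y\<^sup>T *\<^sub>v x = Y *\<^sub>v (Y\<^sup>T *\<^sub>v x)" using assms by (intro assoc_mult_mat_vec[of _ d n _ d]) auto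
  then show ?thesis using assms scalar_prod_mult_mat_vec[of Y d n x "Y\<^sup>T *\<^sub>v x"] by simp
qed

lemma left_sing_vec_gram:
  assumes Y: "Y \<in> carrier_mat d n" and w: "is_left_sing_vec Y k w"
  shows "w \<in> carrier_vec d" "vnorm w = 1" "Y * Y\<^sup>T *\<^sub>v w = (sing_val Y k)\<^sup>2 \<cdot>\<^sub>v w"
proof -
  obtain v where v: "v \<in> carrier_vec n" "Y *\<^sub>v v = sing_val Y k \<cdot>\<^sub>v w" "Y\<^sup>T *\<^sub>v w = sing_val Y k \<cdot>\<^sub>v v"
    using w Y unfolding is_left_sing_vec_def by auto
  show wc: "w \<in> carrier_vec d" and "vnorm w = 1" using w Y unfolding is_left_sing_vec_def by auto
  have "Y * Y\<^sup>T *\<^sub>v w = Y *\<^sub>v (Y\<^sup>T *\<^sub>v w)" using Y wc by (intro assoc_mult_mat_vec[of _ d n _ d]) auto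
  also have "\<dots> = (sing_val Y k)\<^sup>2 \<cdot>\<^sub>v w"
    unfolding v(3) using v Y by (simp add: mult_mat_vec smult_smult_assoc power2_eq_square)
  finally show "Y * Y\<^sup>T *\<^sub>v w = (sing_val Y k)\<^sup>2 \<cdot>\<^sub>v w" .
qed

text \<open>Values beyond the number of rows are 0 and leave no positive gap, so \<open>k\<close> is
  a genuine index. By monotonicity the two neighbouring differences control the distance to all
  other singular values.\<close>

lemma eigengap_pos:
  assumes M: "M \<in> carrier_mat d n" and k: "1 \<le> k" and pos: "0 < eigengap (M * M\<^sup>T) k"
  shows "k \<le> d" "eigengap (M * M\<^sup>T) k \<le> (sing_val M k)\<^sup>2" "0 < sing_val M k"
    and "\<And>i. 1 \<le> i \<Longrightarrow> i \<noteq> k \<Longrightarrow> eigengap (M * M\<^sup>T) k \<le> \<bar>(sing_val M i)\<^sup>2 - (sing_val M k)\<^sup>2\<bar>"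
proof -
  let ?g = "eigengap (M * M\<^sup>T) k"
  obtain P where mono0: "\<And>i j. i \<le> j \<Longrightarrow> sing_val M (Suc j) \<le> sing_val M (Suc i)"
    and nn: "\<And>i. 0 \<le> sing_val M i" and sq: "\<And>i. sing_val (M * M\<^sup>T) i = (sing_val M i)\<^sup>2"
    and zero: "\<And>i. d < i \<Longrightarrow> sing_val M i = 0"
    using gram_spectral[OF M] by metis
  have mono: "sing_val M j \<le> sing_val M i" if "1 \<le> i" "i \<le> j" for i j
    using mono0[of "i - 1" "j - 1"] that by simp
  have mono2: "(sing_val M j)\<^sup>2 \<le> (sing_val M i)\<^sup>2" if "1 \<le> i" "i \<le> j" for i j
    using mono[OF that] nn by (intro power_mono) auto
  have up: "?g \<le> (sing_val M k)\<^sup>2 - (sing_val M (k + 1))\<^sup>2"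
    unfolding eigengap_def sq by (auto simp: numeral_2_eq_2)
  have down: "?g \<le> (sing_val M (k - 1))\<^sup>2 - (sing_val M k)\<^sup>2" if "k \<noteq> 1"
    unfolding eigengap_def sq using that by auto
  show "k \<le> d"
  proof (rule ccontr)
    assume "\<not> k \<le> d"
    then have "sing_val M k = 0" by (intro zero) simp
    then have "?g \<le> - (sing_val M (k + 1))\<^sup>2" using up by simp
    then show False using pos zero_le_power2[of "sing_val M (k + 1)"] by linarith
  qed
  show gl: "?g \<le> (sing_val M k)\<^sup>2" using up zero_le_power2[of "sing_val M (k + 1)"] by linarith
  then have "sing_val M k \<noteq> 0" using pos by auto
  then show "0 < sing_val M k" using nn[of k] by linarith
  fix i assume i: "1 \<le> i" "i \<noteq> k"
  show "?g \<le> \<bar>(sing_val M i)\<^sup>2 - (sing_val M k)\<^sup>2\<bar>"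
  proof (cases "i < k")
    case True
    then have "(sing_val M (k - 1))\<^sup>2 \<le> (sing_val M i)\<^sup>2" using i by (intro mono2) auto
    then show ?thesis using down True i by linarith
  next
    case False
    then have "(sing_val M i)\<^sup>2 \<le> (sing_val M (k + 1))\<^sup>2" using i by (intro mono2) auto
    then show ?thesis using up by linarith
  qed
qed

section \<open>Stability of singular values and vectors under closeness of Gram matrices\<close>

text \<open>Closeness of \<open>Y * Y\<^sup>T\<close> to \<open>M * M\<^sup>T\<close> plus
  \<open>c\<close> times the identity in operator norm, written as a bound on quadratic forms.
  Weyl's inequality consumes it and the net produces it in this form.\<close>

definition close_gram :: "real mat \<Rightarrow> real \<Rightarrow> real \<Rightarrow> real mat \<Rightarrow> bool" where
  "close_gram M c \<epsilon> Y \<longleftrightarrow> Y \<in> carrier_mat (dim_row M) (dim_col M) \<and>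
    (\<forall>x\<in>carrier_vec (dim_row M).
      \<bar>(Y\<^sup>T *\<^sub>v x) \<bullet> (Y\<^sup>T *\<^sub>v x) - (M\<^sup>T *\<^sub>v x) \<bullet> (M\<^sup>T *\<^sub>v x) - c * (x \<bullet> x)\<bar> \<le> \<epsilon> * (x \<bullet> x))"

lemma sing_val_perturbation:
  assumes M: "M \<in> carrier_mat d n" and Y: "Y \<in> carrier_mat d n" and k: "1 \<le> k" "k \<le> d"
    and close: "close_gram M c \<epsilon> Y"
  shows "\<bar>(sing_val Y k)\<^sup>2 - ((sing_val M k)\<^sup>2 + c)\<bar> \<le> \<epsilon>"
proof -
  obtain P where P: "P \<in> carrier_mat d d" "P\<^sup>T * P = 1\<^sub>m d"
    "M * M\<^sup>T = P * mat_diag d (\<lambda>i. (sing_val M (Suc i))\<^sup>2) * P\<^sup>T"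
    and Pm: "\<And>i j. i \<le> j \<Longrightarrow> sing_val M (Suc j) \<le> sing_val M (Suc i)" "\<And>i. 0 \<le> sing_val M i"
    using gram_spectral[OF M] by metis
  obtain Q where Q: "Q \<in> carrier_mat d d" "Q\<^sup>T * Q = 1\<^sub>m d"
    "Y * Y\<^sup>T = Q * mat_diag d (\<lambda>i. (sing_val Y (Suc i))\<^sup>2) * Q\<^sup>T"
    and Qm: "\<And>i j. i \<le> j \<Longrightarrow> sing_val Y (Suc j) \<le> sing_val Y (Suc i)" "\<And>i. 0 \<le> sing_val Y i"
    using gram_spectral[OF Y] by metis
  have quad: "\<bar>x \<bullet> (Y * Y\<^sup>T *\<^sub>v x) - x \<bullet> (M * M\<^sup>T *\<^sub>v x) - c * (x \<bullet> x)\<bar> \<le> \<epsilon> * (x \<bullet> x)" if "x \<in> carrier_vec d" for x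
    using close that M unfolding close_gram_def gram_quadratic_form[OF Y that] gram_quadratic_form[OF M that] by auto
  have k1: "k - 1 < d" "Suc (k - 1) = k" using k by auto
  have mP: "(sing_val M (Suc j))\<^sup>2 \<le> (sing_val M (Suc i))\<^sup>2" if "i \<le> j" for i j
    using Pm that by (intro power_mono) auto
  have mQ: "(sing_val Y (Suc j))\<^sup>2 \<le> (sing_val Y (Suc i))\<^sup>2" if "i \<le> j" for i j
    using Qm that by (intro power_mono) auto
  have "(sing_val M (Suc (k - 1)))\<^sup>2 \<le> (sing_val Y (Suc (k - 1)))\<^sup>2 + (\<epsilon> - c)"
  proof (rule weyl[OF P Q mP mQ k1(1)])
    show "x \<bullet> (M * M\<^sup>T *\<^sub>v x) \<le> x \<bullet> (Y * Y\<^sup>T *\<^sub>v x) + (\<epsilon> - c) * (x \<bullet> x)" if "x \<in> carrier_vec d" for x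
      using quad[OF that] unfolding left_diff_distrib by linarith
  qed
  moreover have "(sing_val Y (Suc (k - 1)))\<^sup>2 \<le> (sing_val M (Suc (k - 1)))\<^sup>2 + (\<epsilon> + c)"
  proof (rule weyl[OF Q P mQ mP k1(1)])
    show "x \<bullet> (Y * Y\<^sup>T *\<^sub>v x) \<le> x \<bullet> (M * M\<^sup>T *\<^sub>v x) + (\<epsilon> + c) * (x \<bullet> x)" if "x \<in> carrier_vec d" for x
      using quad[OF that] unfolding distrib_right by linarith
  qed
  ultimately show ?thesis unfolding k1(2) by linarith
qed

lemma gram_difference:
  fixes M Y :: "real mat" and c :: real
  assumes M: "M \<in> carrier_mat d n" and Y: "Y \<in> carrier_mat d n"
  defines "G \<equiv> Y * Y\<^sup>T - (M * M\<^sup>T + c \<cdot>\<^sub>m 1\<^sub>m d)"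
  shows "G \<in> carrier_mat d d" "G\<^sup>T = G"
    and "\<And>x. x \<in> carrier_vec d \<Longrightarrow>
      x \<bullet> (G *\<^sub>v x) = (Y\<^sup>T *\<^sub>v x) \<bullet> (Y\<^sup>T *\<^sub>v x) - (M\<^sup>T *\<^sub>v x) \<bullet> (M\<^sup>T *\<^sub>v x) - c * (x \<bullet> x)"
proof -
  have YY: "Y * Y\<^sup>T \<in> carrier_mat d d" and MM: "M * M\<^sup>T \<in> carrier_mat d d" using M Y by auto
  let ?C = "c \<cdot>\<^sub>m 1\<^sub>m d"
  have C: "?C \<in> carrier_mat d d" "?C\<^sup>T = ?C" by (auto intro!: eq_matI)
  have MC: "M * M\<^sup>T + ?C \<in> carrier_mat d d" using MM C by auto
  show G: "G \<in> carrier_mat d d" unfolding G_def using YY MC by auto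
  have "(Y * Y\<^sup>T)\<^sup>T = Y * Y\<^sup>T" using Y by (simp add: transpose_mult[of _ d n _ d])
  moreover have "(M * M\<^sup>T)\<^sup>T = M * M\<^sup>T" using M by (simp add: transpose_mult[of _ d n _ d])
  ultimately show "G\<^sup>T = G"
    unfolding G_def using YY MM MC C by (simp add: transpose_minus[of _ d d] transpose_add[of _ d d])
  fix x :: "real vec" assume x: "x \<in> carrier_vec d"
  have Cx: "?C *\<^sub>v x = c \<cdot>\<^sub>v x"
    using x by (intro eq_vecI) (auto simp: scalar_prod_left_unit[OF x] smult_scalar_prod_distrib[of _ d])
  have cs: "Y * Y\<^sup>T *\<^sub>v x \<in> carrier_vec d" "M * M\<^sup>T *\<^sub>v x \<in> carrier_vec d"
    using mult_mat_vec_carrier[OF YY x] mult_mat_vec_carrier[OF MM x] by auto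
  have "G *\<^sub>v x = Y * Y\<^sup>T *\<^sub>v x - (M * M\<^sup>T *\<^sub>v x + c \<cdot>\<^sub>v x)"
    unfolding G_def minus_mult_distrib_mat_vec[OF YY MC x] add_mult_distrib_mat_vec[OF MM C(1) x] Cx ..
  then have "x \<bullet> (G *\<^sub>v x) = x \<bullet> (Y * Y\<^sup>T *\<^sub>v x) - (x \<bullet> (M * M\<^sup>T *\<^sub>v x) + c * (x \<bullet> x))"
    using cs x by (simp add: scalar_prod_minus_distrib[of _ d] scalar_prod_add_distrib[of _ d]
      scalar_prod_smult_distrib[of _ d] del: assoc_mult_mat_vec)
  then show "x \<bullet> (G *\<^sub>v x) = (Y\<^sup>T *\<^sub>v x) \<bullet> (Y\<^sup>T *\<^sub>v x) - (M\<^sup>T *\<^sub>v x) \<bullet> (M\<^sup>T *\<^sub>v x) - c * (x \<bullet> x)"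
    unfolding gram_quadratic_form[OF Y x] gram_quadratic_form[OF M x] by simp
qed

context
  fixes M :: "real mat" and d n k :: nat and u :: "real vec" and c g :: real
  assumes M: "M \<in> carrier_mat d n" and k: "1 \<le> k" and g_def: "g = eigengap (M * M\<^sup>T) k" and g: "0 < g"
    and u: "is_left_sing_vec M k u"
begin

text \<open>For c = d2 d3 sigma^2 this is the mean of \<open>Y * Y\<^sup>T\<close>. The shift
  changes the eigenvalue to \<open>\<mu>\<close> but keeps \<open>u\<close> and the gap.\<close>

private definition "S = M * M\<^sup>T + c \<cdot>\<^sub>m 1\<^sub>m d"
private definition "\<mu> = (sing_val M k)\<^sup>2 + c"

private lemma uc: "u \<in> carrier_vec d" "vnorm u = 1"
  using left_sing_vec_gram[OF M u] by auto

private lemma MM: "M * M\<^sup>T \<in> carrier_mat d d"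
  using M by auto

private lemma S: "S \<in> carrier_mat d d"
  unfolding S_def using MM by auto

private lemma S_sym: "S\<^sup>T = S"
proof -
  have "(M * M\<^sup>T)\<^sup>T = M * M\<^sup>T" using M by (simp add: transpose_mult[of _ d n _ d])
  moreover have "(c \<cdot>\<^sub>m 1\<^sub>m d)\<^sup>T = c \<cdot>\<^sub>m 1\<^sub>m d" by (rule eq_matI) auto
  ultimately show ?thesis unfolding S_def using MM by (simp add: transpose_add[of _ d d])
qed

private lemma S_mult: "x \<in> carrier_vec d \<Longrightarrow> S *\<^sub>v x = M * M\<^sup>T *\<^sub>v x + c \<cdot>\<^sub>v x"
proof -
  assume x: "x \<in> carrier_vec d"
  have "(c \<cdot>\<^sub>m 1\<^sub>m d) *\<^sub>v x = c \<cdot>\<^sub>v x"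
    using x by (intro eq_vecI) (auto simp: scalar_prod_left_unit[OF x] smult_scalar_prod_distrib[of _ d])
  then show "S *\<^sub>v x = M * M\<^sup>T *\<^sub>v x + c \<cdot>\<^sub>v x"
    unfolding S_def using MM x by (simp add: add_mult_distrib_mat_vec[of _ d d])
qed

private lemma Su: "S *\<^sub>v u = \<mu> \<cdot>\<^sub>v u"
  unfolding S_mult[OF uc(1)] left_sing_vec_gram(3)[OF M u] \<mu>_def by (simp add: add_smult_distrib_vec)

private lemma gapS:
  assumes p: "p \<in> carrier_vec d" "p \<bullet> u = 0"
  shows "g * vnorm p \<le> vnorm (S *\<^sub>v p - \<mu> \<cdot>\<^sub>v p)"
proof -
  obtain P where P: "P \<in> carrier_mat d d" "P\<^sup>T * P = 1\<^sub>m d"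
    "M * M\<^sup>T = P * mat_diag d (\<lambda>i. (sing_val M (Suc i))\<^sup>2) * P\<^sup>T"
    using gram_spectral[OF M] by metis
  note eg = eigengap_pos[OF M k g[unfolded g_def]]
  have k1: "k - 1 < d" "Suc (k - 1) = k" using k eg(1) by auto
  have "M * M\<^sup>T *\<^sub>v p \<in> carrier_vec d" using MM p(1) by (rule mult_mat_vec_carrier)
  then have "S *\<^sub>v p - \<mu> \<cdot>\<^sub>v p = M * M\<^sup>T *\<^sub>v p - (sing_val M (Suc (k - 1)))\<^sup>2 \<cdot>\<^sub>v p"
    unfolding S_mult[OF p(1)] \<mu>_def k1(2) using p(1) by (intro eq_vecI) (auto simp: algebra_simps simp del: assoc_mult_mat_vec)
  moreover have "g * vnorm p \<le> vnorm (M * M\<^sup>T *\<^sub>v p - (sing_val M (Suc (k - 1)))\<^sup>2 \<cdot>\<^sub>v p)"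
  proof (rule spectral_gap[OF P uc _ k1(1) g _ p])
    show "M * M\<^sup>T *\<^sub>v u = (sing_val M (Suc (k - 1)))\<^sup>2 \<cdot>\<^sub>v u" unfolding k1(2) by (rule left_sing_vec_gram(3)[OF M u])
    show "g \<le> \<bar>(sing_val M (Suc i))\<^sup>2 - (sing_val M (Suc (k - 1)))\<^sup>2\<bar>" if "i \<noteq> k - 1" for i
      unfolding k1(2) g_def using that k by (intro eg(4)) auto
  qed
  ultimately show ?thesis by simp
qed

private lemma nearS:
  assumes Y: "Y \<in> carrier_mat d n" and close: "close_gram M c \<epsilon> Y" and x: "x \<in> carrier_vec d"
  shows "vnorm (Y * Y\<^sup>T *\<^sub>v x - S *\<^sub>v x) \<le> \<epsilon> * vnorm x"
proof -
  have YY: "Y * Y\<^sup>T \<in> carrier_mat d d" using Y by auto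
  note gd = gram_difference[OF M Y, where c = c, folded S_def]
  have "vnorm ((Y * Y\<^sup>T - S) *\<^sub>v x) \<le> \<epsilon> * vnorm x"
  proof (rule vnorm_le_of_quadratic_form[OF gd(1,2) _ x])
    fix z :: "real vec" assume z: "z \<in> carrier_vec d"
    then show "\<bar>z \<bullet> ((Y * Y\<^sup>T - S) *\<^sub>v z)\<bar> \<le> \<epsilon> * (z \<bullet> z)"
      using close M unfolding close_gram_def gd(3)[OF z] by auto
  qed
  then show ?thesis unfolding minus_mult_distrib_mat_vec[OF YY S x] .
qed

text \<open>Closeness of the Gram matrices already bounds \<open>Y\<close> by |Y^T x|^2 <= (|M|^2 +
  c + epsilon) |x|^2, so no separate estimate of the norm of the noise is required.\<close>

lemma close_gram_transpose_bound:
  assumes Y: "Y \<in> carrier_mat d n" and close: "close_gram M c \<epsilon> Y" and \<epsilon>: "\<epsilon> \<le> (op_norm M)\<^sup>2" and c: "0 \<le> c"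
    and x: "x \<in> carrier_vec d"
  shows "vnorm (Y\<^sup>T *\<^sub>v x) \<le> (2 * op_norm M + sqrt c) * vnorm x"
proof -
  have "(vnorm (Y\<^sup>T *\<^sub>v x))\<^sup>2 \<le> (vnorm (M\<^sup>T *\<^sub>v x))\<^sup>2 + c * (vnorm x)\<^sup>2 + \<epsilon> * (vnorm x)\<^sup>2"
    unfolding vnorm_power2 using close x M by (auto simp: close_gram_def abs_le_iff)
  also have "(vnorm (M\<^sup>T *\<^sub>v x))\<^sup>2 \<le> (op_norm M * vnorm x)\<^sup>2"
    by (intro power_mono op_norm_transpose_bound[OF M x]) simp
  also have "\<epsilon> * (vnorm x)\<^sup>2 \<le> (op_norm M)\<^sup>2 * (vnorm x)\<^sup>2" using \<epsilon> by (intro mult_right_mono) auto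
  finally have "(vnorm (Y\<^sup>T *\<^sub>v x))\<^sup>2 \<le> (2 * (op_norm M)\<^sup>2 + (sqrt c)\<^sup>2) * (vnorm x)\<^sup>2"
    using c by (simp add: power_mult_distrib algebra_simps)
  also have "\<dots> \<le> (2 * op_norm M + sqrt c)\<^sup>2 * (vnorm x)\<^sup>2"
  proof (rule mult_right_mono)
    have "(2 * op_norm M + sqrt c)\<^sup>2 = 4 * (op_norm M)\<^sup>2 + 4 * (op_norm M * sqrt c) + (sqrt c)\<^sup>2"
      by (simp add: power2_sum power_mult_distrib)
    moreover have "0 \<le> op_norm M * sqrt c" using op_norm_nonneg[OF M] c by simp
    ultimately show "2 * (op_norm M)\<^sup>2 + (sqrt c)\<^sup>2 \<le> (2 * op_norm M + sqrt c)\<^sup>2"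
      using zero_le_power2[of "op_norm M"] by linarith
  qed simp
  finally have "(vnorm (Y\<^sup>T *\<^sub>v x))\<^sup>2 \<le> ((2 * op_norm M + sqrt c) * vnorm x)\<^sup>2" by (simp add: power_mult_distrib)
  then show ?thesis by (rule power2_le_imp_le) (use op_norm_nonneg[OF M] c in simp)
qed

text \<open>The gap is at most the square of the k-th singular value. This is the link by which a
  gap condition forces the signal to dominate the noise.\<close>

lemma eigengap_le_op_norm: "g \<le> (op_norm M)\<^sup>2"
proof -
  obtain v where v: "v \<in> carrier_vec n" "vnorm v = 1" "M *\<^sub>v v = sing_val M k \<cdot>\<^sub>v u"
    using u M unfolding is_left_sing_vec_def by auto
  note eg = eigengap_pos[OF M k g[unfolded g_def]]
  have "sing_val M k \<le> op_norm M"
    using op_norm_bound[OF M v(1)] eg(3) uc(2) unfolding v(3) by (simp add: v(2))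
  then have "(sing_val M k)\<^sup>2 \<le> (op_norm M)\<^sup>2" using eg(3) by (intro power_mono) auto
  then show ?thesis using eg(2) g_def by simp
qed

text \<open>Davis-Kahan with g - epsilon >= g / 2. That the bound is quadratic in epsilon / g is
  what later makes the bias small.\<close>

lemma left_sing_vec_near:
  assumes Y: "Y \<in> carrier_mat d n" and close: "close_gram M c \<epsilon> Y" and \<epsilon>: "\<epsilon> \<le> g / 10"
    and w: "is_left_sing_vec Y k w"
  shows "1 - (w \<bullet> u)\<^sup>2 \<le> (2 * (\<epsilon> / g))\<^sup>2"
proof -
  note eg = eigengap_pos[OF M k g[unfolded g_def]]
  note lw = left_sing_vec_gram[OF Y w]
  have \<theta>: "\<bar>(sing_val Y k)\<^sup>2 - \<mu>\<bar> \<le> \<epsilon>" unfolding \<mu>_def by (rule sing_val_perturbation[OF M Y k eg(1) close])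
  have "(g - \<epsilon>) * vnorm (w - (w \<bullet> u) \<cdot>\<^sub>v u) \<le> \<epsilon>"
    using nearS[OF Y close lw(1)] lw(2) by (intro davis_kahan[OF S S_sym uc Su gapS lw _ \<theta>]) auto
  moreover have "g / 2 * vnorm (w - (w \<bullet> u) \<cdot>\<^sub>v u) \<le> (g - \<epsilon>) * vnorm (w - (w \<bullet> u) \<cdot>\<^sub>v u)"
    using \<epsilon> g by (intro mult_right_mono) auto
  ultimately have "vnorm (w - (w \<bullet> u) \<cdot>\<^sub>v u) \<le> 2 * (\<epsilon> / g)" using g by (simp add: field_simps)
  then have "(vnorm (w - (w \<bullet> u) \<cdot>\<^sub>v u))\<^sup>2 \<le> (2 * (\<epsilon> / g))\<^sup>2" by (intro power_mono) auto
  then show ?thesis unfolding vnorm_reject[OF uc lw(1)] using lw(2) by (simp add: vnorm_eq_1_iff)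
qed

text \<open>For the difference e of the two Gram matrices at w', expand |e|^2 = <Y'^T e, Y'^T w'> -
  <Y^T e, Y^T w'> and telescope. Each of the two terms has one factor bounded by the Frobenius
  distance F and one by Lambda = 2 |M| + sqrt c, so |e| <= 2 Lambda F; the Lipschitz constant 5 / g
  of eigenvectors gives the 10.\<close>

lemma left_sing_vec_lipschitz:
  assumes Y: "Y \<in> carrier_mat d n" "close_gram M c (g / 10) Y" and Y': "Y' \<in> carrier_mat d n" "close_gram M c (g / 10) Y'"
    and w: "is_left_sing_vec Y k w" "0 < w \<bullet> u" and w': "is_left_sing_vec Y' k w'" "0 < w' \<bullet> u" and c: "0 \<le> c"
  shows "vnorm (w - w') \<le> 10 * (2 * op_norm M + sqrt c) / g * sqrt (\<Sum>i<d. \<Sum>j<n. (Y $$ (i, j) - Y' $$ (i, j))\<^sup>2)"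
proof -
  let ?F = "sqrt (\<Sum>i<d. \<Sum>j<n. (Y $$ (i, j) - Y' $$ (i, j))\<^sup>2)"
  let ?\<Lambda> = "2 * op_norm M + sqrt c"
  note eg = eigengap_pos[OF M k g[unfolded g_def]]
  note lw = left_sing_vec_gram[OF Y(1) w(1)]
  note lw' = left_sing_vec_gram[OF Y'(1) w'(1)]
  have gle: "g / 10 \<le> (op_norm M)\<^sup>2" using eigengap_le_op_norm g by simp
  note bY = close_gram_transpose_bound[OF Y gle c]
  note bY' = close_gram_transpose_bound[OF Y' gle c]
  have \<Lambda>0: "0 \<le> ?\<Lambda>" using op_norm_nonneg[OF M] c by simp
  have YY: "Y * Y\<^sup>T \<in> carrier_mat d d" "Y' * Y'\<^sup>T \<in> carrier_mat d d" using Y(1) Y'(1) by auto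
  have diff: "vnorm (Y'\<^sup>T *\<^sub>v x - Y\<^sup>T *\<^sub>v x) \<le> ?F * vnorm x" if x: "x \<in> carrier_vec d" for x
  proof -
    have "(Y'\<^sup>T - Y\<^sup>T) *\<^sub>v x = Y'\<^sup>T *\<^sub>v x - Y\<^sup>T *\<^sub>v x"
      using Y(1) Y'(1) x by (intro minus_mult_distrib_mat_vec[of _ n d]) auto
    moreover have "vnorm ((Y'\<^sup>T - Y\<^sup>T) *\<^sub>v x) \<le> sqrt (\<Sum>i<n. \<Sum>j<d. ((Y'\<^sup>T - Y\<^sup>T) $$ (i, j))\<^sup>2) * vnorm x"
      using Y(1) Y'(1) x by (intro vnorm_mult_mat_vec_le_frobenius) auto
    moreover have "(\<Sum>i<n. \<Sum>j<d. ((Y'\<^sup>T - Y\<^sup>T) $$ (i, j))\<^sup>2) = (\<Sum>i<n. \<Sum>j<d. (Y $$ (j, i) - Y' $$ (j, i))\<^sup>2)"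
      using Y(1) Y'(1) by (intro sum.cong refl) (auto simp: power2_commute)
    moreover have "\<dots> = (\<Sum>i<d. \<Sum>j<n. (Y $$ (i, j) - Y' $$ (i, j))\<^sup>2)" by (rule sum.swap)
    ultimately show ?thesis by simp
  qed
  define e where "e = Y' * Y'\<^sup>T *\<^sub>v w' - Y * Y\<^sup>T *\<^sub>v w'"
  have cw: "Y * Y\<^sup>T *\<^sub>v w' \<in> carrier_vec d" "Y' * Y'\<^sup>T *\<^sub>v w' \<in> carrier_vec d"
    using mult_mat_vec_carrier[OF YY(1) lw'(1)] mult_mat_vec_carrier[OF YY(2) lw'(1)] by auto
  have e: "e \<in> carrier_vec d" unfolding e_def using cw by auto
  have Yc: "Y\<^sup>T *\<^sub>v x \<in> carrier_vec n" "Y'\<^sup>T *\<^sub>v x \<in> carrier_vec n" if "x \<in> carrier_vec d" for x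
    using that Y(1) Y'(1) by auto
  have form: "e \<bullet> (X * X\<^sup>T *\<^sub>v w') = (X\<^sup>T *\<^sub>v e) \<bullet> (X\<^sup>T *\<^sub>v w')" if X: "X \<in> carrier_mat d n" for X :: "real mat"
  proof -
    have "X * X\<^sup>T *\<^sub>v w' = X *\<^sub>v (X\<^sup>T *\<^sub>v w')" using X lw'(1) by (intro assoc_mult_mat_vec[of _ d n _ d]) auto
    moreover have "X\<^sup>T *\<^sub>v w' \<in> carrier_vec n" using X lw'(1) by auto
    ultimately show ?thesis using scalar_prod_mult_mat_vec[OF X e] by simp
  qed
  have "(vnorm e)\<^sup>2 = e \<bullet> (Y' * Y'\<^sup>T *\<^sub>v w') - e \<bullet> (Y * Y\<^sup>T *\<^sub>v w')"
    unfolding vnorm_power2 by (subst (2) e_def) (rule scalar_prod_minus_distrib[OF e cw(2) cw(1)])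
  also have "\<dots> = (Y'\<^sup>T *\<^sub>v e) \<bullet> (Y'\<^sup>T *\<^sub>v w') - (Y\<^sup>T *\<^sub>v e) \<bullet> (Y\<^sup>T *\<^sub>v w')"
    unfolding form[OF Y(1)] form[OF Y'(1)] ..
  also have "\<dots> = (Y'\<^sup>T *\<^sub>v e - Y\<^sup>T *\<^sub>v e) \<bullet> (Y'\<^sup>T *\<^sub>v w') + (Y\<^sup>T *\<^sub>v e) \<bullet> (Y'\<^sup>T *\<^sub>v w' - Y\<^sup>T *\<^sub>v w')"
    using Yc[OF e] Yc[OF lw'(1)]
    by (simp add: minus_scalar_prod_distrib[of _ n] scalar_prod_minus_distrib[of _ n])
  also have "\<dots> \<le> vnorm (Y'\<^sup>T *\<^sub>v e - Y\<^sup>T *\<^sub>v e) * vnorm (Y'\<^sup>T *\<^sub>v w') + vnorm (Y\<^sup>T *\<^sub>v e) * vnorm (Y'\<^sup>T *\<^sub>v w' - Y\<^sup>T *\<^sub>v w')"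
    using Yc[OF e] Yc[OF lw'(1)] by (intro add_mono scalar_prod_le_vnorm[of _ n]) auto
  also have "\<dots> \<le> (?F * vnorm e) * (?\<Lambda> * vnorm w') + (?\<Lambda> * vnorm e) * (?F * vnorm w')"
    by (intro add_mono mult_mono diff bY bY' e lw'(1) mult_nonneg_nonneg \<Lambda>0 vnorm_nonneg real_sqrt_ge_zero sum_nonneg) auto
  also have "\<dots> = vnorm e * (2 * ?\<Lambda> * ?F)" using lw'(2) by simp
  finally have "vnorm e * vnorm e \<le> vnorm e * (2 * ?\<Lambda> * ?F)" by (simp add: power2_eq_square)
  moreover have "0 \<le> 2 * ?\<Lambda> * ?F" by (intro mult_nonneg_nonneg \<Lambda>0 real_sqrt_ge_zero sum_nonneg) auto
  ultimately have D: "vnorm e \<le> 2 * ?\<Lambda> * ?F"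
    by (cases "vnorm e = 0") (auto simp: mult_le_cancel_left order_less_le)
  have sYY: "(Y * Y\<^sup>T)\<^sup>T = Y * Y\<^sup>T" using Y(1) by (simp add: transpose_mult[of _ d n _ d])
  have \<theta>: "\<bar>(sing_val Y k)\<^sup>2 - \<mu>\<bar> \<le> g / 10" unfolding \<mu>_def by (rule sing_val_perturbation[OF M Y(1) k eg(1) Y(2)])
  have \<theta>': "\<bar>(sing_val Y' k)\<^sup>2 - \<mu>\<bar> \<le> g / 10" unfolding \<mu>_def by (rule sing_val_perturbation[OF M Y'(1) k eg(1) Y'(2)])
  have "vnorm (w - w') \<le> 5 / g * (2 * ?\<Lambda> * ?F)"
    by (rule eigenvector_lipschitz[OF S S_sym sYY uc Su gapS g YY(1) lw nearS[OF Y] \<theta> w(2) YY(2) lw' nearS[OF Y'] \<theta>' w'(2) D[unfolded e_def]])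
  moreover have "5 / g * (2 * L * F) = 10 * L / g * F" for L F by simp
  ultimately show ?thesis by (simp only:)
qed

end

section \<open>Two-sided reflections\<close>

text \<open>On the singular pair the two sign changes cancel, and \<open>M\<close> respects the
  orthogonal complements, where both reflections act trivially.\<close>

lemma householder_fixes:
  assumes M: "M \<in> carrier_mat d n" and u: "u \<in> carrier_vec d" "vnorm u = 1" and v: "v \<in> carrier_vec n" "vnorm v = 1"
    and Mv: "M *\<^sub>v v = s \<cdot>\<^sub>v u" and Mu: "M\<^sup>T *\<^sub>v u = s \<cdot>\<^sub>v v"
  shows "householder d u * M * householder n v = M"
proof (rule mat_eqI_mult_vec[OF _ M])
  have H: "householder d u \<in> carrier_mat d d" and G: "householder n v \<in> carrier_mat n n" by auto
  show "householder d u * M * householder n v \<in> carrier_mat d n"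
    using M by (auto intro!: mult_carrier_mat[OF mult_carrier_mat[OF H M] G])
  fix x :: "real vec" assume x: "x \<in> carrier_vec n"
  have uu: "u \<bullet> u = 1" "v \<bullet> v = 1" using u v by (simp_all add: vnorm_eq_1_iff)
  define a where "a = v \<bullet> x"
  have Mx: "M *\<^sub>v x \<in> carrier_vec d" using M x by auto
  have uM: "u \<bullet> (M *\<^sub>v x) = s * a"
    unfolding scalar_prod_mult_mat_vec[OF M u(1) x] Mu a_def using v x by (simp add: smult_scalar_prod_distrib[of _ n])
  have Gx: "householder n v *\<^sub>v x = x - (2 * a) \<cdot>\<^sub>v v"
    unfolding householder_mult_vec[OF v(1) x] uu a_def by simp
  have MGx: "M *\<^sub>v (x - (2 * a) \<cdot>\<^sub>v v) = M *\<^sub>v x - (2 * a * s) \<cdot>\<^sub>v u"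
    using M x v u by (simp add: mult_mat_vec_diff[of _ d n] mult_mat_vec[of _ d n] Mv smult_smult_assoc)
  have z: "M *\<^sub>v x - (2 * a * s) \<cdot>\<^sub>v u \<in> carrier_vec d" using Mx u by auto
  have "u \<bullet> (M *\<^sub>v x - (2 * a * s) \<cdot>\<^sub>v u) = - (a * s)"
    using Mx u by (simp add: scalar_prod_minus_distrib[of _ d] scalar_prod_smult_distrib[of _ d] uM uu)
  then have "householder d u *\<^sub>v (M *\<^sub>v x - (2 * a * s) \<cdot>\<^sub>v u) = (M *\<^sub>v x - (2 * a * s) \<cdot>\<^sub>v u) - (- 2 * a * s) \<cdot>\<^sub>v u"
    unfolding householder_mult_vec[OF u(1) z] uu by (simp add: mult.assoc)
  also have "\<dots> = M *\<^sub>v x"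
    by (intro eq_vecI) (simp_all add: carrier_vecD[OF u(1)] carrier_matD[OF M])
  finally have HMGx: "householder d u *\<^sub>v (M *\<^sub>v (householder n v *\<^sub>v x)) = M *\<^sub>v x" unfolding Gx MGx .
  have Gxc: "householder n v *\<^sub>v x \<in> carrier_vec n" by (rule mult_mat_vec_carrier[OF G x])
  have "householder d u * M * householder n v *\<^sub>v x = householder d u * M *\<^sub>v (householder n v *\<^sub>v x)"
    by (rule assoc_mult_mat_vec[OF mult_carrier_mat[OF H M] G x])
  also have "\<dots> = householder d u *\<^sub>v (M *\<^sub>v (householder n v *\<^sub>v x))"
    by (rule assoc_mult_mat_vec[OF H M Gxc])
  finally show "householder d u * M * householder n v *\<^sub>v x = M *\<^sub>v x" unfolding HMGx .
qed

context
  fixes d n :: nat and H G :: "real mat"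
  assumes H: "H \<in> carrier_mat d d" "H\<^sup>T = H" "H * H = 1\<^sub>m d" and G: "G \<in> carrier_mat n n" "G\<^sup>T = G" "G * G = 1\<^sub>m n"
begin

lemma reflect_carrier: "Y \<in> carrier_mat d n \<Longrightarrow> H * Y * G \<in> carrier_mat d n"
  using mult_carrier_mat[OF mult_carrier_mat[OF H(1)] G(1)] by blast

lemma reflect_involutive:
  assumes Y: "Y \<in> carrier_mat d n" shows "H * (H * Y * G) * G = Y"
proof -
  have HY: "H * Y \<in> carrier_mat d n" using H(1) Y by auto
  have "H * (H * Y * G) * G = H * ((H * Y * G) * G)"
    by (rule assoc_mult_mat[OF H(1) reflect_carrier[OF Y] G(1)])
  also have "(H * Y * G) * G = H * Y * (G * G)" by (rule assoc_mult_mat[OF HY G(1) G(1)])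
  also have "\<dots> = H * Y" unfolding G(3) by (rule right_mult_one_mat[OF HY])
  also have "H * (H * Y) = (H * H) * Y" by (rule assoc_mult_mat[OF H(1) H(1) Y, symmetric])
  also have "\<dots> = Y" unfolding H(3) by (rule left_mult_one_mat[OF Y])
  finally show ?thesis .
qed

lemma H_isometry:
  assumes "x \<in> carrier_vec d" shows "(H *\<^sub>v x) \<bullet> (H *\<^sub>v x) = x \<bullet> x"
proof -
  have "H *\<^sub>v (H *\<^sub>v x) = H * H *\<^sub>v x" by (rule assoc_mult_mat_vec[OF H(1) H(1) assms, symmetric])
  then have "H *\<^sub>v (H *\<^sub>v x) = x" unfolding H(3) using assms by simp
  then show ?thesis
    using scalar_prod_mult_mat_vec[OF H(1) assms mult_mat_vec_carrier[OF H(1) assms]] H(2) by simp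
qed

lemma G_isometry:
  assumes "x \<in> carrier_vec n" shows "(G *\<^sub>v x) \<bullet> (G *\<^sub>v x) = x \<bullet> x"
proof -
  have "G *\<^sub>v (G *\<^sub>v x) = G * G *\<^sub>v x" by (rule assoc_mult_mat_vec[OF G(1) G(1) assms, symmetric])
  then have "G *\<^sub>v (G *\<^sub>v x) = x" unfolding G(3) using assms by simp
  then show ?thesis
    using scalar_prod_mult_mat_vec[OF G(1) assms mult_mat_vec_carrier[OF G(1) assms]] G(2) by simp
qed

lemma reflect_transpose:
  assumes Y: "Y \<in> carrier_mat d n" shows "(H * Y * G)\<^sup>T = G * Y\<^sup>T * H"
proof -
  have YT: "Y\<^sup>T \<in> carrier_mat n d" using Y by simp
  have "(H * Y * G)\<^sup>T = G\<^sup>T * (H * Y)\<^sup>T" using H(1) Y by (intro transpose_mult[OF _ G(1), of _ d]) auto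
  also have "(H * Y)\<^sup>T = Y\<^sup>T * H\<^sup>T" by (rule transpose_mult[OF H(1) Y])
  finally show ?thesis unfolding H(2) G(2) using assoc_mult_mat[OF G(1) YT H(1)] by simp
qed

lemma reflect_transpose_mult_vec:
  assumes Y: "Y \<in> carrier_mat d n" and x: "x \<in> carrier_vec d"
  shows "(H * Y * G)\<^sup>T *\<^sub>v x = G *\<^sub>v (Y\<^sup>T *\<^sub>v (H *\<^sub>v x))"
proof -
  have YT: "Y\<^sup>T \<in> carrier_mat n d" using Y by simp
  have "G * Y\<^sup>T * H *\<^sub>v x = G * Y\<^sup>T *\<^sub>v (H *\<^sub>v x)"
    by (rule assoc_mult_mat_vec[OF mult_carrier_mat[OF G(1) YT] H(1) x])
  also have "\<dots> = G *\<^sub>v (Y\<^sup>T *\<^sub>v (H *\<^sub>v x))"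
    by (rule assoc_mult_mat_vec[OF G(1) YT mult_mat_vec_carrier[OF H(1) x]])
  finally show ?thesis unfolding reflect_transpose[OF Y] .
qed

text \<open>Substitute H x for x: \<open>G\<close> and \<open>H\<close> are isometries, and the form
  of \<open>M\<close> is unchanged because the reflection fixes \<open>M\<close>.\<close>

lemma close_gram_reflect:
  assumes M: "M \<in> carrier_mat d n" and fix_M: "H * M * G = M" and Y: "Y \<in> carrier_mat d n" and close: "close_gram M c \<epsilon> Y"
  shows "close_gram M c \<epsilon> (H * Y * G)"
  unfolding close_gram_def
proof (intro conjI ballI)
  show "H * Y * G \<in> carrier_mat (dim_row M) (dim_col M)" using reflect_carrier[OF Y] M by auto
  fix x :: "real vec" assume "x \<in> carrier_vec (dim_row M)"
  then have x: "x \<in> carrier_vec d" using M by simp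
  have Hx: "H *\<^sub>v x \<in> carrier_vec d" by (rule mult_mat_vec_carrier[OF H(1) x])
  have q: "((H * X * G)\<^sup>T *\<^sub>v x) \<bullet> ((H * X * G)\<^sup>T *\<^sub>v x) = (X\<^sup>T *\<^sub>v (H *\<^sub>v x)) \<bullet> (X\<^sup>T *\<^sub>v (H *\<^sub>v x))"
    if X: "X \<in> carrier_mat d n" for X
    unfolding reflect_transpose_mult_vec[OF X x] using X Hx by (intro G_isometry) auto
  have qM: "(M\<^sup>T *\<^sub>v x) \<bullet> (M\<^sup>T *\<^sub>v x) = (M\<^sup>T *\<^sub>v (H *\<^sub>v x)) \<bullet> (M\<^sup>T *\<^sub>v (H *\<^sub>v x))"
    using q[OF M] unfolding fix_M .
  show "\<bar>((H * Y * G)\<^sup>T *\<^sub>v x) \<bullet> ((H * Y * G)\<^sup>T *\<^sub>v x) - (M\<^sup>T *\<^sub>v x) \<bullet> (M\<^sup>T *\<^sub>v x) - c * (x \<bullet> x)\<bar> \<le> \<epsilon> * (x \<bullet> x)"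
    unfolding q[OF Y] qM H_isometry[OF x, symmetric] using close Hx M unfolding close_gram_def by auto
qed

lemma is_left_sing_vec_reflect:
  assumes Y: "Y \<in> carrier_mat d n" and w: "is_left_sing_vec Y k w"
  shows "is_left_sing_vec (H * Y * G) k (H *\<^sub>v w)"
proof -
  have YT: "Y\<^sup>T \<in> carrier_mat n d" using Y by simp
  have HY: "H * Y \<in> carrier_mat d n" using H(1) Y by auto
  have YY: "Y * Y\<^sup>T \<in> carrier_mat d d" using Y by auto
  obtain v where v: "v \<in> carrier_vec n" "vnorm v = 1" "Y *\<^sub>v v = sing_val Y k \<cdot>\<^sub>v w" "Y\<^sup>T *\<^sub>v w = sing_val Y k \<cdot>\<^sub>v v"
    and wc: "w \<in> carrier_vec d" "vnorm w = 1"
    using w Y unfolding is_left_sing_vec_def by auto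
  have Gv: "G *\<^sub>v v \<in> carrier_vec n" by (rule mult_mat_vec_carrier[OF G(1) v(1)])
  have HHw: "H *\<^sub>v (H *\<^sub>v w) = w"
    using assoc_mult_mat_vec[OF H(1) H(1) wc(1)] wc(1) unfolding H(3) by simp
  have GGv: "G *\<^sub>v (G *\<^sub>v v) = v"
    using assoc_mult_mat_vec[OF G(1) G(1) v(1)] v(1) unfolding G(3) by simp
  \<comment> \<open>The Gram matrix is conjugated by \<open>H\<close>, so its characteristic
    polynomial, and with it every singular value, is unchanged.\<close>
  have "H * Y * G * (H * Y * G)\<^sup>T = H * (Y * Y\<^sup>T) * H"
  proof -
    have GYT: "G * Y\<^sup>T \<in> carrier_mat n d" using G(1) YT by auto
    have "H * Y * G * (G * Y\<^sup>T * H) = H * Y * (G * (G * Y\<^sup>T * H))"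
      by (rule assoc_mult_mat[OF HY G(1) mult_carrier_mat[OF GYT H(1)]])
    also have "G * (G * Y\<^sup>T * H) = (G * (G * Y\<^sup>T)) * H" by (rule assoc_mult_mat[OF G(1) GYT H(1), symmetric])
    also have "G * (G * Y\<^sup>T) = (G * G) * Y\<^sup>T" by (rule assoc_mult_mat[OF G(1) G(1) YT, symmetric])
    also have "\<dots> = Y\<^sup>T" unfolding G(3) by (rule left_mult_one_mat[OF YT])
    also have "H * Y * (Y\<^sup>T * H) = H * Y * Y\<^sup>T * H" by (rule assoc_mult_mat[OF HY YT H(1), symmetric])
    also have "H * Y * Y\<^sup>T = H * (Y * Y\<^sup>T)" by (rule assoc_mult_mat[OF H(1) Y YT])
    finally show ?thesis unfolding reflect_transpose[OF Y] .
  qed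
  then have "similar_mat (H * Y * G * (H * Y * G)\<^sup>T) (Y * Y\<^sup>T)"
    unfolding similar_mat_def similar_mat_wit_def Let_def
    by (intro exI[of _ H]) (use H YY reflect_carrier[OF Y] in \<open>auto intro: mult_carrier_mat\<close>)
  then have "sing_vals (H * Y * G) = sing_vals Y" unfolding sing_vals_def by (simp add: char_poly_similar)
  then have sv: "sing_val (H * Y * G) k = sing_val Y k" unfolding sing_val_def by simp
  show ?thesis
    unfolding is_left_sing_vec_def sv
  proof (intro conjI bexI[of _ "G *\<^sub>v v"])
    show "H *\<^sub>v w \<in> carrier_vec (dim_row (H * Y * G))" using H(1) wc(1) by auto
    show "vnorm (H *\<^sub>v w) = 1" using H_isometry[OF wc(1)] wc(2) by (simp add: vnorm_eq_1_iff)
    show "vnorm (G *\<^sub>v v) = 1" using G_isometry[OF v(1)] v(2) by (simp add: vnorm_eq_1_iff)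
    have "H * Y * G *\<^sub>v (G *\<^sub>v v) = H * Y *\<^sub>v (G *\<^sub>v (G *\<^sub>v v))" by (rule assoc_mult_mat_vec[OF HY G(1) Gv])
    also have "\<dots> = H *\<^sub>v (Y *\<^sub>v v)" unfolding GGv by (rule assoc_mult_mat_vec[OF H(1) Y v(1)])
    also have "\<dots> = sing_val Y k \<cdot>\<^sub>v (H *\<^sub>v w)" unfolding v(3) by (rule mult_mat_vec[OF H(1) wc(1)])
    finally show "H * Y * G *\<^sub>v (G *\<^sub>v v) = sing_val Y k \<cdot>\<^sub>v (H *\<^sub>v w)" .
    show "(H * Y * G)\<^sup>T *\<^sub>v (H *\<^sub>v w) = sing_val Y k \<cdot>\<^sub>v (G *\<^sub>v v)"
      unfolding reflect_transpose_mult_vec[OF Y mult_mat_vec_carrier[OF H(1) wc(1)]] HHw v(4)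
      by (rule mult_mat_vec[OF G(1) v(1)])
    show "G *\<^sub>v v \<in> carrier_vec (dim_col (H * Y * G))" using G(1) Gv by simp
  qed
qed

text \<open>\<open>H\<close> acts isometrically on the columns and \<open>G\<close> on the rows, so
  the sum of squares is arranged by columns for one and by rows for the other.\<close>

lemma frobenius_reflect:
  assumes X: "X \<in> carrier_mat d n"
  shows "(\<Sum>i<d. \<Sum>j<n. ((H * X * G) $$ (i, j))\<^sup>2) = (\<Sum>i<d. \<Sum>j<n. (X $$ (i, j))\<^sup>2)"
proof -
  have HX: "H * X \<in> carrier_mat d n" using H(1) X by auto
  have cols: "(\<Sum>i<d. \<Sum>j<n. (A $$ (i, j))\<^sup>2) = (\<Sum>j<n. col A j \<bullet> col A j)" if A: "A \<in> carrier_mat d n" for A :: "real mat"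
  proof -
    have "(\<Sum>i<d. \<Sum>j<n. (A $$ (i, j))\<^sup>2) = (\<Sum>j<n. \<Sum>i<d. (A $$ (i, j))\<^sup>2)" by (rule sum.swap)
    also have "\<dots> = (\<Sum>j<n. col A j \<bullet> col A j)"
      using A by (intro sum.cong refl) (auto simp: scalar_prod_def power2_eq_square lessThan_atLeast0)
    finally show ?thesis .
  qed
  have rows: "(\<Sum>i<d. \<Sum>j<n. (A $$ (i, j))\<^sup>2) = (\<Sum>i<d. row A i \<bullet> row A i)" if A: "A \<in> carrier_mat d n" for A :: "real mat"
    using A by (intro sum.cong refl) (auto simp: scalar_prod_def power2_eq_square lessThan_atLeast0)
  have "row (H * X * G) i = G *\<^sub>v row (H * X) i" if i: "i < d" for i
  proof (rule eq_vecI)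
    fix j assume "j < dim_vec (G *\<^sub>v row (H * X) i)"
    then have j: "j < n" using G(1) by simp
    have "col G j = row G j"
      using G(2) j G(1) by (metis carrier_matD(1) carrier_matD(2) row_transpose)
    moreover have "row (H * X) i \<in> carrier_vec n" using HX i by auto
    ultimately show "row (H * X * G) i $ j = (G *\<^sub>v row (H * X) i) $ j"
      using i j G(1) HX by (simp add: comm_scalar_prod[of _ n])
  qed (use G(1) in simp)
  then have "(\<Sum>i<d. row (H * X * G) i \<bullet> row (H * X * G) i) = (\<Sum>i<d. row (H * X) i \<bullet> row (H * X) i)"
    using HX by (intro sum.cong refl) (auto intro!: G_isometry)
  then have "(\<Sum>i<d. \<Sum>j<n. ((H * X * G) $$ (i, j))\<^sup>2) = (\<Sum>i<d. \<Sum>j<n. ((H * X) $$ (i, j))\<^sup>2)"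
    unfolding rows[OF HX] rows[OF reflect_carrier[OF X]] .
  also have "\<dots> = (\<Sum>j<n. col (H * X) j \<bullet> col (H * X) j)" by (rule cols[OF HX])
  also have "\<dots> = (\<Sum>j<n. col X j \<bullet> col X j)"
  proof (intro sum.cong refl)
    fix j assume "j \<in> {..<n}"
    then have "col (H * X) j = H *\<^sub>v col X j" using X H(1) by (intro col_mult2) auto
    then show "col (H * X) j \<bullet> col (H * X) j = col X j \<bullet> col X j" using X by (auto intro!: H_isometry)
  qed
  also have "\<dots> = (\<Sum>i<d. \<Sum>j<n. (X $$ (i, j))\<^sup>2)" by (rule cols[OF X, symmetric])
  finally show ?thesis .
qed

end

section \<open>Gaussian tensors\<close>

context
  fixes d1 d2 d3 :: nat
begin

text \<open>The inverse of unfolding. The restriction makes the result extensional, hence a point of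
  the product space that carries the Gaussian law.\<close>

definition refold1 :: "real mat \<Rightarrow> tensor" where
  "refold1 X = (\<lambda>p\<in>tensor_index d1 d2 d3. case p of (i, j, l) \<Rightarrow> X $$ (i, j * d3 + l))"

lemma finite_tensor_index: "finite (tensor_index d1 d2 d3)"
  by (simp add: tensor_index_def)

lemma unfold1_carrier: "unfold1 d1 d2 d3 Z \<in> carrier_mat d1 (d2 * d3)"
  by (simp add: unfold1_def)

lemma tensor_index_of_column:
  assumes "i < d1" "j < d2 * d3" shows "(i, j div d3, j mod d3) \<in> tensor_index d1 d2 d3"
proof -
  have "0 < d3" using assms(2) by (cases d3) auto
  then show ?thesis using assms by (simp add: tensor_index_def less_mult_imp_div_less)
qed

lemma column_of_tensor_index:
  assumes "(i, j, l) \<in> tensor_index d1 d2 d3" shows "i < d1" "j * d3 + l < d2 * d3"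
proof -
  have jl: "j < d2" "l < d3" and i: "i < d1" using assms by (auto simp: tensor_index_def)
  show "i < d1" by (rule i)
  have "j * d3 + l < Suc j * d3" using jl by simp
  also have "\<dots> \<le> d2 * d3" using jl by (intro mult_le_mono1) simp
  finally show "j * d3 + l < d2 * d3" .
qed

lemma unfold1_refold1:
  assumes X: "X \<in> carrier_mat d1 (d2 * d3)" shows "unfold1 d1 d2 d3 (refold1 X) = X"
proof (rule eq_matI)
  fix i j assume "i < dim_row X" "j < dim_col X"
  then have ij: "i < d1" "j < d2 * d3" using X by auto
  then show "unfold1 d1 d2 d3 (refold1 X) $$ (i, j) = X $$ (i, j)"
    using tensor_index_of_column[OF ij] by (simp add: unfold1_def refold1_def div_mult_mod_eq)
qed (use X in \<open>auto simp: unfold1_def\<close>)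

lemma refold1_unfold1:
  assumes "Z \<in> extensional (tensor_index d1 d2 d3)" shows "refold1 (unfold1 d1 d2 d3 Z) = Z"
proof
  fix p :: "nat \<times> nat \<times> nat"
  obtain i j l where p: "p = (i, j, l)" by (cases p)
  show "refold1 (unfold1 d1 d2 d3 Z) p = Z p"
  proof (cases "p \<in> tensor_index d1 d2 d3")
    case True
    then have "i < d1" "j < d2" "l < d3" by (auto simp: p tensor_index_def)
    then show ?thesis using True unfold1_index[of i d1 j d2 l d3 Z] by (simp add: refold1_def p)
  next
    case False
    then show ?thesis using extensional_arb[OF assms False] by (simp add: refold1_def)
  qed
qed

lemma sum_tensor_index:
  "(\<Sum>p\<in>tensor_index d1 d2 d3. f p) = (\<Sum>i<d1. \<Sum>j<d2 * d3. f (i, j div d3, j mod d3))"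
proof -
  have "(\<Sum>p\<in>tensor_index d1 d2 d3. f p) = (\<Sum>(i, j)\<in>{..<d1} \<times> {..<d2 * d3}. f (i, j div d3, j mod d3))"
  proof (rule sum.reindex_bij_witness[where i = "\<lambda>(i, j). (i, j div d3, j mod d3)" and j = "\<lambda>(i, j, l). (i, j * d3 + l)"])
    fix p assume p: "p \<in> tensor_index d1 d2 d3"
    obtain i j l where ijl: "p = (i, j, l)" by (cases p)
    have l: "l < d3" using p by (simp add: ijl tensor_index_def)
    then have dm: "(j * d3 + l) div d3 = j" "(j * d3 + l) mod d3 = l" by simp_all
    show "(case case p of (i, j, l) \<Rightarrow> (i, j * d3 + l) of (i, j) \<Rightarrow> (i, j div d3, j mod d3)) = p"
      "(case case p of (i, j, l) \<Rightarrow> (i, j * d3 + l) of (i, j) \<Rightarrow> f (i, j div d3, j mod d3)) = f p"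
      unfolding ijl prod.case dm by (rule refl)+
    show "(case p of (i, j, l) \<Rightarrow> (i, j * d3 + l)) \<in> {..<d1} \<times> {..<d2 * d3}"
      using column_of_tensor_index[OF p[unfolded ijl]] unfolding ijl by simp
  next
    fix q assume q: "q \<in> {..<d1} \<times> {..<d2 * d3}"
    obtain i j where ij: "q = (i, j)" by (cases q)
    show "(case case q of (i, j) \<Rightarrow> (i, j div d3, j mod d3) of (i, j, l) \<Rightarrow> (i, j * d3 + l)) = q"
      unfolding ij prod.case div_mult_mod_eq by (rule refl)
    show "(case q of (i, j) \<Rightarrow> (i, j div d3, j mod d3)) \<in> tensor_index d1 d2 d3"
      using q tensor_index_of_column[of i j] unfolding ij by simp
  qed
  then show ?thesis by (simp add: sum.cartesian_product)
qed

lemma unfold1_entry: "i < d1 \<Longrightarrow> j < d2 * d3 \<Longrightarrow> unfold1 d1 d2 d3 Z $$ (i, j) = Z (i, j div d3, j mod d3)"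
  by (simp add: unfold1_def)

lemma unfold1_add: "unfold1 d1 d2 d3 (\<lambda>i. A i + Z i) = unfold1 d1 d2 d3 A + unfold1 d1 d2 d3 Z"
  by (intro eq_matI) (auto simp: unfold1_def)

text \<open>The entries of H Z G are linear in those of Z, which gives measurability and additivity;
  together with involutivity and preservation of the Frobenius norm these are the conditions for
  invariance of the Gaussian law.\<close>

lemma gaussian_tensor_reflect:
  assumes \<sigma>: "0 < \<sigma>"
    and H: "H \<in> carrier_mat d1 d1" "H\<^sup>T = H" "H * H = 1\<^sub>m d1"
    and G: "G \<in> carrier_mat (d2 * d3) (d2 * d3)" "G\<^sup>T = G" "G * G = 1\<^sub>m (d2 * d3)"
  defines "T \<equiv> \<lambda>Z. refold1 (H * unfold1 d1 d2 d3 Z * G)"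
  shows "T \<in> measurable (gaussian_tensor d1 d2 d3 \<sigma>) (gaussian_tensor d1 d2 d3 \<sigma>)"
    and "distr (gaussian_tensor d1 d2 d3 \<sigma>) (gaussian_tensor d1 d2 d3 \<sigma>) T = gaussian_tensor d1 d2 d3 \<sigma>"
    and "\<And>Z. unfold1 d1 d2 d3 (T Z) = H * unfold1 d1 d2 d3 Z * G"
proof -
  let ?I = "tensor_index d1 d2 d3" and ?n = "d2 * d3" and ?U = "unfold1 d1 d2 d3"
  let ?L = "Pi\<^sub>M ?I (\<lambda>_. lborel :: real measure)"
  note rc = reflect_carrier[OF H G unfold1_carrier]
  have Tapp: "T Z = refold1 (H * ?U Z * G)" for Z unfolding T_def ..
  show UT: "?U (T Z) = H * ?U Z * G" for Z unfolding T_def by (rule unfold1_refold1[OF rc])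
  have entry: "(H * ?U Z * G) $$ (i, j) = (\<Sum>b<?n. (\<Sum>a<d1. H $$ (i, a) * Z (a, b div d3, b mod d3)) * G $$ (b, j))"
    if "i < d1" "j < ?n" for i j Z
  proof -
    have HU: "H * ?U Z \<in> carrier_mat d1 ?n" using H(1) unfold1_carrier by (rule mult_carrier_mat)
    have "(H * ?U Z * G) $$ (i, j) = (\<Sum>b<?n. (H * ?U Z) $$ (i, b) * G $$ (b, j))"
      using that HU G(1) by (subst index_mult_mat) (auto simp: scalar_prod_def lessThan_atLeast0 simp del: index_mult_mat)
    also have "\<dots> = (\<Sum>b<?n. (\<Sum>a<d1. H $$ (i, a) * Z (a, b div d3, b mod d3)) * G $$ (b, j))"
    proof (intro sum.cong refl arg_cong2[of _ _ _ _ "(*)"])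
      fix b assume "b \<in> {..<?n}"
      then show "(H * ?U Z) $$ (i, b) = (\<Sum>a<d1. H $$ (i, a) * Z (a, b div d3, b mod d3))"
        using that H(1) carrier_matD[OF unfold1_carrier[of Z]]
        by (subst index_mult_mat) (auto simp: scalar_prod_def lessThan_atLeast0 unfold1_entry)
    qed
    finally show ?thesis .
  qed
  have TL: "T \<in> measurable ?L ?L"
    unfolding T_def refold1_def
  proof (rule measurable_restrict)
    fix p assume p: "p \<in> ?I"
    obtain i j l where ijl: "p = (i, j, l)" by (cases p)
    have ij: "i < d1" "j * d3 + l < ?n" using column_of_tensor_index[OF p[unfolded ijl]] by auto
    have "(\<lambda>Z. (\<Sum>b<?n. (\<Sum>a<d1. H $$ (i, a) * Z (a, b div d3, b mod d3)) * G $$ (b, j * d3 + l))) \<in> borel_measurable ?L"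
    proof (intro borel_measurable_sum borel_measurable_times borel_measurable_const)
      fix b a assume "b \<in> {..<?n}" "a \<in> {..<d1}"
      then have "(a, b div d3, b mod d3) \<in> ?I" by (intro tensor_index_of_column) auto
      from measurable_component_singleton[OF this, of "\<lambda>_. lborel :: real measure"]
      show "(\<lambda>Z. Z (a, b div d3, b mod d3)) \<in> borel_measurable ?L" by simp
    qed
    then show "(\<lambda>x. case p of (i, j, l) \<Rightarrow> (H * ?U x * G) $$ (i, j * d3 + l)) \<in> measurable ?L lborel"
      unfolding ijl prod.case entry[OF ij] measurable_lborel1 by simp
  qed
  have PN: "gaussian_tensor d1 d2 d3 \<sigma> = Pi\<^sub>M ?I (\<lambda>_. normal_measure \<sigma>)" by (simp add: gaussian_tensor_def)
  have sL: "sets (gaussian_tensor d1 d2 d3 \<sigma>) = sets ?L" unfolding PN by (intro sets_PiM_cong) auto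
  show "T \<in> measurable (gaussian_tensor d1 d2 d3 \<sigma>) (gaussian_tensor d1 d2 d3 \<sigma>)"
    using TL unfolding measurable_cong_sets[OF sL sL] .
  have Text: "T Z \<in> extensional ?I" for Z unfolding T_def refold1_def by simp
  show "distr (gaussian_tensor d1 d2 d3 \<sigma>) (gaussian_tensor d1 d2 d3 \<sigma>) T = gaussian_tensor d1 d2 d3 \<sigma>"
    unfolding PN
  proof (rule PiM_normal_involutive_isometry[OF \<sigma> finite_tensor_index TL])
    fix x y :: tensor assume xy: "x \<in> extensional ?I" "y \<in> extensional ?I"
    show "T (\<lambda>i\<in>?I. x i + y i) = (\<lambda>i\<in>?I. T x i + T y i)"
    proof (rule ext)
      fix p :: "nat \<times> nat \<times> nat"
      obtain i j l where ijl: "p = (i, j, l)" by (cases p)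
      show "T (\<lambda>i\<in>?I. x i + y i) p = (\<lambda>i\<in>?I. T x i + T y i) p"
      proof (cases "p \<in> ?I")
        case True
        have ij: "i < d1" "j * d3 + l < ?n" using column_of_tensor_index[OF True[unfolded ijl]] by auto
        have inner: "(\<Sum>a<d1. H $$ (i, a) * (\<lambda>i\<in>?I. x i + y i) (a, b div d3, b mod d3))
          = (\<Sum>a<d1. H $$ (i, a) * x (a, b div d3, b mod d3)) + (\<Sum>a<d1. H $$ (i, a) * y (a, b div d3, b mod d3))"
          if b: "b < ?n" for b
        proof -
          have eq: "H $$ (i, a) * (\<lambda>i\<in>?I. x i + y i) (a, b div d3, b mod d3)
            = H $$ (i, a) * x (a, b div d3, b mod d3) + H $$ (i, a) * y (a, b div d3, b mod d3)" if "a < d1" for a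
            unfolding restrict_apply'[OF tensor_index_of_column[OF that b]] by (rule distrib_left)
          show ?thesis unfolding sum.distrib[symmetric] by (rule sum.cong[OF refl], rule eq, simp)
        qed
        have "(H * ?U (\<lambda>i\<in>?I. x i + y i) * G) $$ (i, j * d3 + l)
          = (\<Sum>b<?n. ((\<Sum>a<d1. H $$ (i, a) * x (a, b div d3, b mod d3)) + (\<Sum>a<d1. H $$ (i, a) * y (a, b div d3, b mod d3)))
              * G $$ (b, j * d3 + l))"
          unfolding entry[OF ij]
        proof (rule sum.cong[OF refl])
          fix b assume "b \<in> {..<?n}"
          then have "b < ?n" by simp
          from inner[OF this] show "(\<Sum>a<d1. H $$ (i, a) * (\<lambda>i\<in>?I. x i + y i) (a, b div d3, b mod d3)) * G $$ (b, j * d3 + l)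
            = ((\<Sum>a<d1. H $$ (i, a) * x (a, b div d3, b mod d3)) + (\<Sum>a<d1. H $$ (i, a) * y (a, b div d3, b mod d3)))
              * G $$ (b, j * d3 + l)" by (simp only:)
        qed
        also have "\<dots> = (H * ?U x * G) $$ (i, j * d3 + l) + (H * ?U y * G) $$ (i, j * d3 + l)"
          unfolding entry[OF ij] distrib_right sum.distrib ..
        finally have "(H * ?U (\<lambda>i\<in>?I. x i + y i) * G) $$ (i, j * d3 + l)
          = (H * ?U x * G) $$ (i, j * d3 + l) + (H * ?U y * G) $$ (i, j * d3 + l)" .
        then show ?thesis using True unfolding ijl Tapp refold1_def by (simp only: restrict_apply' prod.case)
      qed (simp add: Tapp refold1_def)
    qed
  next
    fix x :: tensor assume x: "x \<in> extensional ?I"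
    show "T (T x) = x"
      unfolding Tapp[of "T x"] UT reflect_involutive[OF H G unfold1_carrier] by (rule refold1_unfold1[OF x])
    have fr: "(\<Sum>p\<in>?I. (z p)\<^sup>2) = (\<Sum>i<d1. \<Sum>j<?n. (?U z $$ (i, j))\<^sup>2)" for z :: tensor
      unfolding sum_tensor_index by (intro sum.cong refl) (simp add: unfold1_entry)
    show "(\<Sum>p\<in>?I. (T x p)\<^sup>2) = (\<Sum>p\<in>?I. (x p)\<^sup>2)"
      unfolding fr UT by (rule frobenius_reflect[OF H G unfold1_carrier])
  qed
qed

end


section \<open>The Gram matrix of the noisy unfolding\<close>

context
  fixes d1 d2 d3 :: nat and \<sigma> :: real and M :: "real mat"
  assumes \<sigma>: "0 < \<sigma>" and d1: "0 < d1" and M: "M \<in> carrier_mat d1 (d2 * d3)"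
begin

abbreviation (input) "noise Z \<equiv> unfold1 d1 d2 d3 Z"

text \<open>The quantity that \<open>close_gram\<close> bounds at the vector \<open>w\<close>, for c
  = d2 d3 sigma^2.\<close>

definition gram_error :: "real vec \<Rightarrow> tensor \<Rightarrow> real" where
  "gram_error w Z = ((M + noise Z)\<^sup>T *\<^sub>v w) \<bullet> ((M + noise Z)\<^sup>T *\<^sub>v w) - (M\<^sup>T *\<^sub>v w) \<bullet> (M\<^sup>T *\<^sub>v w)
    - real (d2 * d3) * \<sigma>\<^sup>2 * (w \<bullet> w)"

lemma gram_error_eq:
  assumes w: "w \<in> carrier_vec d1"
  shows "gram_error w Z = 2 * ((M\<^sup>T *\<^sub>v w) \<bullet> ((noise Z)\<^sup>T *\<^sub>v w)) + ((noise Z)\<^sup>T *\<^sub>v w) \<bullet> ((noise Z)\<^sup>T *\<^sub>v w)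
    - real (d2 * d3) * \<sigma>\<^sup>2 * (w \<bullet> w)"
proof -
  let ?n = "d2 * d3"
  define m where "m = M\<^sup>T *\<^sub>v w"
  define y where "y = (noise Z)\<^sup>T *\<^sub>v w"
  have NT: "(noise Z)\<^sup>T \<in> carrier_mat ?n d1" using unfold1_carrier by simp
  have MT: "M\<^sup>T \<in> carrier_mat ?n d1" using M by simp
  have my: "m \<in> carrier_vec ?n" "y \<in> carrier_vec ?n"
    unfolding m_def y_def using mult_mat_vec_carrier[OF MT w] mult_mat_vec_carrier[OF NT w] by auto
  have "(M + noise Z)\<^sup>T = M\<^sup>T + (noise Z)\<^sup>T" by (rule transpose_add[OF M unfold1_carrier])
  then have eq: "(M + noise Z)\<^sup>T *\<^sub>v w = m + y"
    unfolding m_def y_def using add_mult_distrib_mat_vec[OF MT NT w] by simp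
  show ?thesis
    unfolding gram_error_def eq m_def[symmetric] y_def[symmetric] using my
    by (simp add: add_scalar_prod_distrib[of _ ?n] scalar_prod_add_distrib[of _ ?n] comm_scalar_prod[of y ?n m])
qed

lemma measurable_noise_coord:
  assumes w: "w \<in> carrier_vec d1" and j: "j < d2 * d3"
  shows "(\<lambda>Z. ((noise Z)\<^sup>T *\<^sub>v w) $ j) \<in> borel_measurable (gaussian_tensor d1 d2 d3 \<sigma>)"
proof -
  have eq: "((noise Z)\<^sup>T *\<^sub>v w) $ j = (\<Sum>i<d1. Z (i, j div d3, j mod d3) * w $ i)" for Z
    using w j carrier_matD[OF unfold1_carrier[of d1 d2 d3 Z]]
    by (simp add: scalar_prod_def lessThan_atLeast0 unfold1_entry)
  show ?thesis
    unfolding eq gaussian_tensor_def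
    by (intro borel_measurable_sum borel_measurable_times borel_measurable_const measurable_component_normal
        tensor_index_of_column) (use j in auto)
qed

lemma measurable_gram_error:
  assumes w: "w \<in> carrier_vec d1"
  shows "gram_error w \<in> borel_measurable (gaussian_tensor d1 d2 d3 \<sigma>)"
proof -
  have dims: "dim_vec ((noise Z)\<^sup>T *\<^sub>v w) = d2 * d3" for Z
    using carrier_matD[OF unfold1_carrier[of d1 d2 d3 Z]] by simp
  have "gram_error w = (\<lambda>Z. 2 * (\<Sum>j\<in>{0..<d2 * d3}. (M\<^sup>T *\<^sub>v w) $ j * ((noise Z)\<^sup>T *\<^sub>v w) $ j)
      + (\<Sum>j\<in>{0..<d2 * d3}. ((noise Z)\<^sup>T *\<^sub>v w) $ j * ((noise Z)\<^sup>T *\<^sub>v w) $ j) - real (d2 * d3) * \<sigma>\<^sup>2 * (w \<bullet> w))"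
    unfolding gram_error_eq[OF w] by (rule ext) (simp only: scalar_prod_def dims gram_error_eq[OF w])
  also have "\<dots> \<in> borel_measurable (gaussian_tensor d1 d2 d3 \<sigma>)"
    by (intro borel_measurable_diff borel_measurable_add borel_measurable_times borel_measurable_const
        borel_measurable_sum measurable_noise_coord[OF w]) auto
  finally show ?thesis .
qed

text \<open>Only the noise is rotated, by a reflection taking \<open>w\<close> to a multiple of the
  first basis vector, with the identity on the right. By invariance of its law the error is then
  distributed as an expression in the slice of \<open>Z\<close> with first index 0: a linear form
  with coefficients M^T w plus a centred sum of d2 d3 squares.\<close>

lemma gram_error_tail:
  assumes w: "w \<in> carrier_vec d1" "vnorm w \<le> 1" and A: "0 < A" "op_norm M \<le> A" and L: "0 < L"
  shows "measure (gaussian_tensor d1 d2 d3 \<sigma>) {Z \<in> space (gaussian_tensor d1 d2 d3 \<sigma>).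
      3 * \<sigma> * A * sqrt L + 5 * \<sigma>\<^sup>2 * (sqrt (real (d2 * d3) * L) + L) < \<bar>gram_error w Z\<bar>} \<le> 4 * exp (- L)"
    (is "measure ?P {Z \<in> space ?P. ?\<tau> < _} \<le> _")
proof -
  let ?n = "d2 * d3" and ?I = "tensor_index d1 d2 d3"
  define \<rho> where "\<rho> = vnorm w"
  define e where "e = (unit_vec d1 0 :: real vec)"
  define H where "H = householder d1 (w - \<rho> \<cdot>\<^sub>v e)"
  define T where "T = (\<lambda>Z. refold1 d1 d2 d3 (H * noise Z * 1\<^sub>m ?n))"
  have e: "e \<in> carrier_vec d1" "e \<bullet> e = 1" unfolding e_def using d1 by auto
  have H: "H \<in> carrier_mat d1 d1" "H\<^sup>T = H" "H * H = 1\<^sub>m d1" unfolding H_def using w e by auto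
  have Hw: "H *\<^sub>v w = \<rho> \<cdot>\<^sub>v e"
    unfolding H_def using w e by (intro householder_maps) (auto simp: \<rho>_def vnorm_power2[symmetric] power2_eq_square)
  have one: "1\<^sub>m ?n \<in> carrier_mat ?n ?n" "(1\<^sub>m ?n)\<^sup>T = 1\<^sub>m ?n" "1\<^sub>m ?n * 1\<^sub>m ?n = (1\<^sub>m ?n :: real mat)" by auto
  note pres = gaussian_tensor_reflect(1,2)[OF \<sigma> H one, folded T_def]
  have noise_T: "noise (T Z) = H * noise Z * 1\<^sub>m ?n" for Z
    unfolding T_def by (rule gaussian_tensor_reflect(3)[OF \<sigma> H one])
  define J where "J = {p \<in> ?I. fst p = 0}"
  define a :: "nat \<times> nat \<times> nat \<Rightarrow> real" where "a = (\<lambda>p. (M\<^sup>T *\<^sub>v w) $ (case p of (i, j, l) \<Rightarrow> j * d3 + l))"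
  have sumJ: "(\<Sum>p\<in>J. f p) = (\<Sum>j<?n. f (0, j div d3, j mod d3))" for f :: "nat \<times> nat \<times> nat \<Rightarrow> real"
  proof -
    have "(\<Sum>p\<in>J. f p) = (\<Sum>p\<in>?I. if fst p = 0 then f p else 0)"
      unfolding J_def by (rule sum.inter_filter[OF finite_tensor_index])
    also have "\<dots> = (\<Sum>i<d1. if i = 0 then (\<Sum>j<?n. f (0, j div d3, j mod d3)) else 0)"
      unfolding sum_tensor_index by (intro sum.cong refl) auto
    also have "\<dots> = (\<Sum>j<?n. f (0, j div d3, j mod d3))" using d1 by simp
    finally show ?thesis .
  qed
  have a_col: "a (0, j div d3, j mod d3) = (M\<^sup>T *\<^sub>v w) $ j" for j
    unfolding a_def by simp
  have card: "real (card J) = real ?n" using sumJ[of "\<lambda>_. 1"] by simp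
  have MT: "M\<^sup>T \<in> carrier_mat ?n d1" using M by simp
  have Mw: "M\<^sup>T *\<^sub>v w \<in> carrier_vec ?n" by (rule mult_mat_vec_carrier[OF MT w(1)])
  have sub: "J \<subseteq> ?I" unfolding J_def by auto
  have sa: "(\<Sum>p\<in>J. (a p)\<^sup>2) \<le> A\<^sup>2"
  proof -
    have "vnorm (M\<^sup>T *\<^sub>v w) \<le> op_norm M * vnorm w" by (rule op_norm_transpose_bound[OF M w(1)])
    also have "\<dots> \<le> A * 1" using w A op_norm_nonneg[OF M] by (intro mult_mono) auto
    finally have "(vnorm (M\<^sup>T *\<^sub>v w))\<^sup>2 \<le> A\<^sup>2" by (intro power_mono) auto
    then show ?thesis unfolding sumJ a_col sum_power2_eq_scalar_prod[OF Mw] vnorm_power2 .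
  qed
  have err: "gram_error w (T Z) = 2 * \<rho> * (\<Sum>p\<in>J. a p * Z p) + \<rho>\<^sup>2 * ((\<Sum>p\<in>J. (Z p)\<^sup>2) - real (card J) * \<sigma>\<^sup>2)" for Z
  proof -
    have NT: "(noise Z)\<^sup>T \<in> carrier_mat ?n d1" using unfold1_carrier by simp
    define y where "y = (noise Z)\<^sup>T *\<^sub>v e"
    have y: "y \<in> carrier_vec ?n" unfolding y_def by (rule mult_mat_vec_carrier[OF NT e(1)])
    have yj: "y $ j = Z (0, j div d3, j mod d3)" if "j < ?n" for j
      unfolding y_def e_def using that d1 carrier_matD[OF unfold1_carrier[of d1 d2 d3 Z]]
      by (simp add: scalar_prod_right_unit unfold1_entry)
    have "(noise (T Z))\<^sup>T *\<^sub>v w = 1\<^sub>m ?n *\<^sub>v ((noise Z)\<^sup>T *\<^sub>v (\<rho> \<cdot>\<^sub>v e))"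
      unfolding noise_T reflect_transpose_mult_vec[OF H one unfold1_carrier w(1)] Hw ..
    also have "\<dots> = \<rho> \<cdot>\<^sub>v y" unfolding mult_mat_vec[OF NT e(1)] y_def[symmetric] using y by simp
    finally have Nw: "(noise (T Z))\<^sup>T *\<^sub>v w = \<rho> \<cdot>\<^sub>v y" .
    have "(M\<^sup>T *\<^sub>v w) \<bullet> y = (\<Sum>p\<in>J. a p * Z p)"
      unfolding sumJ a_col scalar_prod_def carrier_vecD[OF y] lessThan_atLeast0
    proof (rule sum.cong[OF refl])
      fix j assume "j \<in> {0..<?n}"
      then have "j < ?n" by (simp only: atLeastLessThan_iff)
      from yj[OF this] show "(M\<^sup>T *\<^sub>v w) $ j * y $ j = (M\<^sup>T *\<^sub>v w) $ j * Z (0, j div d3, j mod d3)" by (simp only:)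
    qed
    moreover have "y \<bullet> y = (\<Sum>p\<in>J. (Z p)\<^sup>2)"
      unfolding sumJ sum_power2_eq_scalar_prod[OF y, symmetric] by (intro sum.cong refl) (simp add: yj)
    moreover have "w \<bullet> w = \<rho>\<^sup>2" unfolding \<rho>_def vnorm_power2 ..
    ultimately show ?thesis
      unfolding gram_error_eq[OF w(1)] Nw using Mw y
      by (simp add: scalar_prod_smult_distrib[of _ ?n] smult_scalar_prod_distrib[of _ ?n] card power2_eq_square algebra_simps)
  qed
  have PN: "?P = Pi\<^sub>M ?I (\<lambda>_. normal_measure \<sigma>)" by (simp add: gaussian_tensor_def)
  let ?E = "{Z \<in> space ?P. ?\<tau> < \<bar>gram_error w Z\<bar>}"
  have [measurable]: "gram_error w \<in> borel_measurable ?P" by (rule measurable_gram_error[OF w(1)])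
  have E: "?E \<in> sets ?P" by measurable
  have "measure ?P ?E = measure (distr ?P ?P T) ?E" unfolding pres(2) ..
  also have "\<dots> = measure ?P (T -` ?E \<inter> space ?P)" by (rule measure_distr[OF pres(1) E])
  also have "T -` ?E \<inter> space ?P = {Z \<in> space ?P. ?\<tau> < \<bar>gram_error w (T Z)\<bar>}"
    using measurable_space[OF pres(1)] by auto
  also have "measure ?P \<dots> \<le> 4 * exp (- L)"
    unfolding err PN card[symmetric] using w
    by (intro PiM_normal_quadratic_tail[OF \<sigma> finite_tensor_index sub A(1) sa]) (auto simp: \<rho>_def L)
  finally show ?thesis .
qed

text \<open>A union bound over the net; the outer factor 2 is the passage from net to ball. The
  event is cut out by the finitely many net vectors, which makes it measurable, whereas closeness
  quantifies over all vectors.\<close>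

lemma gaussian_close_gram:
  assumes A: "0 < A" "op_norm M \<le> A"
  obtains E where "E \<in> sets (gaussian_tensor d1 d2 d3 \<sigma>)"
    "measure (gaussian_tensor d1 d2 d3 \<sigma>) (space (gaussian_tensor d1 d2 d3 \<sigma>) - E) \<le> 4 * exp (- 4 * real d1)"
    "\<And>Z. Z \<in> E \<Longrightarrow> close_gram M (real (d2 * d3) * \<sigma>\<^sup>2)
      (2 * (3 * \<sigma> * A * sqrt (10 * real d1) + 5 * \<sigma>\<^sup>2 * (sqrt (real (d2 * d3) * (10 * real d1)) + 10 * real d1))) (M + noise Z)"
proof -
  let ?P = "gaussian_tensor d1 d2 d3 \<sigma>" and ?n = "d2 * d3"
  define L where "L = 10 * real d1" \<comment> \<open>beats the size of the net, since \<open>48 \<le> exp 6\<close>\<close>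
  have L: "0 < L" unfolding L_def using d1 by simp
  define \<tau> where "\<tau> = 3 * \<sigma> * A * sqrt L + 5 * \<sigma>\<^sup>2 * (sqrt (real ?n * L) + L)"
  obtain W where W: "finite W" "real (card W) \<le> 48 ^ d1" "\<And>w. w \<in> W \<Longrightarrow> w \<in> carrier_vec d1 \<and> vnorm w \<le> 1"
    and net: "\<And>x. x \<in> carrier_vec d1 \<Longrightarrow> vnorm x \<le> 1 \<Longrightarrow> \<exists>w\<in>W. vnorm (x - w) \<le> 1 / 4"
    by (rule unit_ball_net[OF d1]) blast
  define B where "B w = {Z \<in> space ?P. \<tau> < \<bar>gram_error w Z\<bar>}" for w
  have B: "B w \<in> sets ?P" if "w \<in> W" for w
  proof -
    have [measurable]: "gram_error w \<in> borel_measurable ?P" using W(3)[OF that] by (intro measurable_gram_error) auto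
    show ?thesis unfolding B_def by measurable
  qed
  define E where "E = space ?P - (\<Union>w\<in>W. B w)"
  have UB: "(\<Union>w\<in>W. B w) \<in> sets ?P" using W(1) B by auto
  have "space ?P - E = (\<Union>w\<in>W. B w)" unfolding E_def using sets.sets_into_space[OF UB] by auto
  then have "measure ?P (space ?P - E) \<le> (\<Sum>w\<in>W. measure ?P (B w))"
    using measure_UNION_le[OF W(1) B] by simp
  also have "\<dots> \<le> (\<Sum>w\<in>W. 4 * exp (- L))"
    unfolding B_def \<tau>_def using W(3) A L by (intro sum_mono gram_error_tail) auto
  also have "\<dots> = real (card W) * (4 * exp (- L))" by simp
  also have "\<dots> \<le> exp (6 * real d1) * (4 * exp (- L))"
  proof (rule mult_right_mono)
    have "(2 :: real) \<le> exp 1" using exp_ge_add_one_self[of 1] by simp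
    then have "(2 :: real) ^ 6 \<le> exp 1 ^ 6" by (rule power_mono) simp
    then have "(48 :: real) \<le> exp 1 ^ 6" by simp
    then have "(48 :: real) \<le> exp 6" by (simp add: exp_of_nat_mult[symmetric])
    then have "(48 :: real) ^ d1 \<le> exp 6 ^ d1" by (rule power_mono) simp
    also have "\<dots> = exp (6 * real d1)" by (simp add: exp_of_nat_mult[symmetric] mult.commute)
    finally show "real (card W) \<le> exp (6 * real d1)" by (rule order_trans[OF W(2)])
  qed simp
  also have "\<dots> = 4 * exp (- 4 * real d1)" unfolding L_def by (simp add: exp_add[symmetric])
  finally have prob: "measure ?P (space ?P - E) \<le> 4 * exp (- 4 * real d1)" .
  have E: "E \<in> sets ?P" unfolding E_def using UB by auto
  have close: "close_gram M (real ?n * \<sigma>\<^sup>2) (2 * \<tau>) (M + noise Z)" if Z: "Z \<in> E" for Z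
  proof -
    have Y: "M + noise Z \<in> carrier_mat d1 ?n" using M unfold1_carrier by auto
    note gd = gram_difference[OF M Y, where c = "real ?n * \<sigma>\<^sup>2"]
    have "\<bar>x \<bullet> (((M + noise Z) * (M + noise Z)\<^sup>T - (M * M\<^sup>T + (real ?n * \<sigma>\<^sup>2) \<cdot>\<^sub>m 1\<^sub>m d1)) *\<^sub>v x)\<bar> \<le> 2 * \<tau> * (x \<bullet> x)"
      if x: "x \<in> carrier_vec d1" for x
    proof (rule quadratic_form_le_of_net[OF gd(1,2) _ _ x])
      show "\<exists>w\<in>W. w \<in> carrier_vec d1 \<and> vnorm w \<le> 1 \<and> vnorm (x - w) \<le> 1 / 4"
        if "x \<in> carrier_vec d1" "vnorm x \<le> 1" for x
        using net[OF that] W(3) by blast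
      fix w assume w: "w \<in> W"
      then have "\<bar>gram_error w Z\<bar> \<le> \<tau>" using Z unfolding E_def B_def by (auto simp: not_less)
      then show "\<bar>w \<bullet> (((M + noise Z) * (M + noise Z)\<^sup>T - (M * M\<^sup>T + (real ?n * \<sigma>\<^sup>2) \<cdot>\<^sub>m 1\<^sub>m d1)) *\<^sub>v w)\<bar> \<le> \<tau>"
        using W(3)[OF w] unfolding gram_error_def by (subst gd(3)) auto
    qed
    then show ?thesis unfolding close_gram_def using Y M gd(3) by auto
  qed
  show thesis by (rule that[OF E prob]) (use close in \<open>simp add: \<tau>_def L_def\<close>)
qed

end

section \<open>Deviation of the empirical singular vector\<close>

text \<open>A bound on a product: it becomes a tail bound for any level \<open>a\<close> whose
  sublevel set within \<open>E\<close> has probability bounded below.\<close>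

lemma PiM_normal_concentration:
  fixes f :: "('i \<Rightarrow> real) \<Rightarrow> real"
  assumes \<sigma>: "0 < \<sigma>" and I: "finite I" and E[measurable]: "E \<in> sets (Pi\<^sub>M I (\<lambda>_. normal_measure \<sigma>))"
    and f[measurable]: "f \<in> borel_measurable (Pi\<^sub>M I (\<lambda>_. normal_measure \<sigma>))" and K: "0 \<le> K" and r: "0 \<le> r"
    and lip: "\<And>x y. x \<in> E \<Longrightarrow> y \<in> E \<Longrightarrow> \<bar>f x - f y\<bar> \<le> K * sqrt (\<Sum>i\<in>I. (x i - y i)\<^sup>2)"
  shows "measure (Pi\<^sub>M I (\<lambda>_. normal_measure \<sigma>)) {x \<in> E. f x \<le> a}
       * measure (Pi\<^sub>M I (\<lambda>_. normal_measure \<sigma>)) {x \<in> E. a + K * r < f x} \<le> exp (- r\<^sup>2 / (4 * \<sigma>\<^sup>2))"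
proof (rule PiM_normal_two_sets[OF \<sigma> I])
  let ?P = "Pi\<^sub>M I (\<lambda>_. normal_measure \<sigma>)"
  have "E \<subseteq> space ?P" using E by (rule sets.sets_into_space)
  then have "{x \<in> E. f x \<le> a} = E \<inter> {x \<in> space ?P. f x \<le> a}" "{x \<in> E. a + K * r < f x} = E \<inter> {x \<in> space ?P. a + K * r < f x}"
    by auto
  then show "{x \<in> E. f x \<le> a} \<in> sets ?P" "{x \<in> E. a + K * r < f x} \<in> sets ?P" by simp_all
  fix x y assume "x \<in> {x \<in> E. f x \<le> a}" "y \<in> {x \<in> E. a + K * r < f x}"
  then have "K * r < \<bar>f x - f y\<bar>" and xy: "x \<in> E" "y \<in> E" by auto
  then have "K * r < K * sqrt (\<Sum>i\<in>I. (x i - y i)\<^sup>2)" using lip[OF xy] by linarith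
  then have "r < sqrt (\<Sum>i\<in>I. (x i - y i)\<^sup>2)" using K by (simp add: mult_less_cancel_left)
  then have "r\<^sup>2 \<le> (sqrt (\<Sum>i\<in>I. (x i - y i)\<^sup>2))\<^sup>2" using r by (intro power_mono) auto
  then show "r\<^sup>2 \<le> (\<Sum>i\<in>I. (x i - y i)\<^sup>2)" by (simp add: sum_nonneg)
qed

lemma (in prob_space) approximate_median:
  fixes f :: "'a \<Rightarrow> real"
  assumes E[measurable]: "E \<in> events" and f[measurable]: "f \<in> borel_measurable M" and big: "3 / 4 \<le> prob E"
    and range: "\<And>x. x \<in> E \<Longrightarrow> lo \<le> f x" "\<And>x. x \<in> E \<Longrightarrow> f x \<le> hi" and \<eta>: "0 < \<eta>"
  obtains m where "lo \<le> m" "m \<le> hi" "1 / 4 \<le> prob {x \<in> E. f x \<le> m + \<eta>}" "1 / 4 \<le> prob {x \<in> E. m - \<eta> \<le> f x}"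
proof -
  have Esub: "E \<subseteq> space M" using E by (rule sets.sets_into_space)
  have ev: "{x \<in> E. f x \<le> s} \<in> events" "{x \<in> E. s \<le> f x} \<in> events" for s
  proof -
    have "{x \<in> E. f x \<le> s} = E \<inter> {x \<in> space M. f x \<le> s}" "{x \<in> E. s \<le> f x} = E \<inter> {x \<in> space M. s \<le> f x}"
      using Esub by auto
    then show "{x \<in> E. f x \<le> s} \<in> events" "{x \<in> E. s \<le> f x} \<in> events" by simp_all
  qed
  define S where "S = {s. 1 / 4 \<le> prob {x \<in> E. f x \<le> s}}"
  define m where "m = Inf S"
  have "{x \<in> E. f x \<le> hi} = E" using range by auto
  then have hi: "hi \<in> S" unfolding S_def using big by simp
  have low: "lo \<le> s" if "s \<in> S" for s
  proof (rule ccontr)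
    assume "\<not> lo \<le> s"
    then have "{x \<in> E. f x \<le> s} = {}" using range(1) by fastforce
    then have "prob {x \<in> E. f x \<le> s} = 0" by (simp only: measure_empty)
    then show False using that unfolding S_def by simp
  qed
  have bdd: "bdd_below S" using low by (rule bdd_belowI)
  show thesis
  proof (rule that)
    show "lo \<le> m" unfolding m_def using hi low by (intro cInf_greatest) auto
    show "m \<le> hi" unfolding m_def by (rule cInf_lower[OF hi bdd])
    have "Inf S < m + \<eta>" unfolding m_def using \<eta> by simp
    then obtain s where s: "s \<in> S" "s < m + \<eta>" using cInf_less_iff[OF _ bdd] hi by blast
    have "prob {x \<in> E. f x \<le> s} \<le> prob {x \<in> E. f x \<le> m + \<eta>}"
      using s(2) ev by (intro finite_measure_mono) auto
    then show "1 / 4 \<le> prob {x \<in> E. f x \<le> m + \<eta>}" using s(1) unfolding S_def by simp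
    have "m - \<eta> \<notin> S"
    proof
      assume "m - \<eta> \<in> S"
      then have "m \<le> m - \<eta>" unfolding m_def by (rule cInf_lower[OF _ bdd])
      then show False using \<eta> by simp
    qed
    then have "prob {x \<in> E. f x \<le> m - \<eta>} < 1 / 4" unfolding S_def by simp
    moreover have "prob E \<le> prob ({x \<in> E. f x \<le> m - \<eta>} \<union> {x \<in> E. m - \<eta> \<le> f x})"
      using ev by (intro finite_measure_mono) auto
    moreover have "\<dots> \<le> prob {x \<in> E. f x \<le> m - \<eta>} + prob {x \<in> E. m - \<eta> \<le> f x}"
      by (rule measure_Un_le[OF ev])
    ultimately show "1 / 4 \<le> prob {x \<in> E. m - \<eta> \<le> f x}" using big by linarith
  qed
qed

lemma is_left_sing_vec_uminus:
  assumes Y: "Y \<in> carrier_mat d n" and w: "is_left_sing_vec Y k w"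
  shows "is_left_sing_vec Y k ((- 1) \<cdot>\<^sub>v w)"
proof -
  obtain v where v: "v \<in> carrier_vec n" "vnorm v = 1" "Y *\<^sub>v v = sing_val Y k \<cdot>\<^sub>v w" "Y\<^sup>T *\<^sub>v w = sing_val Y k \<cdot>\<^sub>v v"
    and wc: "w \<in> carrier_vec d" "vnorm w = 1"
    using w Y unfolding is_left_sing_vec_def by auto
  have YT: "Y\<^sup>T \<in> carrier_mat n d" using Y by simp
  show ?thesis
    unfolding is_left_sing_vec_def
  proof (intro conjI bexI[of _ "(- 1) \<cdot>\<^sub>v v"])
    show "Y *\<^sub>v ((- 1) \<cdot>\<^sub>v v) = sing_val Y k \<cdot>\<^sub>v ((- 1) \<cdot>\<^sub>v w)"
      unfolding mult_mat_vec[OF Y v(1)] v(3) by (simp add: smult_smult_assoc)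
    show "Y\<^sup>T *\<^sub>v ((- 1) \<cdot>\<^sub>v w) = sing_val Y k \<cdot>\<^sub>v ((- 1) \<cdot>\<^sub>v v)"
      unfolding mult_mat_vec[OF YT wc(1)] v(4) by (simp add: smult_smult_assoc)
  qed (use Y v wc in auto)
qed

lemma close_gram_mono:
  assumes "close_gram M c \<epsilon> Y" "\<epsilon> \<le> \<epsilon>'" shows "close_gram M c \<epsilon>' Y"
proof -
  have "\<epsilon> * (x \<bullet> x) \<le> \<epsilon>' * (x \<bullet> x)" for x :: "real vec" using assms(2) by (intro mult_right_mono) auto
  then show ?thesis using assms(1) unfolding close_gram_def by (meson order_trans)
qed

text \<open>The tail bound contains a term sigma^2 d without counterpart in \<open>\<delta>\<close>.
  From sigma sqrt d M0 <= delta <= g <= M0^2 follows sigma sqrt d <= M0, hence sigma^2 d <= delta.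
  With sqrt 10 <= 4 the total is 2 (20 + 50) = 140.\<close>

lemma signal_dominates_noise:
  fixes \<delta> g \<sigma> M\<^sub>0 d n :: real
  assumes \<sigma>: "0 < \<sigma>" and d: "0 < d" and n: "0 < n" and M\<^sub>0: "0 \<le> M\<^sub>0"
    and \<delta>: "\<delta> = \<sigma> * sqrt d * M\<^sub>0 + \<sigma>\<^sup>2 * sqrt (d * n)" and g: "\<delta> \<le> g" "g \<le> M\<^sub>0\<^sup>2"
  shows "0 < M\<^sub>0" "2 * (3 * \<sigma> * M\<^sub>0 * sqrt (10 * d) + 5 * \<sigma>\<^sup>2 * (sqrt (n * (10 * d)) + 10 * d)) \<le> 140 * \<delta>"
proof -
  have p: "0 < \<sigma>\<^sup>2 * sqrt (d * n)" using \<sigma> d n by simp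
  have q: "0 \<le> \<sigma> * sqrt d * M\<^sub>0" using \<sigma> d M\<^sub>0 by simp
  have "0 < M\<^sub>0\<^sup>2" using p q \<delta> g by linarith
  then show M: "0 < M\<^sub>0" using M\<^sub>0 by (cases "M\<^sub>0 = 0") auto
  have "(\<sigma> * sqrt d) * M\<^sub>0 \<le> M\<^sub>0 * M\<^sub>0" using p \<delta> g by (simp add: power2_eq_square)
  then have "\<sigma> * sqrt d \<le> M\<^sub>0" using M by (simp add: mult_le_cancel_right)
  then have "(\<sigma> * sqrt d) * (\<sigma> * sqrt d) \<le> (\<sigma> * sqrt d) * M\<^sub>0" using \<sigma> d by (intro mult_left_mono) auto
  moreover have "(\<sigma> * sqrt d)\<^sup>2 = \<sigma>\<^sup>2 * d" using d by (simp add: power_mult_distrib)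
  ultimately have sd: "\<sigma>\<^sup>2 * d \<le> \<delta>" using p \<delta> unfolding power2_eq_square[of "\<sigma> * sqrt d"] by linarith
  have s10: "sqrt 10 \<le> 4" by (rule real_le_lsqrt) auto
  have "sqrt (10 * d) \<le> 4 * sqrt d" using s10 d by (simp add: real_sqrt_mult mult_right_mono)
  then have "3 * \<sigma> * M\<^sub>0 * sqrt (10 * d) \<le> 3 * \<sigma> * M\<^sub>0 * (4 * sqrt d)" using \<sigma> M by (intro mult_left_mono) auto
  then have 1: "3 * \<sigma> * M\<^sub>0 * sqrt (10 * d) \<le> 12 * (\<sigma> * sqrt d * M\<^sub>0)" by (simp add: mult_ac)
  have "sqrt (n * (10 * d)) = sqrt 10 * sqrt (d * n)" by (simp add: real_sqrt_mult mult_ac)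
  also have "\<dots> \<le> 4 * sqrt (d * n)" using s10 d n by (intro mult_right_mono) auto
  finally have "\<sigma>\<^sup>2 * sqrt (n * (10 * d)) \<le> \<sigma>\<^sup>2 * (4 * sqrt (d * n))" by (rule mult_left_mono) simp
  moreover have "5 * \<sigma>\<^sup>2 * (sqrt (n * (10 * d)) + 10 * d) = 5 * (\<sigma>\<^sup>2 * sqrt (n * (10 * d))) + 50 * (\<sigma>\<^sup>2 * d)"
    by (simp add: algebra_simps)
  ultimately show "2 * (3 * \<sigma> * M\<^sub>0 * sqrt (10 * d) + 5 * \<sigma>\<^sup>2 * (sqrt (n * (10 * d)) + 10 * d)) \<le> 140 * \<delta>"
    using 1 sd \<delta> p q by (simp add: algebra_simps)
qed

section \<open>Good event, symmetry and concentration for the singular vector\<close>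

context
  fixes d1 d2 d3 n k :: nat and \<sigma> \<delta> g :: real and A :: tensor and u :: "real vec" and u_hat :: "tensor \<Rightarrow> real vec"
    and P :: "tensor measure" and M :: "real mat"
  assumes \<sigma>: "0 < \<sigma>" and k: "1 \<le> k"
    and P_def: "P = gaussian_tensor d1 d2 d3 \<sigma>" and M_def: "M = unfold1 d1 d2 d3 A"
    and n_def: "n = d2 * d3"
    and \<delta>_def: "\<delta> = \<sigma> * sqrt (real d1) * op_norm M + \<sigma>\<^sup>2 * sqrt (real (d1 * d2 * d3))"
    and g_def: "g = eigengap (M * M\<^sup>T) k"
    and u: "is_left_sing_vec M k u"
    and meas: "\<forall>i<d1. (\<lambda>Z. u_hat Z $ i) \<in> borel_measurable P"
    and sing: "AE Z in P. is_left_sing_vec (unfold1 d1 d2 d3 (\<lambda>i. A i + Z i)) k (u_hat Z) \<and> u_hat Z \<bullet> u > 0"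
    and gap: "100000 * \<delta> \<le> g"
begin

interpretation P: prob_space P
  unfolding P_def gaussian_tensor_def by (intro prob_space_PiM prob_space_normal_density \<sigma>)

definition observed_mat :: "tensor \<Rightarrow> real mat" where
  "observed_mat Z = M + unfold1 d1 d2 d3 Z"
text \<open>The constant of \<open>left_sing_vec_lipschitz\<close> at c = n sigma^2. Multiplied by
  sigma sqrt t it has the order of the first term of the rate.\<close>

definition lipschitz_const :: real where
  "lipschitz_const = 10 * (2 * op_norm M + \<sigma> * sqrt (real n)) / g"

lemma M_carrier: "M \<in> carrier_mat d1 n"
  unfolding M_def n_def by (rule unfold1_carrier)

lemma observed_mat_carrier: "observed_mat Z \<in> carrier_mat d1 n"
  unfolding observed_mat_def n_def using M_carrier unfold1_carrier by (simp add: n_def)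

lemma u_carrier: "u \<in> carrier_vec d1" "vnorm u = 1" "u \<bullet> u = 1"
  using u M_carrier unfolding is_left_sing_vec_def by (auto simp: vnorm_eq_1_iff)

lemma dims_pos: "0 < d1" "0 < n"
proof -
  obtain v where v: "v \<in> carrier_vec n" "vnorm v = 1"
    using u M_carrier unfolding is_left_sing_vec_def by auto
  show "0 < d1" using u_carrier by (cases d1) (auto simp: vnorm_def)
  show "0 < n" using v by (cases n) (auto simp: vnorm_def)
qed

lemma \<delta>_eq: "\<delta> = \<sigma> * sqrt (real d1) * op_norm M + \<sigma>\<^sup>2 * sqrt (real d1 * real n)"
  unfolding \<delta>_def n_def by (simp add: mult.assoc)

lemma \<delta>_pos: "0 < \<delta>"
proof -
  have "0 < \<sigma>\<^sup>2 * sqrt (real d1 * real n)" using \<sigma> dims_pos by simp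
  moreover have "0 \<le> \<sigma> * sqrt (real d1) * op_norm M" using \<sigma> op_norm_nonneg[OF M_carrier] by simp
  ultimately show ?thesis unfolding \<delta>_eq by linarith
qed

lemma g_pos: "0 < g"
  using gap \<delta>_pos by linarith

lemma op_norm_pos: "0 < op_norm M"
  and noise_level: "2 * (3 * \<sigma> * op_norm M * sqrt (10 * real d1) + 5 * \<sigma>\<^sup>2 * (sqrt (real n * (10 * real d1)) + 10 * real d1)) \<le> 140 * \<delta>"
proof -
  have g1: "\<delta> \<le> g" using gap \<delta>_pos by linarith
  have g2: "g \<le> (op_norm M)\<^sup>2" by (rule eigengap_le_op_norm[OF M_carrier k g_def g_pos u])
  note sdn = signal_dominates_noise[OF \<sigma> _ _ op_norm_nonneg[OF M_carrier] \<delta>_eq g1 g2]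
  show "0 < op_norm M" "2 * (3 * \<sigma> * op_norm M * sqrt (10 * real d1) + 5 * \<sigma>\<^sup>2 * (sqrt (real n * (10 * real d1)) + 10 * real d1)) \<le> 140 * \<delta>"
    using dims_pos by (intro sdn; simp)+
qed

lemma lipschitz_const_pos: "0 < lipschitz_const"
  unfolding lipschitz_const_def using op_norm_pos \<sigma> g_pos by (simp add: add_pos_nonneg)

lemma measurable_linear_form:
  assumes x: "x \<in> carrier_vec d1" shows "(\<lambda>Z. u_hat Z \<bullet> x) \<in> borel_measurable P"
  unfolding scalar_prod_def carrier_vecD[OF x]
  using meas by (intro borel_measurable_sum borel_measurable_times borel_measurable_const) auto

text \<open>Outside the null set \<open>N\<close> the vector \<open>u_hat\<close> is a singular
  vector with the right sign. \<open>N\<close> is kept apart from \<open>E\<close> since a reflected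
  tensor need not lie in \<open>E\<close> and must still be handled off \<open>N\<close>. As d1 >=
  1, the bad probability is at most 4 exp (-4) <= 1/4.\<close>

lemma good_event:
  obtains E N where "E \<in> sets P" "N \<in> null_sets P" "3 / 4 \<le> P.prob E" "P.prob (space P - E) \<le> 4 * exp (- 4 * real d1)"
    "\<And>Z. Z \<in> space P \<Longrightarrow> Z \<notin> N \<Longrightarrow> is_left_sing_vec (observed_mat Z) k (u_hat Z) \<and> 0 < u_hat Z \<bullet> u"
    "\<And>Z. Z \<in> E \<Longrightarrow> Z \<in> space P \<and> Z \<notin> N \<and> close_gram M (real n * \<sigma>\<^sup>2) (140 * \<delta>) (observed_mat Z)"
proof -
  obtain E0 where E0': "E0 \<in> sets (gaussian_tensor d1 d2 d3 \<sigma>)"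
      "measure (gaussian_tensor d1 d2 d3 \<sigma>) (space (gaussian_tensor d1 d2 d3 \<sigma>) - E0) \<le> 4 * exp (- 4 * real d1)"
    and close': "\<And>Z. Z \<in> E0 \<Longrightarrow> close_gram M (real (d2 * d3) * \<sigma>\<^sup>2)
      (2 * (3 * \<sigma> * op_norm M * sqrt (10 * real d1) + 5 * \<sigma>\<^sup>2 * (sqrt (real (d2 * d3) * (10 * real d1)) + 10 * real d1)))
      (M + unfold1 d1 d2 d3 Z)"
    by (rule gaussian_close_gram[OF \<sigma> dims_pos(1) M_carrier[unfolded n_def] op_norm_pos order_refl]) (rule that)
  note E0 = E0'[folded P_def]
  note close = close'[folded n_def observed_mat_def]
  obtain N where bad: "{Z \<in> space P. \<not> (is_left_sing_vec (unfold1 d1 d2 d3 (\<lambda>i. A i + Z i)) k (u_hat Z) \<and> u_hat Z \<bullet> u > 0)} \<subseteq> N"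
    and "emeasure P N = 0" "N \<in> sets P"
    by (rule AE_E[OF sing])
  then have N: "N \<in> null_sets P" by (intro null_setsI)
  define E where "E = E0 - N"
  have "space P - E \<subseteq> (space P - E0) \<union> N" unfolding E_def by auto
  then have "P.prob (space P - E) \<le> P.prob ((space P - E0) \<union> N)"
    using E0 N by (intro P.finite_measure_mono) auto
  also have "\<dots> \<le> P.prob (space P - E0) + P.prob N" using E0 N by (intro measure_Un_le) auto
  also have "P.prob N = 0" using N by (auto simp: measure_def)
  finally have small: "P.prob (space P - E) \<le> 4 * exp (- 4 * real d1)" using E0 by simp
  have E: "E \<in> sets P" unfolding E_def using E0 N by auto
  have "exp (- 4 * real d1) \<le> exp (- 4)" using dims_pos by simp
  also have "\<dots> \<le> 1 / 16"
  proof -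
    have "(2 :: real) \<le> exp 1" using exp_ge_add_one_self[of 1] by simp
    then have "(2 :: real) ^ 4 \<le> exp 1 ^ 4" by (rule power_mono) simp
    then have "16 \<le> exp (4 :: real)" by (simp add: exp_of_nat_mult[symmetric])
    then show ?thesis by (simp add: exp_minus field_simps)
  qed
  finally have "P.prob (space P - E) \<le> 1 / 4" using small by simp
  then have big: "3 / 4 \<le> P.prob E" using P.prob_compl[OF E] by simp
  show thesis
  proof (rule that[OF E N big small])
    show "is_left_sing_vec (observed_mat Z) k (u_hat Z) \<and> 0 < u_hat Z \<bullet> u" if "Z \<in> space P" "Z \<notin> N" for Z
    proof (rule ccontr)
      have obs: "observed_mat Z = unfold1 d1 d2 d3 (\<lambda>i. A i + Z i)" unfolding observed_mat_def unfold1_add M_def[symmetric] ..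
      assume "\<not> (is_left_sing_vec (observed_mat Z) k (u_hat Z) \<and> 0 < u_hat Z \<bullet> u)"
      then have "Z \<in> {Z \<in> space P. \<not> (is_left_sing_vec (unfold1 d1 d2 d3 (\<lambda>i. A i + Z i)) k (u_hat Z) \<and> u_hat Z \<bullet> u > 0)}"
        unfolding obs using that(1) by (intro CollectI conjI)
      then have "Z \<in> N" by (rule subsetD[OF bad])
      then show False using that(2) by simp
    qed
    show "Z \<in> space P \<and> Z \<notin> N \<and> close_gram M (real n * \<sigma>\<^sup>2) (140 * \<delta>) (observed_mat Z)" if "Z \<in> E" for Z
    proof -
      have "Z \<in> E0" "Z \<notin> N" using that unfolding E_def by auto
      moreover have "Z \<in> space P" using that sets.sets_into_space[OF E] by (rule subsetD[rotated])
      ultimately show ?thesis using close_gram_mono[OF close[OF \<open>Z \<in> E0\<close>] noise_level] by simp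
    qed
  qed
qed

text \<open>Stated for arbitrary singular vectors of the right sign, so that the case Z = Z' is
  uniqueness.\<close>

lemma u_hat_lipschitz:
  assumes Z: "close_gram M (real n * \<sigma>\<^sup>2) (140 * \<delta>) (observed_mat Z)" "is_left_sing_vec (observed_mat Z) k w" "0 < w \<bullet> u"
    and Z': "close_gram M (real n * \<sigma>\<^sup>2) (140 * \<delta>) (observed_mat Z')" "is_left_sing_vec (observed_mat Z') k w'" "0 < w' \<bullet> u"
  shows "vnorm (w - w') \<le> lipschitz_const * sqrt (\<Sum>p\<in>tensor_index d1 d2 d3. (Z p - Z' p)\<^sup>2)"
proof -
  have le: "140 * \<delta> \<le> g / 10" using gap \<delta>_pos by linarith
  have "vnorm (w - w') \<le> 10 * (2 * op_norm M + sqrt (real n * \<sigma>\<^sup>2)) / g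
      * sqrt (\<Sum>i<d1. \<Sum>j<n. (observed_mat Z $$ (i, j) - observed_mat Z' $$ (i, j))\<^sup>2)"
    by (rule left_sing_vec_lipschitz[OF M_carrier k g_def g_pos u observed_mat_carrier close_gram_mono[OF Z(1) le]
        observed_mat_carrier close_gram_mono[OF Z'(1) le] Z(2,3) Z'(2,3)]) simp
  also have "sqrt (real n * \<sigma>\<^sup>2) = \<sigma> * sqrt (real n)" using \<sigma> by (simp add: real_sqrt_mult)
  also have "(\<Sum>i<d1. \<Sum>j<n. (observed_mat Z $$ (i, j) - observed_mat Z' $$ (i, j))\<^sup>2) = (\<Sum>p\<in>tensor_index d1 d2 d3. (Z p - Z' p)\<^sup>2)"
    unfolding sum_tensor_index n_def[symmetric]
  proof (intro sum.cong refl)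
    fix i j assume "i \<in> {..<d1}" "j \<in> {..<n}"
    then show "(observed_mat Z $$ (i, j) - observed_mat Z' $$ (i, j))\<^sup>2 = (Z (i, j div d3, j mod d3) - Z' (i, j div d3, j mod d3))\<^sup>2"
      using carrier_matD[OF M_carrier] by (simp add: observed_mat_def unfold1_def n_def)
  qed
  finally show ?thesis unfolding lipschitz_const_def .
qed

text \<open>The reflections in \<open>u\<close> and in the right singular vector preserve \<open>M\<close> and the law of the noise, and
  they change the sign of the part of \<open>u_hat\<close> orthogonal to \<open>u\<close>.\<close>

lemma orthogonal_symmetry:
  assumes E: "E \<in> sets P" and N: "N \<in> null_sets P"
    and sv: "\<And>Z. Z \<in> space P \<Longrightarrow> Z \<notin> N \<Longrightarrow> is_left_sing_vec (observed_mat Z) k (u_hat Z) \<and> 0 < u_hat Z \<bullet> u"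
    and good: "\<And>Z. Z \<in> E \<Longrightarrow> Z \<in> space P \<and> Z \<notin> N \<and> close_gram M (real n * \<sigma>\<^sup>2) (140 * \<delta>) (observed_mat Z)"
    and x: "x \<in> carrier_vec d1" "u \<bullet> x = 0"
  shows "P.prob {Z \<in> E. 0 \<le> u_hat Z \<bullet> x} \<le> P.prob {Z \<in> space P. u_hat Z \<bullet> x \<le> 0}"
proof -
  obtain v where v: "v \<in> carrier_vec n" "vnorm v = 1" "M *\<^sub>v v = sing_val M k \<cdot>\<^sub>v u" "M\<^sup>T *\<^sub>v u = sing_val M k \<cdot>\<^sub>v v"
    using u M_carrier unfolding is_left_sing_vec_def by auto
  define H where "H = householder d1 u"
  define G where "G = householder n v"
  have H: "H \<in> carrier_mat d1 d1" "H\<^sup>T = H" "H * H = 1\<^sub>m d1" unfolding H_def using u_carrier by auto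
  have G: "G \<in> carrier_mat n n" "G\<^sup>T = G" "G * G = 1\<^sub>m n" unfolding G_def using v by auto
  have HMG: "H * M * G = M" unfolding H_def G_def by (rule householder_fixes[OF M_carrier u_carrier(1,2) v])
  define T where "T = (\<lambda>Z. refold1 d1 d2 d3 (H * unfold1 d1 d2 d3 Z * G))"
  note pres = gaussian_tensor_reflect(1,2)[OF \<sigma> H G[unfolded n_def], folded T_def P_def]
  have UT: "unfold1 d1 d2 d3 (T Z) = H * unfold1 d1 d2 d3 Z * G" for Z
    unfolding T_def by (rule gaussian_tensor_reflect(3)[OF \<sigma> H G[unfolded n_def]])
  have Uc: "unfold1 d1 d2 d3 Z \<in> carrier_mat d1 n" for Z unfolding n_def by (rule unfold1_carrier)
  have obsT: "observed_mat (T Z) = H * observed_mat Z * G" for Z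
  proof -
    have "H * observed_mat Z = H * M + H * unfold1 d1 d2 d3 Z"
      unfolding observed_mat_def by (rule mult_add_distrib_mat[OF H(1) M_carrier Uc])
    then have "H * observed_mat Z * G = H * M * G + H * unfold1 d1 d2 d3 Z * G"
      using add_mult_distrib_mat[OF mult_carrier_mat[OF H(1) M_carrier] mult_carrier_mat[OF H(1) Uc] G(1)] by (simp only:)
    then show ?thesis unfolding observed_mat_def[of "T Z"] UT HMG by simp
  qed
  have flip: "u_hat (T Z) \<bullet> x = - (u_hat Z \<bullet> x)" if Z: "Z \<in> E" and TN: "T Z \<notin> N" for Z
  proof -
    have Zs: "Z \<in> space P" "Z \<notin> N" and close: "close_gram M (real n * \<sigma>\<^sup>2) (140 * \<delta>) (observed_mat Z)" using good[OF Z] by auto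
    have Ts: "T Z \<in> space P" using measurable_space[OF pres(1) Zs(1)] .
    define w where "w = u_hat Z"
    have w: "is_left_sing_vec (observed_mat Z) k w" "0 < w \<bullet> u" using sv[OF Zs] unfolding w_def by auto
    have wc: "w \<in> carrier_vec d1" using left_sing_vec_gram(1)[OF observed_mat_carrier w(1)] .
    \<comment> \<open>\<open>H\<close> reverses the component along \<open>u\<close>, so the sign
      must be changed to restore positivity. This moves the sign change to the component along
      \<open>x\<close>, which \<open>H\<close> leaves alone.\<close>
    define w' where "w' = (- 1) \<cdot>\<^sub>v (H *\<^sub>v w)"
    have Hw: "H *\<^sub>v w \<in> carrier_vec d1" by (rule mult_mat_vec_carrier[OF H(1) wc])
    have Hy: "(H *\<^sub>v w) \<bullet> y = w \<bullet> (H *\<^sub>v y)" if "y \<in> carrier_vec d1" for y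
      using scalar_prod_mult_mat_vec[OF H(1) wc that] unfolding H(2) by simp
    have Hu: "H *\<^sub>v u = (- 1) \<cdot>\<^sub>v u"
      unfolding H_def householder_mult_vec[OF u_carrier(1) u_carrier(1)] u_carrier(3)
      by (intro eq_vecI) auto
    have Hx: "H *\<^sub>v x = x"
      unfolding H_def householder_mult_vec[OF u_carrier(1) x(1)] x(2)
      using x(1) carrier_vecD[OF u_carrier(1)] by (intro eq_vecI) auto
    have "is_left_sing_vec (observed_mat (T Z)) k w'"
      unfolding obsT w'_def
      by (rule is_left_sing_vec_uminus[OF reflect_carrier[OF H G observed_mat_carrier] is_left_sing_vec_reflect[OF H G observed_mat_carrier w(1)]])
    moreover have "w' \<bullet> u = w \<bullet> u"
      unfolding w'_def using Hw Hy[OF u_carrier(1)] wc u_carrier(1)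
      by (simp add: Hu smult_scalar_prod_distrib[of _ d1] scalar_prod_smult_distrib[of _ d1])
    moreover have "close_gram M (real n * \<sigma>\<^sup>2) (140 * \<delta>) (observed_mat (T Z))"
      unfolding obsT by (rule close_gram_reflect[OF H G M_carrier HMG observed_mat_carrier close])
    moreover have "is_left_sing_vec (observed_mat (T Z)) k (u_hat (T Z))" "0 < u_hat (T Z) \<bullet> u" using sv[OF Ts TN] by auto
    \<comment> \<open>At equal tensors the Lipschitz bound is 0, which identifies the selected
      vector \<open>u_hat (T Z)\<close> with \<open>w'\<close>.\<close>
    ultimately have "vnorm (u_hat (T Z) - w') \<le> lipschitz_const * sqrt (\<Sum>p\<in>tensor_index d1 d2 d3. (T Z p - T Z p)\<^sup>2)"
      using w(2) by (intro u_hat_lipschitz) auto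
    then have 0: "vnorm (u_hat (T Z) - w') = 0" using vnorm_nonneg[of "u_hat (T Z) - w'"] by simp
    have uc: "u_hat (T Z) \<in> carrier_vec d1"
      using left_sing_vec_gram(1)[OF observed_mat_carrier conjunct1[OF sv[OF Ts TN]]] .
    have w'c: "w' \<in> carrier_vec d1" unfolding w'_def using Hw by simp
    have "u_hat (T Z) \<bullet> x - w' \<bullet> x = (u_hat (T Z) - w') \<bullet> x"
      using minus_scalar_prod_distrib[OF uc w'c x(1)] by simp
    also have "\<dots> = 0"
      using abs_scalar_prod_le[of "u_hat (T Z) - w'" x] 0 carrier_vecD[OF w'c] carrier_vecD[OF x(1)] by simp
    finally have "u_hat (T Z) \<bullet> x = w' \<bullet> x" by simp
    also have "\<dots> = - (w \<bullet> x)"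
      unfolding w'_def using Hw Hy[OF x(1)] x(1) by (simp add: Hx smult_scalar_prod_distrib[of _ d1])
    finally show ?thesis unfolding w_def .
  qed
  have [measurable]: "(\<lambda>Z. u_hat Z \<bullet> x) \<in> borel_measurable P" by (rule measurable_linear_form[OF x(1)])
  let ?L = "{Z \<in> space P. u_hat Z \<bullet> x \<le> 0}"
  have L: "?L \<in> sets P" by measurable
  have LN: "?L \<union> N \<in> sets P" using L N by auto
  \<comment> \<open>A reflected point may fall into \<open>N\<close>; since \<open>T\<close>
    preserves the law, adding \<open>N\<close> to the target costs nothing.\<close>
  have "P.prob {Z \<in> E. 0 \<le> u_hat Z \<bullet> x} \<le> P.prob (T -` (?L \<union> N) \<inter> space P)"
  proof (rule P.finite_measure_mono)
    show "{Z \<in> E. 0 \<le> u_hat Z \<bullet> x} \<subseteq> T -` (?L \<union> N) \<inter> space P"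
    proof
      fix Z assume Z: "Z \<in> {Z \<in> E. 0 \<le> u_hat Z \<bullet> x}"
      then have "Z \<in> space P" using good[of Z] by simp
      moreover have "T Z \<in> ?L \<union> N"
      proof (cases "T Z \<in> N")
        case False
        then have "u_hat (T Z) \<bullet> x \<le> 0" using flip[of Z] Z by simp
        then show ?thesis using measurable_space[OF pres(1) \<open>Z \<in> space P\<close>] by simp
      qed simp
      ultimately show "Z \<in> T -` (?L \<union> N) \<inter> space P" by simp
    qed
    show "T -` (?L \<union> N) \<inter> space P \<in> sets P" by (rule measurable_sets[OF pres(1) LN])
  qed
  also have "\<dots> = measure (distr P P T) (?L \<union> N)" by (rule measure_distr[OF pres(1) LN, symmetric])
  also have "\<dots> = P.prob (?L \<union> N)" unfolding pres(2) ..
  also have "\<dots> \<le> P.prob ?L + P.prob N" using L N by (intro measure_Un_le) auto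
  also have "P.prob N = 0" using N by (auto simp: measure_def)
  finally show ?thesis by simp
qed

text \<open>At distance r = 6 sigma sqrt t the exponent r^2 / (4 sigma^2) is 9 t, and the lower
  bound 1/8 on the sublevel mass gives the factor 8.\<close>

lemma linear_form_concentration:
  assumes E: "E \<in> sets P"
    and sv: "\<And>Z. Z \<in> E \<Longrightarrow> is_left_sing_vec (observed_mat Z) k (u_hat Z) \<and> 0 < u_hat Z \<bullet> u"
    and good: "\<And>Z. Z \<in> E \<Longrightarrow> close_gram M (real n * \<sigma>\<^sup>2) (140 * \<delta>) (observed_mat Z)"
    and x: "x \<in> carrier_vec d1" and half: "1 / 8 \<le> P.prob {Z \<in> E. u_hat Z \<bullet> x \<le> a}" and t: "0 \<le> t"
  shows "P.prob {Z \<in> E. a + lipschitz_const * vnorm x * (6 * \<sigma> * sqrt t) < u_hat Z \<bullet> x} \<le> 8 * exp (- 9 * t)"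
proof -
  let ?B = "{Z \<in> E. a + lipschitz_const * vnorm x * (6 * \<sigma> * sqrt t) < u_hat Z \<bullet> x}"
  have PN: "P = Pi\<^sub>M (tensor_index d1 d2 d3) (\<lambda>_. normal_measure \<sigma>)" by (simp add: P_def gaussian_tensor_def)
  have "P.prob {Z \<in> E. u_hat Z \<bullet> x \<le> a} * P.prob ?B \<le> exp (- (6 * \<sigma> * sqrt t)\<^sup>2 / (4 * \<sigma>\<^sup>2))"
    unfolding PN
  proof (rule PiM_normal_concentration[OF \<sigma> finite_tensor_index])
    show "E \<in> sets (Pi\<^sub>M (tensor_index d1 d2 d3) (\<lambda>_. normal_measure \<sigma>))" using E unfolding PN .
    show "(\<lambda>Z. u_hat Z \<bullet> x) \<in> borel_measurable (Pi\<^sub>M (tensor_index d1 d2 d3) (\<lambda>_. normal_measure \<sigma>))"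
      using measurable_linear_form[OF x] unfolding PN .
    show "0 \<le> lipschitz_const * vnorm x" "0 \<le> 6 * \<sigma> * sqrt t" using lipschitz_const_pos \<sigma> t by auto
    fix Z Z' assume Z: "Z \<in> E" and Z': "Z' \<in> E"
    have c: "u_hat Z \<in> carrier_vec d1" "u_hat Z' \<in> carrier_vec d1"
      using left_sing_vec_gram(1)[OF observed_mat_carrier] sv[OF Z] sv[OF Z'] by blast+
    have "u_hat Z \<bullet> x - u_hat Z' \<bullet> x = (u_hat Z - u_hat Z') \<bullet> x"
      using minus_scalar_prod_distrib[OF c x] by simp
    then have "\<bar>u_hat Z \<bullet> x - u_hat Z' \<bullet> x\<bar> \<le> vnorm (u_hat Z - u_hat Z') * vnorm x"
      using abs_scalar_prod_le[of "u_hat Z - u_hat Z'" x] carrier_vecD[OF c(2)] carrier_vecD[OF x] by simp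
    also have "\<dots> \<le> (lipschitz_const * sqrt (\<Sum>p\<in>tensor_index d1 d2 d3. (Z p - Z' p)\<^sup>2)) * vnorm x"
      using sv[OF Z] sv[OF Z'] by (intro mult_right_mono u_hat_lipschitz good Z Z') auto
    finally show "\<bar>u_hat Z \<bullet> x - u_hat Z' \<bullet> x\<bar> \<le> lipschitz_const * vnorm x * sqrt (\<Sum>p\<in>tensor_index d1 d2 d3. (Z p - Z' p)\<^sup>2)"
      by (simp add: mult_ac)
  qed
  also have "(6 * \<sigma> * sqrt t)\<^sup>2 / (4 * \<sigma>\<^sup>2) = 9 * t" using \<sigma> t by (simp add: power_mult_distrib)
  then have "- (6 * \<sigma> * sqrt t)\<^sup>2 / (4 * \<sigma>\<^sup>2) = - 9 * t" by simp
  finally have "P.prob {Z \<in> E. u_hat Z \<bullet> x \<le> a} * P.prob ?B \<le> exp (- 9 * t)" .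
  moreover have "1 / 8 * P.prob ?B \<le> P.prob {Z \<in> E. u_hat Z \<bullet> x \<le> a} * P.prob ?B"
    by (rule mult_right_mono[OF half]) simp
  ultimately show ?thesis by simp
qed

text \<open>Symmetry makes 0 an approximate median. With L the event that the form is at most 0,
  P(E) <= P(L) + P(E and L) and P(L) <= P(E and L) + 1 - P(E); since P(E) >= 3/4, the event E and L
  has probability at least 1/4.\<close>

lemma orthogonal_concentration:
  assumes E: "E \<in> sets P" and N: "N \<in> null_sets P" and big: "3 / 4 \<le> P.prob E"
    and sv: "\<And>Z. Z \<in> space P \<Longrightarrow> Z \<notin> N \<Longrightarrow> is_left_sing_vec (observed_mat Z) k (u_hat Z) \<and> 0 < u_hat Z \<bullet> u"
    and good: "\<And>Z. Z \<in> E \<Longrightarrow> Z \<in> space P \<and> Z \<notin> N \<and> close_gram M (real n * \<sigma>\<^sup>2) (140 * \<delta>) (observed_mat Z)"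
    and x: "x \<in> carrier_vec d1" "u \<bullet> x = 0" and t: "0 \<le> t"
  shows "P.prob {Z \<in> E. lipschitz_const * vnorm x * (6 * \<sigma> * sqrt t) < u_hat Z \<bullet> x} \<le> 8 * exp (- 9 * t)"
proof -
  have [measurable]: "(\<lambda>Z. u_hat Z \<bullet> x) \<in> borel_measurable P" by (rule measurable_linear_form[OF x(1)])
  let ?L = "{Z \<in> space P. u_hat Z \<bullet> x \<le> 0}" and ?U = "{Z \<in> space P. 0 \<le> u_hat Z \<bullet> x}"
  have LU: "?L \<in> sets P" "?U \<in> sets P" by measurable
  have EL: "{Z \<in> E. u_hat Z \<bullet> x \<le> 0} = E \<inter> ?L" "{Z \<in> E. 0 \<le> u_hat Z \<bullet> x} = E \<inter> ?U"
    using sets.sets_into_space[OF E] by auto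
  have sym: "P.prob (E \<inter> ?U) \<le> P.prob ?L"
    using orthogonal_symmetry[OF E N sv good x] unfolding EL .
  have "P.prob E \<le> P.prob ((E \<inter> ?U) \<union> (E \<inter> ?L))"
    using E LU sets.sets_into_space[OF E] by (intro P.finite_measure_mono) auto
  also have "\<dots> \<le> P.prob (E \<inter> ?U) + P.prob (E \<inter> ?L)" using E LU by (intro measure_Un_le) auto
  also have "\<dots> \<le> P.prob ?L + P.prob (E \<inter> ?L)" using sym by simp
  finally have 1: "P.prob E \<le> P.prob ?L + P.prob (E \<inter> ?L)" .
  have "P.prob ?L \<le> P.prob ((E \<inter> ?L) \<union> (space P - E))"
    using E LU by (intro P.finite_measure_mono) auto
  also have "\<dots> \<le> P.prob (E \<inter> ?L) + P.prob (space P - E)" using E LU by (intro measure_Un_le) auto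
  also have "P.prob (space P - E) = 1 - P.prob E" by (rule P.prob_compl[OF E])
  finally have "1 / 8 \<le> P.prob {Z \<in> E. u_hat Z \<bullet> x \<le> 0}" using 1 big unfolding EL by linarith
  from linear_form_concentration[OF E _ _ x(1) this t] sv good show ?thesis by simp
qed

lemma singular_vector_deviation:
  obtains b where "- 1 / 2 \<le> b" "b \<le> 0" "\<bar>b\<bar> \<le> sqrt 2 * \<delta> / g"
    "\<And>x t. x \<in> carrier_vec d1 \<Longrightarrow> ln 8 \<le> t \<Longrightarrow> t \<le> real d1 \<Longrightarrow>
      1 - exp (- t) \<le> P.prob {Z \<in> space P. \<bar>u_hat Z \<bullet> x - sqrt (1 + b) * (u \<bullet> x)\<bar>
        \<le> 13 * lipschitz_const * \<sigma> * sqrt t * vnorm x}"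
proof -
  obtain E N where E: "E \<in> sets P" and N: "N \<in> null_sets P" and big: "3 / 4 \<le> P.prob E"
    and small: "P.prob (space P - E) \<le> 4 * exp (- 4 * real d1)"
    and sv: "\<And>Z. Z \<in> space P \<Longrightarrow> Z \<notin> N \<Longrightarrow> is_left_sing_vec (observed_mat Z) k (u_hat Z) \<and> 0 < u_hat Z \<bullet> u"
    and good: "\<And>Z. Z \<in> E \<Longrightarrow> Z \<in> space P \<and> Z \<notin> N \<and> close_gram M (real n * \<sigma>\<^sup>2) (140 * \<delta>) (observed_mat Z)"
    by (rule good_event) (rule that)
  have svE: "is_left_sing_vec (observed_mat Z) k (u_hat Z) \<and> 0 < u_hat Z \<bullet> u"
    and goodE: "close_gram M (real n * \<sigma>\<^sup>2) (140 * \<delta>) (observed_mat Z)" if "Z \<in> E" for Z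
    using sv good[OF that] by simp_all
  \<comment> \<open>The bound on the squared sine at error level 140 delta. It is 78400 (delta /
    g)^2, hence at most delta / g, because the gap condition makes delta / g at most 1 /
    100000.\<close>
  define q where "q = (2 * (140 * \<delta> / g))\<^sup>2"
  have ratio: "\<delta> / g \<le> 1 / 100000" using gap g_pos by (simp add: field_simps)
  have ratio0: "0 \<le> \<delta> / g" using \<delta>_pos g_pos by simp
  have q: "0 \<le> q" "q \<le> \<delta> / g" "q \<le> 1 / 2"
  proof -
    show "0 \<le> q" unfolding q_def by simp
    have "q = 78400 * (\<delta> / g) * (\<delta> / g)" unfolding q_def by (simp add: power2_eq_square)
    also have "\<dots> \<le> 1 * (\<delta> / g)" using ratio ratio0 by (intro mult_right_mono) auto
    finally show "q \<le> \<delta> / g" by simp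
    then show "q \<le> 1 / 2" using ratio by linarith
  qed
  have range: "sqrt (1 - q) \<le> u_hat Z \<bullet> u" "u_hat Z \<bullet> u \<le> 1" if Z: "Z \<in> E" for Z
  proof -
    have le: "140 * \<delta> \<le> g / 10" using gap \<delta>_pos by linarith
    note w = svE[OF Z, THEN conjunct1] and pos = svE[OF Z, THEN conjunct2]
    have "1 - (u_hat Z \<bullet> u)\<^sup>2 \<le> q"
      unfolding q_def by (rule left_sing_vec_near[OF M_carrier k g_def g_pos u observed_mat_carrier goodE[OF Z] le w])
    then show "sqrt (1 - q) \<le> u_hat Z \<bullet> u" using pos by (intro real_le_lsqrt) auto
    show "u_hat Z \<bullet> u \<le> 1"
      using scalar_prod_le_vnorm[OF left_sing_vec_gram(1)[OF observed_mat_carrier w] u_carrier(1)]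
        left_sing_vec_gram(2)[OF observed_mat_carrier w] u_carrier(2) by simp
  qed
  have \<eta>: "0 < lipschitz_const * \<sigma>" using lipschitz_const_pos \<sigma> by simp
  \<comment> \<open>The range puts m between sqrt (1 - q) and 1, so b = m^2 - 1 lies between -q and
    0. The choice of m precedes x and t.\<close>
  obtain m where m: "sqrt (1 - q) \<le> m" "m \<le> 1" "1 / 4 \<le> P.prob {Z \<in> E. u_hat Z \<bullet> u \<le> m + lipschitz_const * \<sigma>}"
      "1 / 4 \<le> P.prob {Z \<in> E. m - lipschitz_const * \<sigma> \<le> u_hat Z \<bullet> u}"
    by (rule P.approximate_median[OF E measurable_linear_form[OF u_carrier(1)] big range \<eta>])
  have m0: "0 \<le> m" using m(1) q(3) real_sqrt_ge_zero[of "1 - q"] by linarith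
  have "1 - q = (sqrt (1 - q))\<^sup>2" using q(3) by simp
  also have "\<dots> \<le> m\<^sup>2" using m(1) q(3) by (intro power_mono) auto
  finally have mq: "1 - q \<le> m\<^sup>2" .
  have m1: "m\<^sup>2 \<le> 1" using m0 m(2) by (simp add: power_le_one)
  define b where "b = m\<^sup>2 - 1"
  have sqrt_b: "sqrt (1 + b) = m" unfolding b_def using m0 by simp
  show thesis
  proof (rule that[of b])
    show "- 1 / 2 \<le> b" "b \<le> 0" unfolding b_def using mq m1 q by linarith+
    have "\<bar>b\<bar> \<le> \<delta> / g" unfolding b_def using mq m1 q by linarith
    also have "\<dots> \<le> sqrt 2 * (\<delta> / g)" using mult_right_mono[of 1 "sqrt 2" "\<delta> / g"] ratio0 by simp
    finally show "\<bar>b\<bar> \<le> sqrt 2 * \<delta> / g" by simp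
    fix x :: "real vec" and t :: real
    assume x: "x \<in> carrier_vec d1" and t: "ln 8 \<le> t" "t \<le> real d1"
    have "exp (1 :: real) \<le> 8" using exp_le by linarith
    then have "(1 :: real) \<le> ln 8" by (simp add: ln_ge_iff)
    then have t1: "1 \<le> t" using t(1) by linarith
    then have st: "1 \<le> sqrt t" "0 \<le> t" by auto
    \<comment> \<open>\<open>x\<close> is split along \<open>u\<close>: the \<open>u\<close>-part
      concentrates around m <u, x>, the rest around 0.\<close>
    define y where "y = x - (x \<bullet> u) \<cdot>\<^sub>v u"
    have y: "y \<in> carrier_vec d1" unfolding y_def using x u_carrier(1) by simp
    have uy: "u \<bullet> y = 0"
      unfolding y_def using x u_carrier comm_scalar_prod[OF x u_carrier(1)]
      by (simp add: scalar_prod_minus_distrib[of _ d1] scalar_prod_smult_distrib[of _ d1])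
    have "(vnorm y)\<^sup>2 \<le> (vnorm x)\<^sup>2"
      unfolding y_def vnorm_reject[OF u_carrier(1,2) x] unfolding vnorm_power2 by simp
    then have yx: "vnorm y \<le> vnorm x" by (rule power2_le_imp_le) simp
    have xu: "\<bar>u \<bullet> x\<bar> \<le> vnorm x"
      using abs_scalar_prod_le[of u x] carrier_vecD[OF u_carrier(1)] carrier_vecD[OF x] u_carrier(2) by simp
    let ?y' = "(- 1) \<cdot>\<^sub>v y" and ?u' = "(- 1) \<cdot>\<^sub>v u"
    have y': "?y' \<in> carrier_vec d1" "u \<bullet> ?y' = 0" using y uy u_carrier by (auto simp: scalar_prod_smult_distrib[of _ d1])
    have u': "?u' \<in> carrier_vec d1" using u_carrier by auto
    have neg: "u_hat Z \<bullet> ((- 1) \<cdot>\<^sub>v z) = - (u_hat Z \<bullet> z)" if "Z \<in> E" "z \<in> carrier_vec d1" for Z z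
      using left_sing_vec_gram(1)[OF observed_mat_carrier svE[OF that(1), THEN conjunct1]] that(2)
      by (simp add: scalar_prod_smult_distrib[of _ d1])
    define r where "r = lipschitz_const * (6 * \<sigma> * sqrt t)"
    \<comment> \<open>Upper and lower deviations of both parts. The lower ones are upper deviations
      for the negated vectors, so one-sided concentration suffices.\<close>
    define B1 where "B1 = {Z \<in> E. (m + lipschitz_const * \<sigma>) + lipschitz_const * vnorm u * (6 * \<sigma> * sqrt t) < u_hat Z \<bullet> u}"
    define B2 where "B2 = {Z \<in> E. (- m + lipschitz_const * \<sigma>) + lipschitz_const * vnorm ?u' * (6 * \<sigma> * sqrt t) < u_hat Z \<bullet> ?u'}"
    define B3 where "B3 = {Z \<in> E. lipschitz_const * vnorm y * (6 * \<sigma> * sqrt t) < u_hat Z \<bullet> y}"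
    define B4 where "B4 = {Z \<in> E. lipschitz_const * vnorm ?y' * (6 * \<sigma> * sqrt t) < u_hat Z \<bullet> ?y'}"
    have p1: "P.prob B1 \<le> 8 * exp (- 9 * t)"
      unfolding B1_def using m(3) by (intro linear_form_concentration[OF E svE goodE u_carrier(1)]) (auto simp: st)
    have "{Z \<in> E. u_hat Z \<bullet> ?u' \<le> - m + lipschitz_const * \<sigma>} = {Z \<in> E. m - lipschitz_const * \<sigma> \<le> u_hat Z \<bullet> u}"
      using neg[OF _ u_carrier(1)] by auto
    then have "1 / 8 \<le> P.prob {Z \<in> E. u_hat Z \<bullet> ?u' \<le> - m + lipschitz_const * \<sigma>}" using m(4) by simp
    then have p2: "P.prob B2 \<le> 8 * exp (- 9 * t)"
      unfolding B2_def by (intro linear_form_concentration[OF E svE goodE u']) (auto simp: st)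
    have p3: "P.prob B3 \<le> 8 * exp (- 9 * t)"
      unfolding B3_def by (rule orthogonal_concentration[OF E N big sv good y uy st(2)])
    have p4: "P.prob B4 \<le> 8 * exp (- 9 * t)"
      unfolding B4_def by (rule orthogonal_concentration[OF E N big sv good y' st(2)])
    have sets_B: "{Z \<in> E. c < u_hat Z \<bullet> z} \<in> sets P" if "z \<in> carrier_vec d1" for c z
    proof -
      have [measurable]: "(\<lambda>Z. u_hat Z \<bullet> z) \<in> borel_measurable P" by (rule measurable_linear_form[OF that])
      have "{Z \<in> E. c < u_hat Z \<bullet> z} = E \<inter> {Z \<in> space P. c < u_hat Z \<bullet> z}"
        using sets.sets_into_space[OF E] by auto
      then show ?thesis using E by simp
    qed
    have Bs: "B1 \<in> sets P" "B2 \<in> sets P" "B3 \<in> sets P" "B4 \<in> sets P" "space P - E \<in> sets P"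
      unfolding B1_def B2_def B3_def B4_def using E by (auto intro: sets_B u_carrier(1) u' y y'(1))
    let ?B = "(space P - E) \<union> ((B1 \<union> B2) \<union> (B3 \<union> B4))"
    have "P.prob ?B \<le> P.prob (space P - E) + ((P.prob B1 + P.prob B2) + (P.prob B3 + P.prob B4))"
      using Bs by (intro order_trans[OF measure_Un_le] add_mono order_refl measure_Un_le sets.Un)
    \<comment> \<open>Here t <= d1 pays for the complement of \<open>E\<close>, with 4 * 8 = 32 for
      the other four events; then t >= ln 8 gives exp (3 t) >= 512, which beats 36.\<close>
    also have "\<dots> \<le> 4 * exp (- 4 * t) + 32 * exp (- 4 * t)"
    proof -
      have "exp (- 4 * real d1) \<le> exp (- 4 * t)" "exp (- 9 * t) \<le> exp (- 4 * t)" using t st by simp_all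
      then show ?thesis using p1 p2 p3 p4 small by linarith
    qed
    also have "\<dots> = 36 * exp (- 3 * t) * exp (- t)" by (simp add: exp_add[symmetric])
    also have "\<dots> \<le> 1 * exp (- t)"
    proof (rule mult_right_mono)
      have "(8 :: real) \<le> exp t" using exp_le_cancel_iff[of "ln 8" t] t(1) by simp
      then have "8 ^ 3 \<le> exp t ^ 3" by (rule power_mono) simp
      then have "512 \<le> exp (3 * t)" by (simp add: exp_of_nat_mult[symmetric])
      then show "36 * exp (- 3 * t) \<le> 1" by (simp add: exp_minus field_simps)
    qed simp
    finally have bad: "P.prob ?B \<le> exp (- t)" by simp
    let ?G = "{Z \<in> space P. \<bar>u_hat Z \<bullet> x - sqrt (1 + b) * (u \<bullet> x)\<bar> \<le> 13 * lipschitz_const * \<sigma> * sqrt t * vnorm x}"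
    have sub: "space P - ?B \<subseteq> ?G"
    proof
      fix Z assume Z: "Z \<in> space P - ?B"
      then have ZE: "Z \<in> E" and nB: "Z \<notin> B1" "Z \<notin> B2" "Z \<notin> B3" "Z \<notin> B4" by auto
      have c: "u_hat Z \<in> carrier_vec d1" using left_sing_vec_gram(1)[OF observed_mat_carrier svE[OF ZE, THEN conjunct1]] .
      have "u_hat Z \<bullet> u - m \<le> lipschitz_const * \<sigma> + r"
        using nB(1) ZE u_carrier(2) unfolding B1_def r_def by simp
      moreover have "m - u_hat Z \<bullet> u \<le> lipschitz_const * \<sigma> + r"
        using nB(2) ZE u_carrier(2) neg[OF ZE u_carrier(1)] unfolding B2_def r_def by simp
      ultimately have du: "\<bar>u_hat Z \<bullet> u - m\<bar> \<le> lipschitz_const * \<sigma> + r" by linarith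
      have "u_hat Z \<bullet> y \<le> r * vnorm y" using nB(3) ZE unfolding B3_def r_def by (simp add: mult_ac)
      moreover have "- (u_hat Z \<bullet> y) \<le> r * vnorm y"
        using nB(4) ZE neg[OF ZE y] unfolding B4_def r_def by (simp add: mult_ac)
      ultimately have dy: "\<bar>u_hat Z \<bullet> y\<bar> \<le> r * vnorm y" by linarith
      have r0: "0 \<le> r" unfolding r_def using lipschitz_const_pos \<sigma> st by simp
      have "u_hat Z \<bullet> y = u_hat Z \<bullet> x - (u \<bullet> x) * (u_hat Z \<bullet> u)"
        unfolding y_def using c x u_carrier(1) comm_scalar_prod[OF x u_carrier(1)]
        by (simp add: scalar_prod_minus_distrib[of _ d1] scalar_prod_smult_distrib[of _ d1])
      then have "u_hat Z \<bullet> x - sqrt (1 + b) * (u \<bullet> x) = (u \<bullet> x) * (u_hat Z \<bullet> u - m) + u_hat Z \<bullet> y"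
        unfolding sqrt_b by (simp add: algebra_simps)
      then have "\<bar>u_hat Z \<bullet> x - sqrt (1 + b) * (u \<bullet> x)\<bar> \<le> \<bar>u \<bullet> x\<bar> * \<bar>u_hat Z \<bullet> u - m\<bar> + \<bar>u_hat Z \<bullet> y\<bar>"
        by (simp add: abs_mult[symmetric])
      \<comment> \<open>The 13 of the final bound is collected here: 1 for the tolerance of the
        median, absorbed because sqrt t >= 1, and 6 for each of the two parts of
        \<open>x\<close>.\<close>
      also have "\<dots> \<le> vnorm x * (lipschitz_const * \<sigma> + r) + r * vnorm x"
        using r0 \<eta> by (intro add_mono mult_mono xu du order_trans[OF dy] mult_left_mono yx) auto
      also have "\<dots> = (lipschitz_const * \<sigma> * (1 + 12 * sqrt t)) * vnorm x" unfolding r_def by (simp add: algebra_simps)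
      also have "\<dots> \<le> (lipschitz_const * \<sigma> * (13 * sqrt t)) * vnorm x"
        using \<eta> st by (intro mult_right_mono mult_left_mono) auto
      finally show "Z \<in> ?G" using Z by (simp add: mult_ac)
    qed
    have [measurable]: "(\<lambda>Z. u_hat Z \<bullet> x) \<in> borel_measurable P" by (rule measurable_linear_form[OF x])
    have G: "?G \<in> sets P" by measurable
    have Bset: "?B \<in> sets P" using Bs by auto
    have "1 - exp (- t) \<le> 1 - P.prob ?B" using bad by simp
    also have "\<dots> = P.prob (space P - ?B)" by (rule P.prob_compl[OF Bset, symmetric])
    also have "\<dots> \<le> P.prob ?G" by (rule P.finite_measure_mono[OF sub G])
    finally show "1 - exp (- t) \<le> P.prob ?G" .
  qed
qed

text \<open>The coefficients are 13 * 20 = 260 for the signal and 13 * 10 = 130 for the noise; the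
  second term of the rate is nonnegative.\<close>

lemma singular_vector_deviation_rate:
  assumes "0 \<le> t"
  shows "13 * lipschitz_const * \<sigma> * sqrt t \<le> 300 * (sqrt t * ((\<sigma> * op_norm M + \<sigma>\<^sup>2 * sqrt (real (d2 * d3))) / g) + \<sigma>\<^sup>2 * real d1 / g * (\<delta> / g))"
proof -
  let ?a = "sqrt t * (\<sigma> * op_norm M) / g" and ?b = "sqrt t * (\<sigma>\<^sup>2 * sqrt (real n)) / g"
  have ab: "0 \<le> ?a" "0 \<le> ?b" using assms \<sigma> op_norm_pos g_pos by auto
  have Y: "0 \<le> \<sigma>\<^sup>2 * real d1 / g * (\<delta> / g)" using g_pos \<delta>_pos by simp
  have 1: "13 * lipschitz_const * \<sigma> * sqrt t = 260 * ?a + 130 * ?b"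
    unfolding lipschitz_const_def by (simp add: algebra_simps add_divide_distrib power2_eq_square)
  have 2: "sqrt t * ((\<sigma> * op_norm M + \<sigma>\<^sup>2 * sqrt (real (d2 * d3))) / g) = ?a + ?b"
    unfolding n_def by (simp add: algebra_simps add_divide_distrib)
  have "260 * a + 130 * b \<le> 300 * (a + b + Y)" if "0 \<le> a" "0 \<le> b" "0 \<le> Y" for a b Y :: real
    using that unfolding distrib_left by simp
  from this[OF ab Y] show ?thesis unfolding 1 2 .
qed

text \<open>The second probability bound is the first at x = u, where <u, u> = 1, followed by the
  triangle inequality around sqrt (1 + b), which is nonnegative.\<close>

lemma singular_vector_bounds:
  defines "R \<equiv> \<lambda>t. sqrt t * ((\<sigma> * op_norm M + \<sigma>\<^sup>2 * sqrt (real (d2 * d3))) / g) + \<sigma>\<^sup>2 * real d1 / g * (\<delta> / g)"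
  shows "\<exists>b. - 1 / 2 \<le> b \<and> b \<le> 0 \<and> \<bar>b\<bar> \<le> sqrt 2 * \<delta> / g \<and>
      (\<forall>x\<in>carrier_vec d1. \<forall>t. ln 8 \<le> t \<and> t \<le> real d1 \<longrightarrow>
        1 - exp (- t) \<le> measure P {Z \<in> space P. \<bar>u_hat Z \<bullet> x - sqrt (1 + b) * (u \<bullet> x)\<bar> \<le> 300 * R t * vnorm x}) \<and>
      (\<forall>t. ln 8 \<le> t \<and> t \<le> real d1 \<longrightarrow>
        1 - exp (- t) \<le> measure P {Z \<in> space P. \<bar>\<bar>u_hat Z \<bullet> u\<bar> - 1\<bar> \<le> \<bar>sqrt (1 + b) - 1\<bar> + 300 * R t})"
proof -
  obtain b where b: "- 1 / 2 \<le> b" "b \<le> 0" "\<bar>b\<bar> \<le> sqrt 2 * \<delta> / g"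
    and dev: "\<And>x t. x \<in> carrier_vec d1 \<Longrightarrow> ln 8 \<le> t \<Longrightarrow> t \<le> real d1 \<Longrightarrow>
      1 - exp (- t) \<le> P.prob {Z \<in> space P. \<bar>u_hat Z \<bullet> x - sqrt (1 + b) * (u \<bullet> x)\<bar> \<le> 13 * lipschitz_const * \<sigma> * sqrt t * vnorm x}"
    by (rule singular_vector_deviation) (rule that)
  have t0: "0 \<le> t" if "ln 8 \<le> t" for t :: real
    using that ln_ge_zero[of 8] by linarith
  have main: "1 - exp (- t) \<le> P.prob {Z \<in> space P. \<bar>u_hat Z \<bullet> x - sqrt (1 + b) * (u \<bullet> x)\<bar> \<le> 300 * R t * vnorm x}"
    if x: "x \<in> carrier_vec d1" and t: "ln 8 \<le> t" "t \<le> real d1" for x t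
  proof -
    have [measurable]: "(\<lambda>Z. u_hat Z \<bullet> x) \<in> borel_measurable P" by (rule measurable_linear_form[OF x])
    have "13 * lipschitz_const * \<sigma> * sqrt t * vnorm x \<le> 300 * R t * vnorm x"
      unfolding R_def by (rule mult_right_mono[OF singular_vector_deviation_rate[OF t0[OF t(1)]] vnorm_nonneg])
    then have "P.prob {Z \<in> space P. \<bar>u_hat Z \<bullet> x - sqrt (1 + b) * (u \<bullet> x)\<bar> \<le> 13 * lipschitz_const * \<sigma> * sqrt t * vnorm x}
      \<le> P.prob {Z \<in> space P. \<bar>u_hat Z \<bullet> x - sqrt (1 + b) * (u \<bullet> x)\<bar> \<le> 300 * R t * vnorm x}"
      by (intro P.finite_measure_mono) auto
    then show ?thesis using dev[OF x t] by linarith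
  qed
  have self: "1 - exp (- t) \<le> P.prob {Z \<in> space P. \<bar>\<bar>u_hat Z \<bullet> u\<bar> - 1\<bar> \<le> \<bar>sqrt (1 + b) - 1\<bar> + 300 * R t}"
    if t: "ln 8 \<le> t" "t \<le> real d1" for t
  proof -
    have [measurable]: "(\<lambda>Z. u_hat Z \<bullet> u) \<in> borel_measurable P" by (rule measurable_linear_form[OF u_carrier(1)])
    have "0 \<le> sqrt (1 + b)" using b by simp
    then have "P.prob {Z \<in> space P. \<bar>u_hat Z \<bullet> u - sqrt (1 + b) * (u \<bullet> u)\<bar> \<le> 300 * R t * vnorm u}
      \<le> P.prob {Z \<in> space P. \<bar>\<bar>u_hat Z \<bullet> u\<bar> - 1\<bar> \<le> \<bar>sqrt (1 + b) - 1\<bar> + 300 * R t}"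
      unfolding u_carrier(2,3) mult_1_right by (intro P.finite_measure_mono) auto
    then show ?thesis using main[OF u_carrier(1) t] by linarith
  qed
  show ?thesis using b main self by (intro exI[of _ b]) simp
qed

end

theorem theorem1:
  shows "\<exists>D1>0. \<exists>D2>0.
    \<forall>(d1::nat) (d2::nat) (d3::nat) (\<sigma>::real) (A::tensor) (k::nat) (u::real vec)
      (u_hat :: tensor \<Rightarrow> real vec).
    let P = gaussian_tensor d1 d2 d3 \<sigma>;
        M = unfold1 d1 d2 d3 A;
        \<delta> = \<sigma> * sqrt (real d1) * op_norm M + \<sigma>\<^sup>2 * sqrt (real (d1 * d2 * d3));
        g = eigengap (M * M\<^sup>T) k;
        R = (\<lambda>t. sqrt t * ((\<sigma> * op_norm M + \<sigma>\<^sup>2 * sqrt (real (d2 * d3))) / g)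
                 + \<sigma>\<^sup>2 * real d1 / g * (\<delta> / g))
    in
      0 < \<sigma> \<and>
      real (d2 * d3) * exp (- real d1 / 2) \<le> 1 \<and>
      1 \<le> k \<and> k \<le> vec_space.rank d1 M \<and>
      count (mset (sing_vals M)) (sing_val M k) = 1 \<and>
      is_left_sing_vec M k u \<and>
      (\<forall>i<d1. (\<lambda>Z. vec_index (u_hat Z) i) \<in> borel_measurable P) \<and>
      (AE Z in P. is_left_sing_vec (unfold1 d1 d2 d3 (\<lambda>i. A i + Z i)) k (u_hat Z) \<and>
                  u_hat Z \<bullet> u > 0) \<and>
      g \<ge> D1 * \<delta>
      \<longrightarrow>
      (\<exists>b. - 1 / 2 \<le> b \<and> b \<le> 0 \<and> \<bar>b\<bar> \<le> sqrt 2 * \<delta> / g \<and>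
        (\<forall>x \<in> carrier_vec d1. \<forall>t. ln 8 \<le> t \<and> t \<le> real d1 \<longrightarrow>
           measure P {Z \<in> space P.
               \<bar>u_hat Z \<bullet> x - sqrt (1 + b) * (u \<bullet> x)\<bar> \<le> D2 * R t * vnorm x}
             \<ge> 1 - exp (- t)) \<and>
        (\<forall>t. ln 8 \<le> t \<and> t \<le> real d1 \<longrightarrow>
           measure P {Z \<in> space P.
               \<bar>\<bar>u_hat Z \<bullet> u\<bar> - 1\<bar> \<le> \<bar>sqrt (1 + b) - 1\<bar> + D2 * R t}
             \<ge> 1 - exp (- t)))"
\<comment> \<open>100000 exceeds 280^2 = 78400, as the bound on b needs, and it also makes 140 delta
  at most g / 10, as the perturbation lemmas need. 300 rounds up 260.\<close>
proof (rule exI[of _ 100000], rule conjI, simp, rule exI[of _ 300], rule conjI, simp, intro allI, unfold Let_def, intro impI, elim conjE)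
  fix d1 d2 d3 :: nat and \<sigma> :: real and A :: tensor and k :: nat and u :: "real vec" and u_hat :: "tensor \<Rightarrow> real vec"
  let ?M = "unfold1 d1 d2 d3 A" and ?P = "gaussian_tensor d1 d2 d3 \<sigma>"
  let ?\<delta> = "\<sigma> * sqrt (real d1) * op_norm ?M + \<sigma>\<^sup>2 * sqrt (real (d1 * d2 * d3))"
  let ?g = "eigengap (?M * ?M\<^sup>T) k"
  let ?R = "\<lambda>t. sqrt t * ((\<sigma> * op_norm ?M + \<sigma>\<^sup>2 * sqrt (real (d2 * d3))) / ?g) + \<sigma>\<^sup>2 * real d1 / ?g * (?\<delta> / ?g)"
  assume "0 < \<sigma>" "1 \<le> k" "is_left_sing_vec ?M k u"
    "\<forall>i<d1. (\<lambda>Z. vec_index (u_hat Z) i) \<in> borel_measurable ?P"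
    "AE Z in ?P. is_left_sing_vec (unfold1 d1 d2 d3 (\<lambda>i. A i + Z i)) k (u_hat Z) \<and> 0 < u_hat Z \<bullet> u"
    "100000 * ?\<delta> \<le> ?g"
  note singular_vector_bounds[OF this(1,2) refl refl refl refl refl this(3-6)]
  then show "\<exists>b\<ge>- 1 / 2. b \<le> 0 \<and> \<bar>b\<bar> \<le> sqrt 2 * ?\<delta> / ?g \<and>
      (\<forall>x\<in>carrier_vec d1. \<forall>t. ln 8 \<le> t \<and> t \<le> real d1 \<longrightarrow>
        1 - exp (- t) \<le> measure ?P {Z \<in> space ?P. \<bar>u_hat Z \<bullet> x - sqrt (1 + b) * (u \<bullet> x)\<bar> \<le> 300 * ?R t * vnorm x}) \<and>
      (\<forall>t. ln 8 \<le> t \<and> t \<le> real d1 \<longrightarrow>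
        1 - exp (- t) \<le> measure ?P {Z \<in> space ?P. \<bar>\<bar>u_hat Z \<bullet> u\<bar> - 1\<bar> \<le> \<bar>sqrt (1 + b) - 1\<bar> + 300 * ?R t})"
    by simp
qed

end
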